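(* There is an absolute constant $C<\infty$ such that for every function $K:\mathbb N\to\mathbb Z_{\ge0}$ with $K(n)=o(n)$ there is an index $n_0=n_0(K)$ such that, for all $n\ge n_0$ and all integers $0\le m\le K(n)$, the following holds. Let $R_m$ be uniformly random among the $m\times n$ Latin rectangles, put $d=n-m$ and $$B_{m,n}=n!\left(\frac dn\right)^n\exp\left(\frac m{2d}\right).$$ Then $$\mathbb E\left|\frac{X(R_m)}{B_{m,n}}-1\right|\le C\frac m{n^2},$$ and consequently $$\left|\frac{L_{m+1,n}}{L_{m,n}\,B_{m,n}}-1\right|\le C\frac m{n^2}.$$
   Context: An $m\times n$ Latin rectangle ($0\le m\le n$) is an $m\times n$ array with entries in $[n]=\{1,\dots,n\}$ such that every row is a permutation of $[n]$ and no symbol is repeated in a column. $L_{m,n}$ denotes the number of $m\times n$ Latin rectangles (rows ordered; rows, columns and symbols labelled), with $L_{0,n}=1$. For an $m\times n$ Latin rectangle $R$, $X(R)$ denotes the number of rows that can be appended to $R$ so as to obtain an $(m+1)\times n$ Latin rectangle; equivalently $X(R)=\operatorname{per}(A)$, where $A$ is the $n\times n$ zero–one matrix with $A_{cs}=1$ iff symbol $s$ does not occur in column $c$ of $R$. Since $K(n)=o(n)$, one has $K(n)<n$ for large $n$. "Absolute" means independent of $K$, $n$ and $m$. *)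

theory Defs
  imports "HOL-Probability.Probability" "HOL-Library.Landau_Symbols"
begin

(* An m x n array is the list of its m rows, each row a list of length n. Row and column
   positions are 0-based, the symbols are 1, ..., n. *)
definition latin_rectangles :: "nat \<Rightarrow> nat \<Rightarrow> nat list list set" where
  "latin_rectangles m n = {R. m \<le> n \<and> length R = m \<and>
     (\<forall>r\<in>set R. length r = n \<and> distinct r \<and> set r = {1..n}) \<and>
     (\<forall>c<n. distinct (map (\<lambda>r. r ! c) R))}"

definition latin_count :: "nat \<Rightarrow> nat \<Rightarrow> nat" where
  "latin_count m n = card (latin_rectangles m n)"

(* The width n is a parameter because the empty rectangle does not determine it. *)
definition extension_count :: "nat \<Rightarrow> nat list list \<Rightarrow> nat" where
  "extension_count n R = card {r. R @ [r] \<in> latin_rectangles (Suc (length R)) n}"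

definition extension_approx :: "nat \<Rightarrow> nat \<Rightarrow> real" where
  "extension_approx m n =
     (let d = real n - real m
      in fact n * (d / real n) ^ n * exp (real m / (2 * d)))"

lemma latin_count_0: "latin_count 0 n = 1"
proof -
  have "latin_rectangles 0 n = {[]}"
    by (auto simp: latin_rectangles_def)
  then show ?thesis
    by (simp add: latin_count_def)
qed

end

theory Submission
  imports Defs "HOL-Real_Asymp.Real_Asymp"
begin

text \<open>
The cells that a Latin rectangle \<open>R\<close> with \<open>m\<close> rows leaves open form a bipartite graph between
columns and symbols that is regular of degree \<open>d = n - m\<close>, and the rows that extend \<open>R\<close> are its
perfect matchings (\<open>extensions_bij\<close>). Appending a row \<open>r\<close> multiplies the number \<open>X\<close> of extensions by
the probability \<open>h(r)\<close> that a uniformly random perfect matching of this graph is disjoint from \<open>r\<close>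
(\<open>avoid\<close>). The approximation \<open>B\<close> has itself the ratio \<open>exp (- n / d) + O(n\<^sup>-\<^sup>2)\<close> between consecutive
values of \<open>m\<close> (\<open>approx_ratio_estimate\<close>). The quotient \<open>X / B\<close> starts at 1 for the empty rectangle, so
it stays close to 1 once \<open>h\<close>, as a function of a random matching \<open>r\<close>, has mean
\<open>exp (- n / d) + O(n\<^sup>-\<^sup>2)\<close> and variance \<open>O((m + 1) / n\<^sup>4)\<close>: over \<open>m\<close> steps the biases then add up to
\<open>O(m / n\<^sup>2)\<close> and the variances to \<open>O(m\<^sup>2 / n\<^sup>4)\<close>. Both facts are proved for a single graph \<open>E\<close> on
\<open>n + n\<close> vertices that is regular of degree \<open>D\<close> with \<open>n - D\<close> a small fraction of \<open>n\<close>.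

The basic estimate compares the matching counts of two subgraphs of \<open>E\<close> that are left after
deleting \<open>q\<close> rows and \<open>q\<close> columns and that differ in one column: they agree up to a factor
\<open>1 + O(q / n)\<close> (\<open>column_exchange\<close>). Both counts are expanded along the column in which they differ;
regularity makes the signed weights of the difference nearly cancel and density keeps them few, so
that an error at level \<open>q + 1\<close> enters at level \<open>q\<close> with a factor 1/4 only.

For the mean, let \<open>p(Q)\<close> be the probability that a random perfect matching contains the partial
matching \<open>Q\<close>. By inclusion and exclusion the mean of \<open>h\<close> is the alternating sum over \<open>q\<close> of the sums
of \<open>p(Q)\<^sup>2\<close> over all \<open>Q\<close> with \<open>q\<close> edges. The \<open>p(Q)\<close> with the same \<open>q\<close> agree up to a factor
\<open>1 + O(q\<^sup>2 / n)\<close>, their average is determined up to a factor \<open>1 + O(q\<^sup>3 / n\<^sup>2)\<close> by regularity alone, and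
their spread around the average enters the sum of squares quadratically, hence with the relative
error \<open>O(q\<^sup>4 / n\<^sup>2)\<close> (\<open>mean_hit_moment_estimate\<close>, \<open>mean_avoid_estimate\<close>). For one fixed \<open>r\<close> the spread
enters linearly, which gives only \<open>h(r) = exp (- n / d) + O(1 / n)\<close> (\<open>avoid_estimate\<close>).

For the variance, exchanging two edges of \<open>r\<close> for two others changes \<open>h\<close> by only
\<open>O((m + 1)\<^sup>2 / n\<^sup>4)\<close>: the change is a double sum of minors with signed weights, and the weights in one
of the two directions add up to 0 (\<open>switch_difference\<close>, \<open>switch_bound\<close>). Two matchings that differ in
\<open>k\<close> edges are joined by at most \<open>3 k\<close> exchanges (\<open>switch_path\<close>). A function with this Lipschitz
property is treated like a martingale: if the edges of the random matching are revealed one at a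
time, each of them moves the conditional mean by a multiple of the Lipschitz constant \<open>L\<close>
(\<open>matching_mean_oscillation\<close>), and the squares add up to \<open>O(n L\<^sup>2)\<close> (\<open>matching_variance_bound\<close>). The
remaining graph has to stay dense for this; averaging over the row to be revealed next keeps a
potential from growing that bounds the share of the bad histories (\<open>nonedge_potential_average\<close>).

Finally, summing a power \<open>Y\<^sup>p\<close> of \<open>Y = X / B\<close> over rectangles with \<open>m + 1\<close> rows is, up to a factor
close to 1, summing \<open>Y\<^sup>p\<^sup>+\<^sup>1\<close> over rectangles with \<open>m\<close> rows, since a rectangle has \<open>X = B Y\<close>
extensions. All exponents that occur are at most \<open>m + 2\<close>, so the factors multiply up to a constant
(\<open>moment_bounds\<close>). The same recursion for \<open>Y\<^sup>p (Y - 1)\<^sup>2\<close> adds \<open>O(m / n\<^sup>4)\<close> per row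
(\<open>deviation_recursion\<close>), which makes the mean of \<open>(Y - 1)\<^sup>2\<close> equal to \<open>O(m\<^sup>2 / n\<^sup>4)\<close>, and the
Cauchy-Schwarz inequality bounds the mean of \<open>\<bar>Y - 1\<bar>\<close>. As \<open>L\<^sub>m\<^sub>+\<^sub>1\<close> is the sum of \<open>X\<close> over the
rectangles with \<open>m\<close> rows, the second bound follows from the first by the triangle inequality. The
constants are uniform for \<open>m \<le> \<epsilon> n\<close> with an absolute \<open>\<epsilon> > 0\<close>, which eventually contains the range
\<open>m \<le> K(n)\<close>.
\<close>

section \<open>Counting perfect matchings of dense bipartite graphs\<close>

definition perfect_matchings :: "('a \<times> 'a) set \<Rightarrow> 'a set \<Rightarrow> 'a set \<Rightarrow> ('a \<times> 'a) set set" where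
  "perfect_matchings E S J = {M. M \<subseteq> E \<and> M \<subseteq> S \<times> J \<and>
     (\<forall>x\<in>S. \<exists>!j. (x, j) \<in> M) \<and> (\<forall>j\<in>J. \<exists>!x. (x, j) \<in> M)}"

definition matching_count :: "('a \<times> 'a) set \<Rightarrow> 'a set \<Rightarrow> 'a set \<Rightarrow> real" where
  "matching_count E S J = real (card (perfect_matchings E S J))"

abbreviation edge :: "('a \<times> 'a) set \<Rightarrow> 'a \<Rightarrow> 'a \<Rightarrow> real" where
  "edge E x j \<equiv> of_bool ((x, j) \<in> E)"

lemma finite_perfect_matchings:
  assumes "finite S" "finite J"
  shows "finite (perfect_matchings E S J)"
  by (rule finite_subset[of _ "Pow (S \<times> J)"]) (auto simp: perfect_matchings_def assms)

lemma perfect_matchings_converse: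
  "perfect_matchings (E\<inverse>) J S = converse ` perfect_matchings E S J"
proof -
  have 1: "M\<inverse> \<in> perfect_matchings (E\<inverse>) J S" if "M \<in> perfect_matchings E S J" for M and E :: "('a \<times> 'a) set" and S J
    using that unfolding perfect_matchings_def by auto
  show ?thesis
  proof
    show "perfect_matchings (E\<inverse>) J S \<subseteq> converse ` perfect_matchings E S J"
    proof
      fix M assume "M \<in> perfect_matchings (E\<inverse>) J S"
      from 1[OF this] have "M\<inverse> \<in> perfect_matchings E S J" by simp
      then show "M \<in> converse ` perfect_matchings E S J"
        by (metis converse_converse image_eqI)
    qed
    show "converse ` perfect_matchings E S J \<subseteq> perfect_matchings (E\<inverse>) J S"
      using 1 by blast
  qed
qed

lemma sum_perfect_matchings_converse:
  "(\<Sum>M\<in>perfect_matchings (E\<inverse>) J S. g M) = (\<Sum>M\<in>perfect_matchings E S J. g (M\<inverse>))"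
  unfolding perfect_matchings_converse
  by (subst sum.reindex) (auto simp: inj_on_def)

lemma matching_count_converse: "matching_count (E\<inverse>) J S = matching_count E S J"
  unfolding matching_count_def perfect_matchings_converse
  by (subst card_image) (auto simp: inj_on_def)

lemma insert_perfect_matching:
  assumes "x \<in> S" "j \<in> J" "(x, j) \<in> E" "M \<in> perfect_matchings E (S - {x}) (J - {j})"
  shows "insert (x, j) M \<in> perfect_matchings E S J"
proof -
  have M: "M \<subseteq> E" "M \<subseteq> (S - {x}) \<times> (J - {j})"
    "\<And>y. y \<in> S - {x} \<Longrightarrow> \<exists>!l. (y, l) \<in> M" "\<And>l. l \<in> J - {j} \<Longrightarrow> \<exists>!y. (y, l) \<in> M"
    using assms(4) by (auto simp: perfect_matchings_def)
  have "\<exists>!l. (y, l) \<in> insert (x, j) M" if "y \<in> S" for y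
  proof (cases "y = x")
    case True then show ?thesis using M(2) by auto
  next
    case False then show ?thesis using M(3)[of y] that by auto
  qed
  moreover have "\<exists>!y. (y, l) \<in> insert (x, j) M" if "l \<in> J" for l
  proof (cases "l = j")
    case True then show ?thesis using M(2) by auto
  next
    case False then show ?thesis using M(4)[of l] that by auto
  qed
  ultimately show ?thesis using assms M(1,2) unfolding perfect_matchings_def by auto
qed

lemma remove_perfect_matching:
  assumes "M \<in> perfect_matchings E S J" "(x, j) \<in> M"
  shows "M - {(x, j)} \<in> perfect_matchings E (S - {x}) (J - {j})"
proof -
  have M: "M \<subseteq> E" "M \<subseteq> S \<times> J"
    "\<And>y. y \<in> S \<Longrightarrow> \<exists>!l. (y, l) \<in> M" "\<And>l. l \<in> J \<Longrightarrow> \<exists>!y. (y, l) \<in> M"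
    using assms(1) by (auto simp: perfect_matchings_def)
  have "x \<in> S" "j \<in> J" using M(2) assms(2) by auto
  have 1: "l = j" if "(x, l) \<in> M" for l using M(3)[OF \<open>x \<in> S\<close>] assms(2) that by auto
  have 2: "y = x" if "(y, j) \<in> M" for y using M(4)[OF \<open>j \<in> J\<close>] assms(2) that by auto
  have "\<exists>!l. (y, l) \<in> M - {(x, j)}" if "y \<in> S - {x}" for y using M(3)[of y] that by auto
  moreover have "\<exists>!y. (y, l) \<in> M - {(x, j)}" if "l \<in> J - {j}" for l using M(4)[of l] that by auto
  moreover have "M - {(x, j)} \<subseteq> (S - {x}) \<times> (J - {j})" using M(2) 1 2 by auto
  ultimately show ?thesis using M(1) unfolding perfect_matchings_def by auto
qed

lemma sum_perfect_matchings_row: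
  fixes g :: "('a \<times> 'a) set \<Rightarrow> real"
  assumes fin: "finite S" "finite J" and x: "x \<in> S"
  shows "(\<Sum>M\<in>perfect_matchings E S J. g M) =
    (\<Sum>j\<in>J. edge E x j * (\<Sum>M\<in>perfect_matchings E (S - {x}) (J - {j}). g (insert (x, j) M)))"
proof -
  let ?P = "perfect_matchings E S J"
  let ?A = "\<lambda>j. {M \<in> ?P. (x, j) \<in> M}"
  have un: "?P = (\<Union>j\<in>J. ?A j)"
    using x unfolding perfect_matchings_def by blast
  have "(\<Sum>M\<in>?P. g M) = (\<Sum>j\<in>J. \<Sum>M\<in>?A j. g M)"
    apply (subst un, rule sum.UNION_disjoint)
    using fin x finite_perfect_matchings[OF fin] by (auto simp: perfect_matchings_def)
  also have "\<dots> = (\<Sum>j\<in>J. edge E x j * (\<Sum>M\<in>perfect_matchings E (S - {x}) (J - {j}). g (insert (x, j) M)))"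
  proof (rule sum.cong[OF refl])
    fix j assume j: "j \<in> J"
    show "(\<Sum>M\<in>?A j. g M) = edge E x j * (\<Sum>M\<in>perfect_matchings E (S - {x}) (J - {j}). g (insert (x, j) M))"
    proof (cases "(x, j) \<in> E")
      case False
      then have "?A j = {}" by (auto simp: perfect_matchings_def)
      then have "(\<Sum>M\<in>?A j. g M) = 0" by (simp only: sum.empty)
      then show ?thesis using False by simp
    next
      case True
      have "(\<Sum>M\<in>?A j. g M) = (\<Sum>M\<in>perfect_matchings E (S - {x}) (J - {j}). g (insert (x, j) M))"
      proof (rule sum.reindex_bij_witness[where i="\<lambda>M. insert (x, j) M" and j="\<lambda>M. M - {(x, j)}"])
        fix M assume M: "M \<in> perfect_matchings E (S - {x}) (J - {j})"
        then show "insert (x, j) M - {(x, j)} = M" by (auto simp: perfect_matchings_def)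
        show "insert (x, j) M \<in> ?A j" using insert_perfect_matching[OF x j True M] by auto
      qed (auto intro: remove_perfect_matching simp: insert_absorb)
      then show ?thesis using True by simp
    qed
  qed
  finally show ?thesis .
qed

lemma matching_count_row:
  assumes "finite S" "finite J" "x \<in> S"
  shows "matching_count E S J = (\<Sum>j\<in>J. edge E x j * matching_count E (S - {x}) (J - {j}))"
  using sum_perfect_matchings_row[OF assms, where g="\<lambda>_. 1" and E=E] by (simp add: matching_count_def)

lemma matching_count_column:
  assumes "finite S" "finite J" "j \<in> J"
  shows "matching_count E S J = (\<Sum>x\<in>S. edge E x j * matching_count E (S - {x}) (J - {j}))"
  using matching_count_row[OF assms(2,1,3), of "E\<inverse>"] by (simp add: matching_count_converse)

lemma matching_count_nonneg [simp]: "0 \<le> matching_count E S J"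
  by (simp add: matching_count_def)

definition dense_between :: "('a \<times> 'a) set \<Rightarrow> nat \<Rightarrow> 'a set \<Rightarrow> 'a set \<Rightarrow> bool" where
  "dense_between E z S J \<longleftrightarrow> finite S \<and> finite J \<and>
     (\<forall>x\<in>S. card {j\<in>J. (x, j) \<notin> E} \<le> z) \<and> (\<forall>j\<in>J. card {x\<in>S. (x, j) \<notin> E} \<le> z)"

lemma dense_between_converse: "dense_between (E\<inverse>) z J S \<longleftrightarrow> dense_between E z S J"
  by (auto simp: dense_between_def)

lemma dense_between_subset:
  assumes "dense_between E z S J" "S' \<subseteq> S" "J' \<subseteq> J"
  shows "dense_between E z S' J'"
proof -
  have fin: "finite S" "finite J" "finite S'" "finite J'"
    using assms by (auto simp: dense_between_def intro: finite_subset)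
  have "card {j\<in>J'. (x, j) \<notin> E} \<le> z" if "x \<in> S'" for x
  proof -
    have "card {j\<in>J'. (x, j) \<notin> E} \<le> card {j\<in>J. (x, j) \<notin> E}"
      using assms(3) fin by (intro card_mono) auto
    with that assms show ?thesis by (force simp: dense_between_def)
  qed
  moreover have "card {x\<in>S'. (x, j) \<notin> E} \<le> z" if "j \<in> J'" for j
  proof -
    have "card {x\<in>S'. (x, j) \<notin> E} \<le> card {x\<in>S. (x, j) \<notin> E}"
      using assms(2) fin by (intro card_mono) auto
    with that assms show ?thesis by (force simp: dense_between_def)
  qed
  ultimately show ?thesis using fin by (simp add: dense_between_def)
qed

text \<open>Write \<open>V y\<close> for the count without row \<open>y\<close>. A matching that omits row \<open>x\<close> turns into one that omits a
chosen other row \<open>y\<close> when the column of \<open>y\<close> is given to \<open>x\<close>; this fails only for the at most \<open>z\<close>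
columns that are not adjacent to \<open>x\<close>. Hence no single row carries much more than an average share of
the sum of all \<open>V y\<close>, in any dense graph.\<close>

lemma unbalanced_count_upper:
  assumes d: "dense_between E z S J" and c: "card S = Suc (card J)" and x: "x \<in> S"
  shows "(real (card J) - real z) * matching_count E (S - {x}) J
      \<le> (\<Sum>y\<in>S. matching_count E (S - {y}) J)"
proof -
  let ?V = "\<lambda>y. matching_count E (S - {y}) J"
  let ?T = "\<lambda>y l. matching_count E (S - {x} - {y}) (J - {l})"
  have fin: "finite S" "finite J" using d by (auto simp: dense_between_def)
  have Vx: "?V x = (\<Sum>l\<in>J. edge E y l * ?T y l)" if "y \<in> S - {x}" for y
    using that fin by (intro matching_count_row) auto
  have Vy: "?V y = (\<Sum>l\<in>J. edge E x l * ?T y l)" if "y \<in> S - {x}" for y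
  proof -
    have "S - {y} - {x} = S - {x} - {y}" by auto
    then show ?thesis using matching_count_row[of "S - {y}" J x E] that fin x by auto
  qed
  have cS: "card (S - {x}) = card J" using c x fin by simp
  \<comment> \<open>The count without row \<open>x\<close> is expanded along every other row \<open>y\<close>; replacing the edge at \<open>y\<close> by an edge at \<open>x\<close> turns the expansion into that of the count without \<open>y\<close>.\<close>
  have "real (card J) * ?V x = (\<Sum>y\<in>S - {x}. \<Sum>l\<in>J. edge E y l * ?T y l)"
  proof -
    have "(\<Sum>y\<in>S - {x}. \<Sum>l\<in>J. edge E y l * ?T y l) = (\<Sum>y\<in>S - {x}. ?V x)"
      by (rule sum.cong[OF refl]) (rule Vx[symmetric])
    then show ?thesis using cS by simp
  qed
  also have "\<dots> \<le> (\<Sum>y\<in>S - {x}. \<Sum>l\<in>J. edge E x l * ?T y l + (1 - edge E x l) * (edge E y l * ?T y l))"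
    by (intro sum_mono) auto
  also have "\<dots> = (\<Sum>y\<in>S - {x}. ?V y) + (\<Sum>y\<in>S - {x}. \<Sum>l\<in>J. (1 - edge E x l) * (edge E y l * ?T y l))"
    unfolding sum.distrib by (intro arg_cong2[where f="(+)"] sum.cong refl Vy[symmetric])
  also have "(\<Sum>y\<in>S - {x}. \<Sum>l\<in>J. (1 - edge E x l) * (edge E y l * ?T y l)) =
     (\<Sum>l\<in>J. (1 - edge E x l) * (\<Sum>y\<in>S - {x}. edge E y l * ?T y l))"
    by (subst sum.swap) (simp add: sum_distrib_left)
  also have "\<dots> = (\<Sum>l\<in>J. (1 - edge E x l) * ?V x)"
  proof (rule sum.cong[OF refl])
    fix l assume "l \<in> J"
    then show "(1 - edge E x l) * (\<Sum>y\<in>S - {x}. edge E y l * ?T y l) = (1 - edge E x l) * ?V x"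
      using matching_count_column[of "S - {x}" J l E] fin by simp
  qed
  also have "\<dots> = real (card {l\<in>J. (x, l) \<notin> E}) * ?V x"
  proof -
    have "(\<Sum>l\<in>J. (1 - edge E x l :: real)) = (\<Sum>l\<in>J. of_bool ((x,l) \<notin> E))"
      by (intro sum.cong) auto
    also have "\<dots> = real (card {l\<in>J. (x, l) \<notin> E})" using fin
      by (simp add: of_bool_def sum.If_cases Int_def)
    finally show ?thesis by (simp only: sum_distrib_right[symmetric])
  qed
  also have "\<dots> \<le> real z * ?V x"
    using d x by (intro mult_right_mono) (auto simp: dense_between_def)
  also have "(\<Sum>y\<in>S - {x}. ?V y) \<le> (\<Sum>y\<in>S. ?V y)"
    using fin by (intro sum_mono2) auto
  finally show ?thesis by (simp add: algebra_simps)
qed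

lemma matching_count_add_column:
  assumes "finite S" "finite J" "s \<notin> J"
  shows "matching_count E S (insert s J) = (\<Sum>y\<in>S. edge E y s * matching_count E (S - {y}) J)"
  using matching_count_column[of S "insert s J" s E] assms by simp

lemma sum_edges_lower:
  fixes V :: "'a \<Rightarrow> real"
  assumes "finite S" "\<And>y. y \<in> S \<Longrightarrow> V y \<le> b" "0 \<le> b" "card {y\<in>S. (y, s) \<notin> E} \<le> z"
  shows "(\<Sum>y\<in>S. V y) - real z * b \<le> (\<Sum>y\<in>S. edge E y s * V y)"
proof -
  have "(\<Sum>y\<in>S. V y) - (\<Sum>y\<in>S. edge E y s * V y) = (\<Sum>y\<in>S. of_bool ((y,s) \<notin> E) * V y)"
    by (subst sum_subtractf[symmetric], intro sum.cong) auto
  also have "\<dots> \<le> (\<Sum>y\<in>S. of_bool ((y,s) \<notin> E) * b)"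
    using assms by (intro sum_mono mult_left_mono) auto
  also have "\<dots> = real (card {y\<in>S. (y, s) \<notin> E}) * b"
    using assms(1) by (simp add: of_bool_def sum.If_cases Int_def flip: sum_distrib_right)
  also have "\<dots> \<le> real z * b" using assms by (intro mult_right_mono) auto
  finally show ?thesis by simp
qed

lemma unbalanced_count_bound:
  assumes d: "dense_between E z S J" and c: "card S = Suc (card J)" and x: "x \<in> S" and z: "z < card J"
  shows "matching_count E (S - {x}) J \<le> (\<Sum>y\<in>S. matching_count E (S - {y}) J) / (real (card J) - real z)"
  using unbalanced_count_upper[OF d c x] z by (simp add: field_simps)

text \<open>Both counts are sums of the counts with one row and the exchanged column removed, taken over the
neighbours of that column. The non-neighbours of \<open>s\<close> carry at most half of the total weight.
This crude form of \<open>column_exchange\<close> starts the recursion there.\<close>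

lemma column_exchange_factor_two:
  assumes d: "dense_between E z S (insert s J)" and c: "card S = Suc (card J)" and s: "s \<notin> J" "s' \<notin> J"
    and z: "3 * z \<le> card J"
  shows "matching_count E S (insert s' J) \<le> 2 * matching_count E S (insert s J)"
proof -
  let ?V = "\<lambda>y. matching_count E (S - {y}) J"
  let ?V0 = "\<Sum>y\<in>S. ?V y"
  have fin: "finite S" "finite J" using d by (auto simp: dense_between_def)
  have d': "dense_between E z S J" using d by (rule dense_between_subset) auto
  have V0: "0 \<le> ?V0" by (intro sum_nonneg) auto
  have up: "matching_count E S (insert s' J) \<le> ?V0"
    unfolding matching_count_add_column[OF fin s(2)] by (intro sum_mono) auto
  show ?thesis
  proof (cases "card J = 0")
    case True
    with z have z0: "z = 0" by simp
    have "?V0 - real 0 * ?V0 \<le> matching_count E S (insert s J)"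
      unfolding matching_count_add_column[OF fin s(1)] using d fin V0 z0
      by (intro sum_edges_lower) (auto simp: dense_between_def intro: member_le_sum)
    then show ?thesis using up V0 by simp
  next
    case False
    then have zz: "z < card J" using z by linarith
    let ?b = "?V0 / (real (card J) - real z)"
    have "?V0 - real z * ?b \<le> matching_count E S (insert s J)"
      unfolding matching_count_add_column[OF fin s(1)]
      using d fin V0 zz unbalanced_count_bound[OF d' c _ zz]
      by (intro sum_edges_lower) (auto simp: dense_between_def)
    moreover have "real z * ?b \<le> ?V0 / 2"
    proof -
      have "real z / (real (card J) - real z) \<le> 1 / 2" using z zz by (simp add: field_simps)
      then have "real z / (real (card J) - real z) * ?V0 \<le> 1 / 2 * ?V0" using V0 by (intro mult_right_mono)
      then show ?thesis by simp
    qed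
    ultimately show ?thesis using up by linarith
  qed
qed

text \<open>A random perfect matching uses a given edge with probability at most \<open>2 / (card J - z)\<close>: all columns
available to \<open>x\<close> have nearly equal minors. The statement also covers pairs that are not edges.\<close>

lemma minor_count_bound:
  assumes d: "dense_between E z S J" and c: "card S = card J" and x: "x \<in> S" "j \<in> J" and z: "3 * z + 2 \<le> card J"
  shows "(real (card J) - real z) * matching_count E (S - {x}) (J - {j}) \<le> 2 * matching_count E S J"
proof -
  let ?N = "\<lambda>l. matching_count E (S - {x}) (J - {l})"
  have fin: "finite S" "finite J" using d by (auto simp: dense_between_def)
  have le: "?N j \<le> 2 * ?N l" if l: "l \<in> J" for l
  proof (cases "l = j")
    case True then show ?thesis by simp
  next
    case False
    have 1: "J - {j} = insert l (J - {j} - {l})" "J - {l} = insert j (J - {j} - {l})" using x l False by auto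
    have c1: "card (J - {j} - {l}) = card J - 2" using x l False fin by auto
    have "matching_count E (S - {x}) (insert l (J - {j} - {l})) \<le> 2 * matching_count E (S - {x}) (insert j (J - {j} - {l}))"
    proof (rule column_exchange_factor_two)
      show "dense_between E z (S - {x}) (insert j (J - {j} - {l}))"
        using d by (rule dense_between_subset) (use x in auto)
      have "card (S - {x}) = card J - 1" using x c fin by simp
      then show "card (S - {x}) = Suc (card (J - {j} - {l}))" using c1 z by linarith
      show "3 * z \<le> card (J - {j} - {l})" using c1 z by linarith
    qed auto
    then show ?thesis using 1 by simp
  qed
  have "(real (card J) - real z) * ?N j = (\<Sum>l\<in>J. ?N j) - real z * ?N j"
    by (simp add: algebra_simps)
  also have "\<dots> \<le> (\<Sum>l\<in>J. edge (E\<inverse>) l x * ?N j)"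
    using d fin x by (intro sum_edges_lower) (auto simp: dense_between_def)
  also have "\<dots> \<le> (\<Sum>l\<in>J. edge E x l * (2 * ?N l))"
    using le by (intro sum_mono) (auto)
  also have "\<dots> = 2 * matching_count E S J"
    unfolding matching_count_row[OF fin x(1)] by (simp add: sum_distrib_left algebra_simps)
  finally show ?thesis .
qed

lemma matching_count_complete_pos:
  assumes "finite S" "finite J" "card S = card J"
  shows "0 < matching_count (S \<times> J) S J"
proof -
  obtain f where f: "bij_betw f S J"
    using finite_same_card_bij[OF assms] by blast
  have "(\<lambda>x. (x, f x)) ` S \<in> perfect_matchings (S \<times> J) S J"
    using f unfolding perfect_matchings_def bij_betw_def inj_on_def by auto
  then show ?thesis
    unfolding matching_count_def using finite_perfect_matchings[OF assms(1,2)] card_gt_0_iff by fastforce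
qed

lemma matching_count_edge_split:
  assumes fin: "finite S" "finite J" and x: "x \<in> S" "j \<in> J" and e: "(x, j) \<in> E"
  shows "matching_count E S J = matching_count (E - {(x, j)}) S J + matching_count E (S - {x}) (J - {j})"
proof -
  let ?E = "E - {(x, j)}"
  have eq: "matching_count ?E (S - {x}) J' = matching_count E (S - {x}) J'" for J'
    unfolding matching_count_def perfect_matchings_def
    by (rule arg_cong[where f="\<lambda>A. real (card A)"]) auto
  have "matching_count ?E S J = (\<Sum>l\<in>J. edge ?E x l * matching_count E (S - {x}) (J - {l}))"
    using matching_count_row[OF fin x(1), of ?E] by (simp add: eq)
  moreover have "matching_count E S J = (\<Sum>l\<in>J. (edge ?E x l + of_bool (l = j)) * matching_count E (S - {x}) (J - {l}))"
    unfolding matching_count_row[OF fin x(1), of E] using e by (intro sum.cong) auto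
  ultimately show ?thesis using fin x by (simp add: sum.distrib ring_distribs)
qed

lemma matching_count_cong:
  assumes "E \<inter> (S \<times> J) = E' \<inter> (S \<times> J)"
  shows "matching_count E S J = matching_count E' S J"
proof -
  have "perfect_matchings E S J = perfect_matchings E' S J"
    unfolding perfect_matchings_def using assms by (intro Collect_cong) blast
  then show ?thesis by (simp add: matching_count_def)
qed

text \<open>The missing edges are removed from the complete graph one at a time. By \<open>minor_count_bound\<close> each
removal destroys at most two thirds of the perfect matchings, so some always survive.\<close>

lemma matching_count_pos:
  assumes d: "dense_between E z S J" and c: "card S = card J" and z: "3 * z + 3 \<le> card J"
  shows "0 < matching_count E S J"
proof -
  have fin: "finite S" "finite J" using d by (auto simp: dense_between_def)
  have "0 < matching_count (S \<times> J - F) S J" if "finite F" "F \<subseteq> S \<times> J - E" for F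
    using that
  proof (induction F rule: finite_induct)
    case empty
    then show ?case using matching_count_complete_pos[OF fin c] by simp
  next
    case (insert e F)
    obtain x j where e: "e = (x, j)" by force
    have xj: "x \<in> S" "j \<in> J" "(x, j) \<in> S \<times> J - F" using insert e by auto
    let ?E = "S \<times> J - F"
    have sub: "E \<inter> (S \<times> J) \<subseteq> ?E" using insert.prems by auto
    have d': "dense_between ?E z S J"
    proof -
      have "card {j\<in>J. (x, j) \<notin> ?E} \<le> card {j\<in>J. (x, j) \<notin> E}" if "x \<in> S" for x
        using sub fin that by (intro card_mono) auto
      moreover have "card {x\<in>S. (x, j) \<notin> ?E} \<le> card {x\<in>S. (x, j) \<notin> E}" if "j \<in> J" for j
        using sub fin that by (intro card_mono) auto
      ultimately show ?thesis using d unfolding dense_between_def by (meson le_trans)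
    qed
    have pos: "0 < matching_count ?E S J" using insert by auto
    let ?N = "matching_count ?E (S - {x}) (J - {j})"
    have eq: "matching_count (S \<times> J - insert e F) S J = matching_count ?E S J - ?N"
    proof -
      have "S \<times> J - insert e F = ?E - {(x, j)}" by (auto simp: e)
      then show ?thesis using matching_count_edge_split[OF fin xj] by simp
    qed
    have "(real (card J) - real z) * ?N \<le> 2 * matching_count ?E S J"
      using z by (intro minor_count_bound[OF d' c xj(1,2)]) auto
    moreover have "3 * ?N \<le> (real (card J) - real z) * ?N" using z by (intro mult_right_mono) auto
    ultimately have "3 * ?N \<le> 2 * matching_count ?E S J" by linarith
    then have "?N < matching_count ?E S J" using pos by linarith
    then show ?case using eq by simp
  qed
  from this[of "S \<times> J - E"] have "0 < matching_count (S \<times> J - (S \<times> J - E)) S J"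
    using fin by auto
  also have "matching_count (S \<times> J - (S \<times> J - E)) S J = matching_count E S J"
    by (rule matching_count_cong) auto
  finally show ?thesis .
qed

section \<open>Minors of a regular graph are nearly equal\<close>

definition regular_between :: "('a \<times> 'a) set \<Rightarrow> nat \<Rightarrow> 'a set \<Rightarrow> 'a set \<Rightarrow> bool" where
  "regular_between E D V W \<longleftrightarrow> finite V \<and> finite W \<and> card V = card W \<and> E \<subseteq> V \<times> W \<and>
     (\<forall>x\<in>V. card {j\<in>W. (x, j) \<in> E} = D) \<and> (\<forall>j\<in>W. card {x\<in>V. (x, j) \<in> E} = D)"

lemma regular_between_converse:
  assumes "regular_between E D V W"
  shows "regular_between (E\<inverse>) D W V"
  using assms by (auto simp: regular_between_def)

lemma regular_imp_dense:
  assumes r: "regular_between E D V W" and z: "card W \<le> D + z"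
  shows "dense_between E z V W"
proof -
  have fin: "finite V" "finite W" using r by (auto simp: regular_between_def)
  have "card {j\<in>W. (x, j) \<notin> E} \<le> z" if "x \<in> V" for x
  proof -
    have "card {j\<in>W. (x, j) \<in> E} + card {j\<in>W. (x, j) \<notin> E} = card W"
      using fin by (subst card_Un_disjoint[symmetric]) (auto intro: arg_cong[where f=card])
    then show ?thesis using r that z by (auto simp: regular_between_def)
  qed
  moreover have "card {x\<in>V. (x, j) \<notin> E} \<le> z" if "j \<in> W" for j
  proof -
    have "card {x\<in>V. (x, j) \<in> E} + card {x\<in>V. (x, j) \<notin> E} = card V"
      using fin by (subst card_Un_disjoint[symmetric]) (auto intro: arg_cong[where f=card])
    then show ?thesis using r that z by (auto simp: regular_between_def)
  qed
  ultimately show ?thesis using fin by (simp add: dense_between_def)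
qed

lemma sum_edge_column:
  assumes "regular_between E D V W" "j \<in> W"
  shows "(\<Sum>x\<in>V. edge E x j) = (real D :: real)"
  using assms by (auto simp: regular_between_def of_bool_def sum.If_cases Int_def)

text \<open>For values that agree up to the factor \<open>1 + \<delta>\<close>, a signed sum consists of the total weight \<open>p\<close>, which
multiplies the common value, and the error \<open>\<delta>\<close>, which is met only by the positive weight \<open>z\<close>.\<close>

lemma signed_sum_bound:
  fixes a V :: "'b \<Rightarrow> real"
  assumes V: "\<And>y. y \<in> S \<Longrightarrow> v \<le> V y" "\<And>y. y \<in> S \<Longrightarrow> V y \<le> (1 + \<delta>) * v"
    and a: "(\<Sum>y\<in>S. a y) \<le> p" "(\<Sum>y\<in>S. max (a y) 0) \<le> z" and nn: "0 \<le> \<delta>" "0 \<le> v"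
  shows "(\<Sum>y\<in>S. a y * V y) \<le> (z * \<delta> + p) * v"
proof -
  have "(\<Sum>y\<in>S. a y * V y) \<le> (\<Sum>y\<in>S. v * a y + \<delta> * v * max (a y) 0)"
  proof (rule sum_mono)
    fix y assume y: "y \<in> S"
    show "a y * V y \<le> v * a y + \<delta> * v * max (a y) 0"
    proof (cases "0 \<le> a y")
      case True
      then have "a y * V y \<le> a y * ((1 + \<delta>) * v)" using V(2)[OF y] by (intro mult_left_mono)
      then show ?thesis using True by (simp add: algebra_simps)
    next
      case False
      then have "a y * V y \<le> a y * v" using V(1)[OF y] by (intro mult_left_mono_neg) auto
      then show ?thesis using False by (simp add: algebra_simps)
    qed
  qed
  also have "\<dots> = v * (\<Sum>y\<in>S. a y) + \<delta> * v * (\<Sum>y\<in>S. max (a y) 0)"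
    by (simp add: sum.distrib sum_distrib_left)
  also have "\<dots> \<le> v * p + \<delta> * v * z"
    using a nn by (intro add_mono mult_left_mono) auto
  finally show ?thesis by (simp add: algebra_simps)
qed

lemma sum_edge_subset_bounds:
  assumes r: "regular_between E D V W" and j: "j \<in> W" and S: "S \<subseteq> V"
  shows "(\<Sum>x\<in>S. edge E x j) \<le> real D" "real D - real (card (V - S)) \<le> (\<Sum>x\<in>S. edge E x j)"
proof -
  have fin: "finite V" using r by (auto simp: regular_between_def)
  have eq: "(\<Sum>x\<in>V. edge E x j) = (\<Sum>x\<in>S. edge E x j) + (\<Sum>x\<in>V - S. (edge E x j :: real))"
    using sum.subset_diff[OF S fin] by (metis add.commute)
  have "(\<Sum>x\<in>V - S. (edge E x j :: real)) \<le> (\<Sum>x\<in>V - S. 1)" by (intro sum_mono) auto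
  moreover have "0 \<le> (\<Sum>x\<in>V - S. (edge E x j :: real))" by (intro sum_nonneg) auto
  ultimately show "(\<Sum>x\<in>S. edge E x j) \<le> real D" "real D - real (card (V - S)) \<le> (\<Sum>x\<in>S. edge E x j)"
    using eq sum_edge_column[OF r j] by auto
qed

lemma sum_positive_part_edges:
  assumes d: "dense_between E z S J" and S: "S' \<subseteq> S" and s: "s \<in> J"
  shows "(\<Sum>y\<in>S'. max (edge E y s' - edge E y s) 0) \<le> real z"
proof -
  have fin: "finite S" "finite S'" using d S by (auto simp: dense_between_def intro: finite_subset)
  have "(\<Sum>y\<in>S'. max (edge E y s' - edge E y s) 0) \<le> (\<Sum>y\<in>S'. (of_bool ((y, s) \<notin> E) :: real))"
    by (intro sum_mono) auto
  also have "\<dots> = real (card {y\<in>S'. (y, s) \<notin> E})" using fin by (simp add: of_bool_def sum.If_cases Int_def)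
  also have "\<dots> \<le> real (card {y\<in>S. (y, s) \<notin> E})" using S fin by (intro of_nat_mono card_mono) auto
  also have "\<dots> \<le> real z" using d s by (auto simp: dense_between_def)
  finally show ?thesis .
qed

text \<open>With \<open>r\<^sub>q\<close> the relative error after the deletion of \<open>q\<close> rows and columns, expanding along the exchanged
column gives \<open>r\<^sub>q \<le> 2 q / n + r\<^sub>q\<^sub>+\<^sub>1 / 4\<close>: the weights are differences of two columns of the graph, whose
sum is at most \<open>q\<close> by regularity and whose positive part is at most \<open>z \<le> n / 10\<close>. The values
compared after the expansion differ in one deleted row, so rows and columns change roles in the
induction. After \<open>k\<close> levels the crude factor 2 contributes \<open>4\<^sup>-\<^sup>k\<close>.\<close>

lemma column_exchange_recursion:
  assumes "regular_between E D V W" and "card V \<le> D + z" "10 * z \<le> card V"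
    and "1 \<le> q" "8 * (q + k) \<le> card V"
    and "S \<subseteq> V" "card S + q = card V" "J \<subseteq> W" "card J + q + 1 = card V"
    and "s \<in> W - J" "s' \<in> W - J"
  shows "matching_count E S (insert s' J) \<le>
    (1 + 4 * real q / real (card V) + (1/4) ^ k) * matching_count E S (insert s J)"
  using assms
proof (induction k arbitrary: E V W q S J s s')
  case (0 E V W q S J s s')
  have d: "dense_between E z V W"
    using 0 by (intro regular_imp_dense) (auto simp: regular_between_def)
  have "matching_count E S (insert s' J) \<le> 2 * matching_count E S (insert s J)"
    using 0 by (intro column_exchange_factor_two[of E z]) (auto intro: dense_between_subset[OF d])
  also have "\<dots> \<le> (1 + 4 * real q / real (card V) + (1/4) ^ 0) * matching_count E S (insert s J)"
    by (intro mult_right_mono) auto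
  finally show ?case .
next
  case (Suc k E V W q S J s s')
  let ?n = "real (card V)"
  have r: "regular_between E D V W" by fact
  have d: "dense_between E z V W"
    using Suc.prems by (intro regular_imp_dense) (auto simp: regular_between_def)
  have finVW: "finite V" "finite W" "card W = card V" using r by (auto simp: regular_between_def)
  have fin: "finite S" "finite J" using finVW Suc.prems by (auto intro: finite_subset)
  have npos: "?n > 0" using Suc.prems by auto
  define \<delta> where "\<delta> = 4 * real (q + 1) / ?n + (1/4) ^ k"
  have d0: "0 \<le> \<delta>" by (simp add: \<delta>_def)
  define U where "U y = matching_count E (S - {y}) J" for y
  \<comment> \<open>The sets \<open>S - {y}\<close> and \<open>S - {y'}\<close> differ in one row, so the induction hypothesis applies to the transposed graph.\<close>
  have ratio: "U y \<le> (1 + \<delta>) * U y'" if y: "y \<in> S" "y' \<in> S" for y y'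
  proof (cases "y = y'")
    case True
    then show ?thesis using d0 by (simp add: U_def mult_right_mono algebra_simps)
  next
    case False
    have eqs: "S - {y} = insert y' (S - {y} - {y'})" "S - {y'} = insert y (S - {y} - {y'})"
      using y False by auto
    have cS: "card (S - {y} - {y'}) = card S - 2" using y False fin by auto
    have "matching_count (E\<inverse>) J (insert y' (S - {y} - {y'})) \<le>
       (1 + 4 * real (q + 1) / real (card W) + (1/4) ^ k) * matching_count (E\<inverse>) J (insert y (S - {y} - {y'}))"
      using Suc.prems y fin finVW cS False
      by (intro Suc.IH[of _ W V] regular_between_converse) (auto)
    then show ?thesis
      using eqs finVW by (simp add: U_def matching_count_converse \<delta>_def add.assoc)
  qed
  define v where "v = Min (U ` S)"
  have Sne: "S \<noteq> {}" using Suc.prems by auto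
  have v1: "v \<le> U y" if "y \<in> S" for y unfolding v_def using fin that by auto
  have "v \<in> U ` S" unfolding v_def using fin Sne by (intro Min_in) auto
  then obtain y0 where y0: "y0 \<in> S" "v = U y0" by auto
  have v2: "U y \<le> (1 + \<delta>) * v" if "y \<in> S" for y using ratio[OF that y0(1)] y0 by simp
  have v0: "0 \<le> v" by (simp add: y0 U_def)
  have cV: "card (V - S) = q" using Suc.prems fin by (simp add: card_Diff_subset)
  let ?w' = "matching_count E S (insert s' J)" and ?w = "matching_count E S (insert s J)"
  have w': "?w' = (\<Sum>y\<in>S. edge E y s' * U y)" and w: "?w = (\<Sum>y\<in>S. edge E y s * U y)"
    using Suc.prems fin by (auto simp: matching_count_add_column U_def)
  have b: "real D - real q \<le> (\<Sum>x\<in>S. edge E x s)" "(\<Sum>x\<in>S. edge E x s') \<le> real D"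
    using sum_edge_subset_bounds[OF r _ \<open>S \<subseteq> V\<close>] Suc.prems cV by auto
  have "?w' - ?w = (\<Sum>y\<in>S. (edge E y s' - edge E y s) * U y)"
    by (simp add: w w' sum_subtractf left_diff_distrib)
  also have "\<dots> \<le> (real z * \<delta> + real q) * v"
  proof (rule signed_sum_bound[OF v1 v2])
    show "(\<Sum>y\<in>S. edge E y s' - edge E y s) \<le> real q" using b by (simp add: sum_subtractf)
    show "(\<Sum>y\<in>S. max (edge E y s' - edge E y s) 0) \<le> real z"
      using sum_positive_part_edges[OF d \<open>S \<subseteq> V\<close>] Suc.prems by auto
  qed (use d0 v0 in auto)
  finally have 1: "?w' - ?w \<le> (real z * \<delta> + real q) * v" .
  have "(real D - real q) * v \<le> (\<Sum>x\<in>S. edge E x s) * v" using b v0 by (intro mult_right_mono)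
  also have "\<dots> \<le> ?w" unfolding w sum_distrib_right using v1 by (intro sum_mono mult_left_mono) auto
  finally have 2: "(real D - real q) * v \<le> ?w" .
  have Dq: "real D - real q \<ge> (31/40) * ?n"
  proof -
    have "10 * z \<le> card V" "card V \<le> D + z" "8 * q \<le> card V" using Suc.prems(2,3,5) by auto
    then have "10 * real z \<le> ?n" "?n \<le> real D + real z" "8 * real q \<le> ?n"
      by linarith+
    then show ?thesis by linarith
  qed
  have zq: "10 * real z \<le> ?n" using Suc.prems(3) by linarith
  have "real z * \<delta> + real q \<le> (\<delta> / 4 + 2 * real q / ?n) * (real D - real q)"
  proof -
    have "real z * \<delta> \<le> ((31/40) * ?n / 4) * \<delta>" using zq d0 by (intro mult_right_mono) auto
    also have "\<dots> \<le> ((real D - real q) / 4) * \<delta>" using Dq d0 by (intro mult_right_mono) auto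
    finally have a: "real z * \<delta> \<le> ((real D - real q) / 4) * \<delta>" .
    have "real q = 2 * real q / ?n * (1/2 * ?n)" using npos by simp
    also have "\<dots> \<le> 2 * real q / ?n * (real D - real q)" using Dq npos by (intro mult_left_mono) auto
    finally show ?thesis using a unfolding distrib_right by (simp add: mult.commute)
  qed
  then have "(real z * \<delta> + real q) * v \<le> (\<delta> / 4 + 2 * real q / ?n) * (real D - real q) * v"
    using v0 by (intro mult_right_mono)
  also have "\<dots> \<le> (\<delta> / 4 + 2 * real q / ?n) * ?w"
    using 2 d0 npos by (simp add: mult.assoc mult_left_mono)
  finally have 3: "?w' \<le> (1 + (\<delta> / 4 + 2 * real q / ?n)) * ?w" using 1 by (simp add: algebra_simps)
  have "\<delta> / 4 + 2 * real q / ?n \<le> 4 * real q / ?n + (1/4) ^ Suc k"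
  proof -
    have "real (q + 1) / ?n + 2 * real q / ?n \<le> 4 * real q / ?n"
      using npos Suc.prems by (simp add: field_simps)
    moreover have "\<delta> / 4 = real (q + 1) / ?n + (1/4) ^ Suc k"
      unfolding \<delta>_def by (simp add: add_divide_distrib)
    ultimately show ?thesis by linarith
  qed
  then have "(1 + (\<delta> / 4 + 2 * real q / ?n)) * ?w \<le> (1 + 4 * real q / ?n + (1/4) ^ Suc k) * ?w"
    by (intro mult_right_mono) auto
  with 3 show ?case by linarith
qed

lemma column_exchange:
  assumes r: "regular_between E D V W" and z: "card V \<le> D + z" "10 * z \<le> card V" and n: "64 \<le> card V"
    and q: "1 \<le> q" "16 * q \<le> card V"
    and S: "S \<subseteq> V" "card S + q = card V" and J: "J \<subseteq> W" "card J + q + 1 = card V"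
    and s: "s \<in> W - J" "s' \<in> W - J"
  shows "matching_count E S (insert s' J) \<le> (1 + 5 * real q / real (card V)) * matching_count E S (insert s J)"
proof -
  let ?n = "real (card V)"
  \<comment> \<open>The depth is the largest that keeps the deleted part below an eighth of the graph; it makes \<open>4\<^sup>-\<^sup>k\<close> negligible against \<open>1 / n\<close>.\<close>
  define k where "k = card V div 8 - q"
  have k: "8 * (q + k) \<le> card V" "card V < 16 * (k + 1)" using q by (auto simp: k_def)
  have k4: "3 \<le> k" using k(2) n by presburger
  have "16 * (k + 1) \<le> 4 ^ k"
    using k4 by (induction k rule: dec_induct) auto
  then have "card V \<le> 4 ^ k" using k(2) by linarith
  then have "?n \<le> real (4 ^ k)" by (rule of_nat_mono)
  then have "?n \<le> 4 ^ k" by simp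
  then have "(1/4) ^ k \<le> 1 / ?n" using n by (simp add: power_one_over field_simps)
  also have "\<dots> \<le> real q / ?n" using q by (intro divide_right_mono) auto
  finally have "(1/4) ^ k \<le> real q / ?n" .
  moreover have "5 * real q / ?n = 4 * real q / ?n + real q / ?n" by (simp add: add_divide_distrib[symmetric])
  ultimately have "1 + 4 * real q / ?n + (1/4) ^ k \<le> 1 + 5 * real q / ?n" by linarith
  moreover have "matching_count E S (insert s' J) \<le>
    (1 + 4 * real q / ?n + (1/4) ^ k) * matching_count E S (insert s J)"
    by (rule column_exchange_recursion) (use assms k in auto)
  ultimately show ?thesis by (meson matching_count_nonneg mult_right_mono order_trans)
qed

text \<open>The matchings are sorted by what the rows \<open>c\<close> and \<open>c'\<close> do: both use the columns \<open>a\<close> and \<open>b\<close>, only \<open>c\<close>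
does, only \<open>c'\<close> does, or neither does.\<close>

lemma two_row_expansion:
  assumes fin: "finite V" "finite J" and c: "c \<in> V" "c' \<in> V" "c \<noteq> c'"
    and ab: "a \<notin> J" "b \<notin> J" "a \<noteq> b"
    and e: "(c, a) \<in> E" "(c', b) \<in> E" "(c, b) \<notin> E" "(c', a) \<notin> E"
  shows "matching_count E V (insert a (insert b J)) =
    matching_count E (V - {c, c'}) J
    + (\<Sum>l\<in>J. edge E c' l * matching_count E (V - {c, c'}) (insert b (J - {l})))
    + (\<Sum>l\<in>J. edge E c l * (matching_count E (V - {c, c'}) (insert a (J - {l}))
        + (\<Sum>l'\<in>J - {l}. edge E c' l' * matching_count E (V - {c, c'}) (insert a (insert b (J - {l, l'}))))))"
proof -
  let ?W = "insert a (insert b J)"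
  have V: "V - {c} - {c'} = V - {c, c'}" by auto
  have 1: "matching_count E V ?W = matching_count E (V - {c}) (insert b J)
      + (\<Sum>l\<in>J. edge E c l * matching_count E (V - {c}) (?W - {l}))"
    using fin c ab e by (subst matching_count_row[of V ?W c]) (auto simp: insert_Diff_if)
  have 2: "matching_count E (V - {c}) (insert b J) = matching_count E (V - {c, c'}) J
      + (\<Sum>l\<in>J. edge E c' l * matching_count E (V - {c, c'}) (insert b (J - {l})))"
  proof -
    have "matching_count E (V - {c}) (insert b J) =
      edge E c' b * matching_count E (V - {c} - {c'}) (insert b J - {b}) +
      (\<Sum>l\<in>J. edge E c' l * matching_count E (V - {c} - {c'}) (insert b J - {l}))"
      using fin c ab e by (subst matching_count_row[of "V - {c}" "insert b J" c']) auto
    also have "(\<Sum>l\<in>J. edge E c' l * matching_count E (V - {c} - {c'}) (insert b J - {l}))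
      = (\<Sum>l\<in>J. edge E c' l * matching_count E (V - {c, c'}) (insert b (J - {l})))"
      using ab by (intro sum.cong refl) (auto simp: V insert_Diff_if)
    finally show ?thesis using e ab by (simp add: V)
  qed
  have 3: "matching_count E (V - {c}) (?W - {l}) = matching_count E (V - {c, c'}) (insert a (J - {l}))
        + (\<Sum>l'\<in>J - {l}. edge E c' l' * matching_count E (V - {c, c'}) (insert a (insert b (J - {l, l'}))))"
    if l: "l \<in> J" for l
  proof -
    have W: "?W - {l} = insert a (insert b (J - {l}))" using l ab by auto
    have "matching_count E (V - {c}) (?W - {l}) =
      edge E c' b * matching_count E (V - {c} - {c'}) (insert a (insert b (J - {l})) - {b}) +
      (\<Sum>l'\<in>J - {l}. edge E c' l' * matching_count E (V - {c} - {c'}) (insert a (insert b (J - {l})) - {l'}))"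
      unfolding W
      using fin c ab e by (subst matching_count_row[of "V - {c}" "insert a (insert b (J - {l}))" c']) auto
    also have "(\<Sum>l'\<in>J - {l}. edge E c' l' * matching_count E (V - {c} - {c'}) (insert a (insert b (J - {l})) - {l'}))
      = (\<Sum>l'\<in>J - {l}. edge E c' l' * matching_count E (V - {c, c'}) (insert a (insert b (J - {l, l'}))))"
    proof (rule sum.cong[OF refl])
      fix l' assume "l' \<in> J - {l}"
      then have "insert a (insert b (J - {l})) - {l'} = insert a (insert b (J - {l, l'}))" using ab by auto
      then show "edge E c' l' * matching_count E (V - {c} - {c'}) (insert a (insert b (J - {l})) - {l'})
         = edge E c' l' * matching_count E (V - {c, c'}) (insert a (insert b (J - {l, l'})))"
        by (simp add: V)
    qed
    also have "insert a (insert b (J - {l})) - {b} = insert a (J - {l})" using ab by auto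
    finally show ?thesis using e by (simp add: V)
  qed
  have "(\<Sum>l\<in>J. edge E c l * matching_count E (V - {c}) (?W - {l})) =
    (\<Sum>l\<in>J. edge E c l * (matching_count E (V - {c, c'}) (insert a (J - {l}))
        + (\<Sum>l'\<in>J - {l}. edge E c' l' * matching_count E (V - {c, c'}) (insert a (insert b (J - {l, l'}))))))"
    by (intro sum.cong refl) (simp add: 3)
  then show ?thesis using 1 2 by simp
qed

text \<open>Only the terms of \<open>two_row_expansion\<close> in which exactly one of the two rows uses an exchanged edge change
under the exchange. In their difference the four rows and columns appear through the differences
of their neighbourhoods, one factor for the columns and one for the rows.\<close>

lemma switch_difference:
  assumes fin: "finite V" "finite J" and c: "c \<in> V" "c' \<in> V" "c \<noteq> c'"
    and ab: "s \<notin> J" "s' \<notin> J" "s \<noteq> s'"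
    and e: "(c, s') \<in> E" "(c', s) \<in> E" "(c, s) \<notin> E" "(c', s') \<notin> E"
  defines "E' \<equiv> E - {(c, s'), (c', s)} \<union> {(c, s), (c', s')}"
  shows "matching_count E' V (insert s (insert s' J)) - matching_count E V (insert s (insert s' J)) =
    (\<Sum>q\<in>V - {c, c'}. (edge E q s' - edge E q s) *
       (\<Sum>l\<in>J. (edge E c' l - edge E c l) * matching_count E (V - {c, c'} - {q}) (J - {l})))"
proof -
  let ?V = "V - {c, c'}"
  have same: "matching_count E' ?V X = matching_count E ?V X" for X
    by (rule matching_count_cong) (auto simp: E'_def)
  have ed: "edge E' c l = edge E c l" "edge E' c' l = edge E c' l" if "l \<in> J" for l
    using that ab by (auto simp: E'_def)
  have I1: "matching_count E V (insert s (insert s' J)) = matching_count E ?V J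
    + (\<Sum>l\<in>J. edge E c' l * matching_count E ?V (insert s (J - {l})))
    + (\<Sum>l\<in>J. edge E c l * (matching_count E ?V (insert s' (J - {l}))
        + (\<Sum>l'\<in>J - {l}. edge E c' l' * matching_count E ?V (insert s (insert s' (J - {l, l'}))))))"
    using two_row_expansion[OF fin c ab(2,1) ab(3)[symmetric] e(1,2,3,4)] by (simp add: insert_commute)
  have I2: "matching_count E' V (insert s (insert s' J)) = matching_count E ?V J
    + (\<Sum>l\<in>J. edge E c' l * matching_count E ?V (insert s' (J - {l})))
    + (\<Sum>l\<in>J. edge E c l * (matching_count E ?V (insert s (J - {l}))
        + (\<Sum>l'\<in>J - {l}. edge E c' l' * matching_count E ?V (insert s (insert s' (J - {l, l'}))))))"
  proof -
    have e': "(c, s) \<in> E'" "(c', s') \<in> E'" "(c, s') \<notin> E'" "(c', s) \<notin> E'"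
      using c ab by (auto simp: E'_def)
    have "matching_count E' V (insert s (insert s' J)) = matching_count E' ?V J
    + (\<Sum>l\<in>J. edge E' c' l * matching_count E' ?V (insert s' (J - {l})))
    + (\<Sum>l\<in>J. edge E' c l * (matching_count E' ?V (insert s (J - {l}))
        + (\<Sum>l'\<in>J - {l}. edge E' c' l' * matching_count E' ?V (insert s (insert s' (J - {l, l'}))))))"
      by (rule two_row_expansion[OF fin c ab e'])
    also have "\<dots> = matching_count E ?V J
    + (\<Sum>l\<in>J. edge E c' l * matching_count E ?V (insert s' (J - {l})))
    + (\<Sum>l\<in>J. edge E c l * (matching_count E ?V (insert s (J - {l}))
        + (\<Sum>l'\<in>J - {l}. edge E c' l' * matching_count E ?V (insert s (insert s' (J - {l, l'}))))))"
      unfolding same by (intro arg_cong2[where f="(+)"] sum.cong refl arg_cong2[where f="(*)"] ed) auto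
    finally show ?thesis .
  qed
  have G: "matching_count E ?V (insert t (J - {l})) =
     (\<Sum>q\<in>?V. edge E q t * matching_count E (?V - {q}) (J - {l}))" if "t \<notin> J" for t l
    using fin that by (intro matching_count_add_column) auto
  have "matching_count E' V (insert s (insert s' J)) - matching_count E V (insert s (insert s' J)) =
    (\<Sum>l\<in>J. (edge E c' l - edge E c l) *
      (matching_count E ?V (insert s' (J - {l})) - matching_count E ?V (insert s (J - {l}))))"
    unfolding I1 I2 by (simp add: sum.distrib sum_subtractf algebra_simps)
  also have "\<dots> = (\<Sum>l\<in>J. (edge E c' l - edge E c l) *
      (\<Sum>q\<in>?V. (edge E q s' - edge E q s) * matching_count E (?V - {q}) (J - {l})))"
    using ab by (simp add: G sum_subtractf left_diff_distrib)
  also have "\<dots> = (\<Sum>q\<in>?V. (edge E q s' - edge E q s) *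
       (\<Sum>l\<in>J. (edge E c' l - edge E c l) * matching_count E (?V - {q}) (J - {l})))"
    unfolding sum_distrib_left by (subst sum.swap) (intro sum.cong refl; simp add: algebra_simps)
  finally show ?thesis .
qed

lemma iterated_minor_bound:
  assumes d: "dense_between E z V W" and c: "card V = card W" and n: "64 \<le> card V" "10 * z \<le> card V"
    and x: "x \<in> V" "x' \<in> V" "x'' \<in> V" "distinct [x, x', x'']"
    and j: "j \<in> W" "j' \<in> W" "j'' \<in> W" "distinct [j, j', j'']"
  shows "matching_count E (V - {x} - {x'} - {x''}) (W - {j} - {j'} - {j''})
    \<le> 64 / real (card V) ^ 3 * matching_count E V W"
proof -
  let ?n = "real (card V)"
  have fin: "finite V" "finite W" using d by (auto simp: dense_between_def)
  have step: "matching_count E (S - {y}) (J - {l}) \<le> 4 / ?n * matching_count E S J"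
    if S: "S \<subseteq> V" "J \<subseteq> W" "card S = card J" "card J + 2 \<ge> card V" "y \<in> S" "l \<in> J" for S J y l
  proof -
    have d': "dense_between E z S J" using d S(1,2) by (rule dense_between_subset)
    have "(real (card J) - real z) * matching_count E (S - {y}) (J - {l}) \<le> 2 * matching_count E S J"
      using S n by (intro minor_count_bound[OF d']) auto
    moreover have "?n / 2 \<le> real (card J) - real z"
    proof -
      have "10 * real z \<le> ?n" "real (card J) + 2 \<ge> ?n" "64 \<le> ?n" using n S by linarith+
      then show ?thesis by linarith
    qed
    then have "?n / 2 * matching_count E (S - {y}) (J - {l}) \<le> (real (card J) - real z) * matching_count E (S - {y}) (J - {l})"
      by (intro mult_right_mono) auto
    ultimately show ?thesis using n by (simp add: field_simps)
  qed
  have p: "0 \<le> 4 / ?n" by simp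
  have "matching_count E (V - {x} - {x'} - {x''}) (W - {j} - {j'} - {j''}) \<le> 4 / ?n * matching_count E (V - {x} - {x'}) (W - {j} - {j'})"
    using x j fin c by (intro step) auto
  also have "\<dots> \<le> 4 / ?n * (4 / ?n * matching_count E (V - {x}) (W - {j}))"
    using x j fin c by (intro mult_left_mono step p) auto
  also have "\<dots> \<le> 4 / ?n * (4 / ?n * (4 / ?n * matching_count E V W))"
    using x j fin c by (intro mult_left_mono step p) auto
  finally show ?thesis by (simp add: power3_eq_cube)
qed

text \<open>In the double sum of \<open>switch_difference\<close> each minor is \<open>O(n\<^sup>-\<^sup>3)\<close> of the whole count. The inner weights add
up to 0 because the rows \<open>c\<close> and \<open>c'\<close> have the same degree, so only the relative variation
\<open>O(1 / n)\<close> of the minors remains; the weights have size \<open>O(z)\<close> in both directions.\<close>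

lemma switch_bound:
  assumes r: "regular_between E D V W" and z: "card V \<le> D + z" "10 * z \<le> card V" and n: "64 \<le> card V"
    and c: "c \<in> V" "c' \<in> V" "c \<noteq> c'" and s: "s \<in> W" "s' \<in> W" "s \<noteq> s'"
    and e: "(c, s') \<in> E" "(c', s) \<in> E" "(c, s) \<notin> E" "(c', s') \<notin> E"
  shows "\<bar>matching_count (E - {(c, s'), (c', s)} \<union> {(c, s), (c', s')}) V W - matching_count E V W\<bar>
    \<le> 1920 * real z ^ 2 / real (card V) ^ 4 * matching_count E V W"
proof -
  let ?n = "real (card V)"
  have fin: "finite V" "finite W" and cVW: "card V = card W" using r by (auto simp: regular_between_def)
  have d: "dense_between E z V W" using r z cVW by (intro regular_imp_dense) auto
  have d': "dense_between (E\<inverse>) z W V" using d by (simp add: dense_between_converse)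
  have npos: "0 < ?n" using n by linarith
  define J where "J = W - {s, s'}"
  define V0 where "V0 = V - {c, c'}"
  have W: "W = insert s (insert s' J)" and sJ: "s \<notin> J" "s' \<notin> J" using s by (auto simp: J_def)
  have finJ: "finite J" "finite V0" using fin by (auto simp: J_def V0_def)
  have cJ: "card J + 2 = card V" "card V0 + 2 = card V"
    using s c fin cVW n by (auto simp: J_def V0_def card_Diff_subset)
  define U where "U q l = matching_count E (V0 - {q}) (J - {l})" for q l
  let ?w = "matching_count E V W"
  have Ub: "U q l \<le> 64 / ?n ^ 3 * ?w" if "q \<in> V0" "l \<in> J" for q l
  proof -
    have "V0 - {q} = V - {c} - {c'} - {q}" "J - {l} = W - {s} - {s'} - {l}" by (auto simp: V0_def J_def)
    then show ?thesis unfolding U_def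
      using iterated_minor_bound[OF d cVW n z(2), of c c' q s s' l] that c s by (auto simp: V0_def J_def)
  qed
  have Ur: "U q l \<le> (1 + 15 / ?n) * U q l'" if "q \<in> V0" "l \<in> J" "l' \<in> J" for q l l'
  proof (cases "l = l'")
    case True
    then show ?thesis by (simp add: U_def mult_right_mono algebra_simps)
  next
    case False
    have 1: "J - {l} = insert l' (J - {l} - {l'})" "J - {l'} = insert l (J - {l} - {l'})" using that False by auto
    have "matching_count E (V0 - {q}) (insert l' (J - {l} - {l'})) \<le>
       (1 + 5 * real 3 / ?n) * matching_count E (V0 - {q}) (insert l (J - {l} - {l'}))"
    proof (rule column_exchange[OF r z n])
      have "card (V0 - {q}) = card V0 - 1" using that finJ by simp
      moreover have cl: "card (J - {l} - {l'}) = card J - 2" using that finJ False by auto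
      ultimately show "card (V0 - {q}) + 3 = card V" "card (J - {l} - {l'}) + 3 + 1 = card V"
        using cJ n by linarith+
    qed (use that n in \<open>auto simp: V0_def J_def\<close>)
    then show ?thesis using 1 by (simp add: U_def)
  qed
  define a where "a l = edge E c' l - (edge E c l :: real)" for l
  define b where "b q = edge E q s' - (edge E q s :: real)" for q
  have row: "(\<Sum>l\<in>J. (edge E x l :: real)) = real D - 1" if "x = c \<or> x = c'" for x
  proof -
    have "(\<Sum>l\<in>W. (edge E x l :: real)) = real D"
      using sum_edge_column[OF regular_between_converse[OF r], of x] that c by auto
    moreover have "(\<Sum>l\<in>W. (edge E x l :: real)) = 1 + (\<Sum>l\<in>J. edge E x l)"
      unfolding W using finJ sJ s e that by auto
    ultimately show ?thesis by simp
  qed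
  have a0: "(\<Sum>l\<in>J. a l) = 0" by (simp add: a_def sum_subtractf row)
  have ap: "(\<Sum>l\<in>J. max (a l) 0) \<le> real z" "(\<Sum>l\<in>J. max (- a l) 0) \<le> real z"
    using sum_positive_part_edges[OF d', of J c c'] sum_positive_part_edges[OF d', of J c' c] c
    by (auto simp: a_def J_def)
  have babs: "(\<Sum>q\<in>V0. \<bar>b q\<bar>) \<le> 2 * real z"
  proof -
    have "(\<Sum>q\<in>V0. \<bar>b q\<bar>) = (\<Sum>q\<in>V0. max (edge E q s' - edge E q s) 0) + (\<Sum>q\<in>V0. max (edge E q s - edge E q s') 0)"
      unfolding sum.distrib[symmetric] by (intro sum.cong) (auto simp: b_def)
    also have "\<dots> \<le> real z + real z"
      using s by (intro add_mono sum_positive_part_edges[OF d]) (auto simp: V0_def)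
    finally show ?thesis by simp
  qed
  have w0: "0 \<le> ?w" by simp
  have inner: "\<bar>\<Sum>l\<in>J. a l * U q l\<bar> \<le> real z * (15 / ?n) * (64 / ?n ^ 3 * ?w)" if q: "q \<in> V0" for q
  proof -
    define v where "v = Min (U q ` J)"
    have Jne: "J \<noteq> {}" using cJ n by auto
    have v1: "v \<le> U q l" if "l \<in> J" for l unfolding v_def using finJ that by auto
    have "v \<in> U q ` J" unfolding v_def using finJ Jne by (intro Min_in) auto
    then obtain l0 where l0: "l0 \<in> J" "v = U q l0" by auto
    have v2: "U q l \<le> (1 + 15 / ?n) * v" if "l \<in> J" for l using Ur[OF q that l0(1)] l0 by simp
    have v0: "0 \<le> v" by (simp add: l0 U_def)
    have "(\<Sum>l\<in>J. a l * U q l) \<le> (real z * (15 / ?n) + 0) * v"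
      by (rule signed_sum_bound[OF v1 v2]) (use a0 ap v0 in auto)
    moreover have "(\<Sum>l\<in>J. - a l * U q l) \<le> (real z * (15 / ?n) + 0) * v"
      by (rule signed_sum_bound[OF v1 v2]) (use a0 ap v0 in \<open>auto simp: sum_negf\<close>)
    ultimately have "\<bar>\<Sum>l\<in>J. a l * U q l\<bar> \<le> real z * (15 / ?n) * v" by (simp add: sum_negf abs_le_iff)
    also have "\<dots> \<le> real z * (15 / ?n) * (64 / ?n ^ 3 * ?w)"
      using Ub[OF q l0(1)] l0 by (intro mult_left_mono) auto
    finally show ?thesis .
  qed
  have "matching_count (E - {(c, s'), (c', s)} \<union> {(c, s), (c', s')}) V W - ?w =
     (\<Sum>q\<in>V0. b q * (\<Sum>l\<in>J. a l * U q l))"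
    using switch_difference[OF fin(1) finJ(1) c sJ s(3) e] by (simp add: W a_def b_def U_def V0_def)
  also have "\<bar>\<dots>\<bar> \<le> (\<Sum>q\<in>V0. \<bar>b q\<bar> * \<bar>\<Sum>l\<in>J. a l * U q l\<bar>)"
    by (rule order_trans[OF sum_abs]) (simp add: abs_mult)
  also have "\<dots> \<le> (\<Sum>q\<in>V0. \<bar>b q\<bar> * (real z * (15 / ?n) * (64 / ?n ^ 3 * ?w)))"
    by (intro sum_mono mult_left_mono inner) auto
  also have "\<dots> = (\<Sum>q\<in>V0. \<bar>b q\<bar>) * (real z * (15 / ?n) * (64 / ?n ^ 3 * ?w))"
    by (rule sum_distrib_right[symmetric])
  also have "\<dots> \<le> 2 * real z * (real z * (15 / ?n) * (64 / ?n ^ 3 * ?w))"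
    using babs w0 by (intro mult_right_mono) auto
  also have "\<dots> = 1920 * real z ^ 2 / ?n ^ 4 * ?w"
    by (simp add: power2_eq_square power3_eq_cube power4_eq_xxxx)
  finally show ?thesis .
qed

section \<open>Exchanging two edges connects all matchings\<close>

lemma perfect_matching_edgeD:
  assumes "M \<in> perfect_matchings E S J" "(x, j) \<in> M"
  shows "(x, j) \<in> E" "x \<in> S" "j \<in> J"
  using assms by (auto simp: perfect_matchings_def)

lemma perfect_matching_unique:
  assumes M: "M \<in> perfect_matchings E S J"
  shows "(x, j) \<in> M \<Longrightarrow> (x, j') \<in> M \<Longrightarrow> j = j'" "(x, j) \<in> M \<Longrightarrow> (x', j) \<in> M \<Longrightarrow> x = x'"
proof -
  have 1: "M \<subseteq> S \<times> J" "\<forall>x\<in>S. \<exists>!j. (x, j) \<in> M" "\<forall>j\<in>J. \<exists>!x. (x, j) \<in> M"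
    using M by (auto simp: perfect_matchings_def)
  show "j = j'" if "(x, j) \<in> M" "(x, j') \<in> M"
  proof -
    have "x \<in> S" using 1(1) that by auto
    then show ?thesis using 1(2) that by auto
  qed
  show "x = x'" if "(x, j) \<in> M" "(x', j) \<in> M"
  proof -
    have "j \<in> J" using 1(1) that by auto
    then show ?thesis using 1(3) that by auto
  qed
qed

lemma perfect_matching_partner:
  assumes M: "M \<in> perfect_matchings E S J"
  shows "x \<in> S \<Longrightarrow> \<exists>j. (x, j) \<in> M" "j \<in> J \<Longrightarrow> \<exists>x. (x, j) \<in> M"
proof -
  have 1: "\<forall>x\<in>S. \<exists>!j. (x, j) \<in> M" "\<forall>j\<in>J. \<exists>!x. (x, j) \<in> M"
    using M by (auto simp: perfect_matchings_def)
  show "x \<in> S \<Longrightarrow> \<exists>j. (x, j) \<in> M" "j \<in> J \<Longrightarrow> \<exists>x. (x, j) \<in> M"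
    using 1 by (meson ex1_implies_ex)+
qed

lemma perfect_matching_finite:
  assumes "M \<in> perfect_matchings E S J" "finite S" "finite J"
  shows "finite M"
  by (rule finite_subset[of _ "S \<times> J"]) (use assms in \<open>auto simp: perfect_matchings_def\<close>)

lemma perfect_matching_fst:
  assumes M: "M \<in> perfect_matchings E S J"
  shows "bij_betw fst M S"
  unfolding bij_betw_def
proof
  show "inj_on fst M"
    using perfect_matching_unique(1)[OF M] by (auto intro!: inj_onI)
  show "fst ` M = S"
  proof
    show "fst ` M \<subseteq> S" using perfect_matching_edgeD(2)[OF M] by auto
    show "S \<subseteq> fst ` M" using perfect_matching_partner(1)[OF M] by (metis fst_conv image_eqI subsetI)
  qed
qed

lemma perfect_matching_snd:
  assumes M: "M \<in> perfect_matchings E S J"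
  shows "bij_betw snd M J"
  unfolding bij_betw_def
proof
  show "inj_on snd M"
    using perfect_matching_unique(2)[OF M] by (auto intro!: inj_onI)
  show "snd ` M = J"
  proof
    show "snd ` M \<subseteq> J" using perfect_matching_edgeD(3)[OF M] by auto
    show "J \<subseteq> snd ` M" using perfect_matching_partner(2)[OF M] by (metis snd_conv image_eqI subsetI)
  qed
qed

lemma perfect_matching_card:
  assumes "M \<in> perfect_matchings E S J"
  shows "card M = card S" "card M = card J"
  using bij_betw_same_card[OF perfect_matching_fst[OF assms]] bij_betw_same_card[OF perfect_matching_snd[OF assms]]
  by simp_all

lemma perfect_matching_swap:
  assumes M: "M \<in> perfect_matchings E S J" and e: "(x, a) \<in> M" "(y, b) \<in> M" "x \<noteq> y"
    and E: "(x, b) \<in> E" "(y, a) \<in> E"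
  shows "insert (x, b) (insert (y, a) (M - {(x, a), (y, b)})) \<in> perfect_matchings E S J"
proof -
  have ab: "a \<noteq> b" using perfect_matching_unique(2)[OF M e(1), of y] e by blast
  have in1: "x \<in> S" "a \<in> J" "y \<in> S" "b \<in> J" using perfect_matching_edgeD[OF M] e by auto
  have "M - {(x, a)} - {(y, b)} \<in> perfect_matchings E (S - {x} - {y}) (J - {a} - {b})"
    using e by (intro remove_perfect_matching M) auto
  also have "M - {(x, a)} - {(y, b)} = M - {(x, a), (y, b)}" by auto
  also have "J - {a} - {b} = J - {b} - {a}" by auto
  finally show ?thesis
    using in1 e ab E by (intro insert_perfect_matching) auto
qed

text \<open>The condition is restricted to matchings at distance at most \<open>K\<close> because \<open>switch_path\<close> joins only
matchings that share many edges. It is applied to matchings that differ in two edges and, once all but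
\<open>K\<close> rows are fixed, to all pairs.\<close>

definition lipschitz_upto :: "nat \<Rightarrow> real \<Rightarrow> (('a \<times> 'a) set \<Rightarrow> real) \<Rightarrow> ('a \<times> 'a) set \<Rightarrow> 'a set \<Rightarrow> 'a set \<Rightarrow> bool" where
  "lipschitz_upto K \<kappa> g E S J \<longleftrightarrow> (\<forall>M\<in>perfect_matchings E S J. \<forall>M'\<in>perfect_matchings E S J.
     card (M - M') \<le> K \<longrightarrow> \<bar>g M - g M'\<bar> \<le> \<kappa> * real (card (M - M')))"

text \<open>Each of the four adjacencies fails for at most \<open>z\<close> edges of the matching, and \<open>card (M - M')\<close> edges are
not shared.\<close>

lemma helper_edge_exists:
  assumes d: "dense_between E z V W" and c: "card V = card W"
    and M: "M \<in> perfect_matchings E V W" "M' \<in> perfect_matchings E V W"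
    and k: "card (M - M') + 4 * z < card V"
    and ab: "a \<in> W" "b \<in> W" "y \<in> V" "w \<in> V"
  shows "\<exists>h l. (h, l) \<in> M \<and> (h, l) \<in> M' \<and> (h, a) \<in> E \<and> (h, b) \<in> E \<and> (y, l) \<in> E \<and> (w, l) \<in> E"
proof (rule ccontr)
  assume no: "\<not> ?thesis"
  have fin: "finite V" "finite W" using d by (auto simp: dense_between_def)
  have finM: "finite M" using perfect_matching_finite[OF M(1) fin] .
  have 1: "card {e\<in>M. (fst e, t) \<notin> E} \<le> z" if "t \<in> W" for t
  proof -
    have "card {e\<in>M. (fst e, t) \<notin> E} \<le> card {h\<in>V. (h, t) \<notin> E}"
    proof (rule card_inj_on_le[where f=fst])
      show "inj_on fst {e\<in>M. (fst e, t) \<notin> E}"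
        using perfect_matching_fst[OF M(1)] by (auto simp: bij_betw_def intro: inj_on_subset)
      show "fst ` {e\<in>M. (fst e, t) \<notin> E} \<subseteq> {h\<in>V. (h, t) \<notin> E}"
        using perfect_matching_edgeD(2)[OF M(1)] by auto
    qed (use fin in auto)
    then show ?thesis using d that unfolding dense_between_def by force
  qed
  have 2: "card {e\<in>M. (t, snd e) \<notin> E} \<le> z" if "t \<in> V" for t
  proof -
    have "card {e\<in>M. (t, snd e) \<notin> E} \<le> card {l\<in>W. (t, l) \<notin> E}"
    proof (rule card_inj_on_le[where f=snd])
      show "inj_on snd {e\<in>M. (t, snd e) \<notin> E}"
        using perfect_matching_snd[OF M(1)] by (auto simp: bij_betw_def intro: inj_on_subset)
      show "snd ` {e\<in>M. (t, snd e) \<notin> E} \<subseteq> {l\<in>W. (t, l) \<notin> E}"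
        using perfect_matching_edgeD(3)[OF M(1)] by auto
    qed (use fin in auto)
    then show ?thesis using d that unfolding dense_between_def by force
  qed
  have "M \<subseteq> (M - M') \<union> {e\<in>M. (fst e, a) \<notin> E} \<union> {e\<in>M. (fst e, b) \<notin> E} \<union> {e\<in>M. (y, snd e) \<notin> E} \<union> {e\<in>M. (w, snd e) \<notin> E}"
    using no by force
  then have "card M \<le> card ((M - M') \<union> {e\<in>M. (fst e, a) \<notin> E} \<union> {e\<in>M. (fst e, b) \<notin> E} \<union> {e\<in>M. (y, snd e) \<notin> E} \<union> {e\<in>M. (w, snd e) \<notin> E})"
    using finM by (intro card_mono) auto
  also have "\<dots> \<le> card (M - M') + card {e\<in>M. (fst e, a) \<notin> E} + card {e\<in>M. (fst e, b) \<notin> E} + card {e\<in>M. (y, snd e) \<notin> E} + card {e\<in>M. (w, snd e) \<notin> E}"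
    by (intro order_trans[OF card_Un_le] add_mono order_refl)
  also have "\<dots> \<le> card (M - M') + z + z + z + z"
    using 1 2 ab by (intro add_mono) auto
  finally show False using k perfect_matching_card[OF M(1)] by linarith
qed

text \<open>To put an edge \<open>(x, b)\<close> of \<open>M'\<close> into \<open>M\<close>, the two edges of \<open>M\<close> at \<open>x\<close> and at \<open>b\<close> are exchanged. If the
remaining two ends are not adjacent, a common edge \<open>(h, l)\<close> serves as an intermediary: three
exchanges then put two edges of \<open>M'\<close> into \<open>M\<close> at the price of the shared edge \<open>(h, l)\<close>. In both cases
the distance to \<open>M'\<close> decreases.\<close>

lemma switch_path:
  fixes g :: "('a \<times> 'a) set \<Rightarrow> real"
  assumes d: "dense_between E z V W" and c: "card V = card W"
    and g: "\<And>M x a y b. M \<in> perfect_matchings E V W \<Longrightarrow> (x, a) \<in> M \<Longrightarrow> (y, b) \<in> M \<Longrightarrow> x \<noteq> y \<Longrightarrow>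
       (x, b) \<in> E \<Longrightarrow> (y, a) \<in> E \<Longrightarrow> \<bar>g (insert (x, b) (insert (y, a) (M - {(x, a), (y, b)}))) - g M\<bar> \<le> L"
    and l0: "0 \<le> L"
    and M: "M \<in> perfect_matchings E V W" "M' \<in> perfect_matchings E V W" "card (M - M') + 4 * z < card V"
  shows "\<bar>g M - g M'\<bar> \<le> 3 * L * real (card (M - M'))"
  using M
proof (induction "card (M - M')" arbitrary: M rule: less_induct)
  case (less M)
  note M = less.prems(1) and M' = less.prems(2)
  have fin: "finite V" "finite W" using d by (auto simp: dense_between_def)
  have finM: "finite M" "finite M'" using perfect_matching_finite[OF _ fin] M M' by auto
  show ?case
  proof (cases "M \<subseteq> M'")
    case True
    then have "M = M'" using perfect_matching_card[OF M] perfect_matching_card[OF M'] finM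
      by (metis card_subset_eq)
    then show ?thesis by simp
  next
    case False
    then obtain x a where xa: "(x, a) \<in> M" "(x, a) \<notin> M'" by auto
    note U = perfect_matching_unique[OF M] and U' = perfect_matching_unique[OF M']
    have xV: "x \<in> V" "a \<in> W" using perfect_matching_edgeD[OF M xa(1)] by auto
    obtain b where b: "(x, b) \<in> M'" using perfect_matching_partner(1)[OF M' xV(1)] by auto
    have ab: "a \<noteq> b" using b xa by auto
    have bW: "b \<in> W" "(x, b) \<in> E" using perfect_matching_edgeD[OF M' b] by auto
    obtain y where y: "(y, b) \<in> M" using perfect_matching_partner(2)[OF M bW(1)] by auto
    have yV: "y \<in> V" using perfect_matching_edgeD[OF M y] by auto
    have xy: "x \<noteq> y" using U(1) y xa ab by auto
    have yb: "(y, b) \<notin> M'" using U'(2) b xy by auto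
    \<comment> \<open>One unit of distance pays for the at most three exchanges, each costing \<open>L\<close>, that lead to \<open>N\<close>.\<close>
    have closer: "\<bar>g N - g M'\<bar> \<le> 3 * L * (real (card (M - M')) - 1)"
      if N: "N \<in> perfect_matchings E V W" "card (N - M') < card (M - M')" for N
    proof -
      have "\<bar>g N - g M'\<bar> \<le> 3 * L * real (card (N - M'))"
        using less.hyps[OF N(2) N(1) M'] N(2) less.prems(3) by linarith
      also have "\<dots> \<le> 3 * L * (real (card (M - M')) - 1)"
        using N(2) l0 by (intro mult_left_mono) auto
      finally show ?thesis .
    qed
    show ?thesis
    proof (cases "(y, a) \<in> E")
      case True
      define N where "N = insert (x, b) (insert (y, a) (M - {(x, a), (y, b)}))"
      have N: "N \<in> perfect_matchings E V W"
        unfolding N_def using perfect_matching_swap[OF M xa(1) y xy bW(2) True] .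
      have gN: "\<bar>g N - g M\<bar> \<le> L" unfolding N_def by (rule g[OF M xa(1) y xy bW(2) True])
      have "card (N - M') < card (M - M')"
      proof -
        have "N - M' \<subseteq> insert (y, a) (M - M' - {(x, a), (y, b)})" using b by (auto simp: N_def)
        then have "card (N - M') \<le> card (insert (y, a) (M - M' - {(x, a), (y, b)}))"
          using finM by (intro card_mono) auto
        also have "\<dots> \<le> Suc (card (M - M' - {(x, a), (y, b)}))" by (rule card_insert_le_m1) auto
        also have "\<dots> = card (M - M') - 1"
        proof -
          have "card {(x, a), (y, b)} \<le> card (M - M')" using finM xa y yb by (intro card_mono) auto
          then have "2 \<le> card (M - M')" using xy by simp
          then show ?thesis using finM xa y yb xy by (subst card_Diff_subset) auto
        qed
        also have "\<dots> < card (M - M')"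
        proof -
          have "M - M' \<noteq> {}" using xa by auto
          then have "0 < card (M - M')" using finM by (simp add: card_gt_0_iff)
          then show ?thesis by simp
        qed
        finally show ?thesis .
      qed
      from closer[OF N this] gN l0 show ?thesis by (simp add: algebra_simps)
    next
      case False
      obtain cc where cc: "(y, cc) \<in> M'" using perfect_matching_partner(1)[OF M' yV] by auto
      have cW: "cc \<in> W" "(y, cc) \<in> E" using perfect_matching_edgeD[OF M' cc] by auto
      have cne: "cc \<noteq> b" "cc \<noteq> a" using cc yb cW False by auto
      obtain w where w: "(w, cc) \<in> M" using perfect_matching_partner(2)[OF M cW(1)] by auto
      have wV: "w \<in> V" using perfect_matching_edgeD[OF M w] by auto
      have wne: "w \<noteq> y" "w \<noteq> x" using U(1) w y xa cne by auto
      have wc: "(w, cc) \<notin> M'" using U'(2) cc wne by auto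
      obtain h l where hl: "(h, l) \<in> M" "(h, l) \<in> M'" "(h, a) \<in> E" "(h, b) \<in> E" "(y, l) \<in> E" "(w, l) \<in> E"
        using helper_edge_exists[OF d c M M' less.prems(3) xV(2) bW(1) yV wV] by auto
      have hne: "h \<noteq> x" "h \<noteq> y" "h \<noteq> w" using U(1)[OF hl(1)] hl(2) xa y yb w wc by auto
      have lne: "l \<noteq> a" "l \<noteq> b" "l \<noteq> cc" using U(2)[OF hl(1)] xa y w hne by auto
      \<comment> \<open>The column \<open>b\<close> is parked at \<open>h\<close>, then passed on to \<open>x\<close>, and finally \<open>y\<close> receives its column in \<open>M'\<close>.\<close>
      define N1 where "N1 = insert (y, l) (insert (h, b) (M - {(y, b), (h, l)}))"
      define N2 where "N2 = insert (x, b) (insert (h, a) (N1 - {(x, a), (h, b)}))"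
      define N3 where "N3 = insert (y, cc) (insert (w, l) (N2 - {(y, l), (w, cc)}))"
      have N1: "N1 \<in> perfect_matchings E V W" "\<bar>g N1 - g M\<bar> \<le> L"
        unfolding N1_def using perfect_matching_swap[OF M y hl(1) hne(2)[symmetric] hl(5,4)]
          g[OF M y hl(1) hne(2)[symmetric] hl(5,4)] by auto
      have in1: "(x, a) \<in> N1" "(h, b) \<in> N1" using xa xy hne by (auto simp: N1_def)
      have N2: "N2 \<in> perfect_matchings E V W" "\<bar>g N2 - g N1\<bar> \<le> L"
        unfolding N2_def using perfect_matching_swap[OF N1(1) in1 hne(1)[symmetric] bW(2) hl(3)]
          g[OF N1(1) in1 hne(1)[symmetric] bW(2) hl(3)] by auto
      have in2: "(y, l) \<in> N2" "(w, cc) \<in> N2" using xy hne wne w lne cne by (auto simp: N1_def N2_def)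
      have N3: "N3 \<in> perfect_matchings E V W" "\<bar>g N3 - g N2\<bar> \<le> L"
        unfolding N3_def using perfect_matching_swap[OF N2(1) in2 wne(1)[symmetric] cW(2) hl(6)]
          g[OF N2(1) in2 wne(1)[symmetric] cW(2) hl(6)] by auto
      have "card (N3 - M') < card (M - M')"
      proof -
        let ?R = "{(x, a), (y, b), (w, cc)}"
        have "N3 - M' \<subseteq> insert (h, a) (insert (w, l) (M - M' - ?R))"
          using b cc by (auto simp: N1_def N2_def N3_def)
        then have "card (N3 - M') \<le> card (insert (h, a) (insert (w, l) (M - M' - ?R)))"
          using finM by (intro card_mono) auto
        also have "\<dots> \<le> Suc (Suc (card (M - M' - ?R)))"
          using finM by (simp add: card_insert_if)
        also have "\<dots> < card (M - M')"
        proof -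
          have R: "card ?R = 3" "?R \<subseteq> M - M'" using xy wne xa y yb w wc by auto
          then have "3 \<le> card (M - M')" using finM by (metis card_mono finite_Diff)
          then show ?thesis using R finM by (subst card_Diff_subset) auto
        qed
        finally show ?thesis .
      qed
      from closer[OF N3(1) this] N1 N2 N3 l0 show ?thesis by (simp add: algebra_simps)
    qed
  qed
qed

lemma lipschitz_upto_insert:
  assumes "lipschitz_upto K \<kappa> g E S J" "x \<in> S" "j \<in> J" "(x, j) \<in> E"
  shows "lipschitz_upto K \<kappa> (\<lambda>M. g (insert (x, j) M)) E (S - {x}) (J - {j})"
  unfolding lipschitz_upto_def
proof (intro ballI impI)
  fix M M' assume M: "M \<in> perfect_matchings E (S - {x}) (J - {j})" "M' \<in> perfect_matchings E (S - {x}) (J - {j})"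
    and c: "card (M - M') \<le> K"
  have eq: "insert (x, j) M - insert (x, j) M' = M - M'"
    using perfect_matching_edgeD(2)[OF M(1)] by auto
  show "\<bar>g (insert (x, j) M) - g (insert (x, j) M')\<bar> \<le> \<kappa> * real (card (M - M'))"
    using assms(1) insert_perfect_matching[OF assms(2-4)] M c unfolding lipschitz_upto_def
    by (metis eq)
qed

lemma lipschitz_upto_converse:
  assumes "lipschitz_upto K \<kappa> g E S J"
  shows "lipschitz_upto K \<kappa> (\<lambda>M. g (M\<inverse>)) (E\<inverse>) J S"
  unfolding lipschitz_upto_def
proof (intro ballI impI)
  fix M M' assume M: "M \<in> perfect_matchings (E\<inverse>) J S" "M' \<in> perfect_matchings (E\<inverse>) J S"
    and c: "card (M - M') \<le> K"
  have "M\<inverse> \<in> perfect_matchings E S J" "M'\<inverse> \<in> perfect_matchings E S J"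
    using M by (auto simp: perfect_matchings_converse)
  moreover have "card (M\<inverse> - M'\<inverse>) = card (M - M')"
  proof -
    have "M\<inverse> - M'\<inverse> = (M - M')\<inverse>" by auto
    then show ?thesis by simp
  qed
  ultimately show "\<bar>g (M\<inverse>) - g (M'\<inverse>)\<bar> \<le> \<kappa> * real (card (M - M'))"
    using assms c unfolding lipschitz_upto_def by metis
qed

lemma sum_perfect_matchings_column:
  fixes g :: "('a \<times> 'a) set \<Rightarrow> real"
  assumes fin: "finite S" "finite J" and j: "j \<in> J"
  shows "(\<Sum>M\<in>perfect_matchings E S J. g M) =
    (\<Sum>x\<in>S. edge E x j * (\<Sum>M\<in>perfect_matchings E (S - {x}) (J - {j}). g (insert (x, j) M)))"
proof -
  have "(\<Sum>M\<in>perfect_matchings E S J. g M) = (\<Sum>M\<in>perfect_matchings (E\<inverse>) J S. g (M\<inverse>))"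
    by (simp add: sum_perfect_matchings_converse)
  also have "\<dots> = (\<Sum>x\<in>S. edge (E\<inverse>) j x * (\<Sum>M\<in>perfect_matchings (E\<inverse>) (J - {j}) (S - {x}). g ((insert (j, x) M)\<inverse>)))"
    by (rule sum_perfect_matchings_row[OF fin(2,1) j])
  also have "\<dots> = (\<Sum>x\<in>S. edge E x j * (\<Sum>M\<in>perfect_matchings E (S - {x}) (J - {j}). g (insert (x, j) M)))"
  proof (rule sum.cong[OF refl])
    fix x
    have "(insert (j, x) (M\<inverse>))\<inverse> = insert (x, j) M" for M :: "('a \<times> 'a) set" by auto
    then have "(\<Sum>M\<in>perfect_matchings (E\<inverse>) (J - {j}) (S - {x}). g ((insert (j, x) M)\<inverse>)) =
       (\<Sum>M\<in>perfect_matchings E (S - {x}) (J - {j}). g (insert (x, j) M))"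
      by (simp add: sum_perfect_matchings_converse)
    then show "edge (E\<inverse>) j x * (\<Sum>M\<in>perfect_matchings (E\<inverse>) (J - {j}) (S - {x}). g ((insert (j, x) M)\<inverse>)) =
       edge E x j * (\<Sum>M\<in>perfect_matchings E (S - {x}) (J - {j}). g (insert (x, j) M))" by simp
  qed
  finally show ?thesis .
qed

section \<open>Means conditioned on one more edge\<close>

definition weighted_mean :: "('b \<Rightarrow> real) \<Rightarrow> ('b \<Rightarrow> real) \<Rightarrow> 'b set \<Rightarrow> real" where
  "weighted_mean V m Y = (\<Sum>y\<in>Y. V y * m y) / (\<Sum>y\<in>Y. V y)"

lemma weighted_mean_close:
  assumes V: "\<And>y. y \<in> Y \<Longrightarrow> 0 \<le> V y" "0 < (\<Sum>y\<in>Y. V y)"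
    and m: "\<And>y. y \<in> Y \<Longrightarrow> \<bar>m y - c\<bar> \<le> r"
  shows "\<bar>weighted_mean V m Y - c\<bar> \<le> r"
proof -
  have "weighted_mean V m Y - c = (\<Sum>y\<in>Y. V y * (m y - c)) / (\<Sum>y\<in>Y. V y)"
    using V(2) by (simp add: weighted_mean_def right_diff_distrib sum_subtractf diff_divide_distrib sum_distrib_right[symmetric])
  moreover have "\<bar>\<Sum>y\<in>Y. V y * (m y - c)\<bar> \<le> (\<Sum>y\<in>Y. V y * r)"
    using V(1) m by (intro order_trans[OF sum_abs] sum_mono) (auto simp: abs_mult intro: mult_left_mono)
  ultimately have "\<bar>weighted_mean V m Y - c\<bar> \<le> (\<Sum>y\<in>Y. V y * r) / (\<Sum>y\<in>Y. V y)"
    using V(2) by (simp add: divide_right_mono)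
  then show ?thesis
    using V(2) by (simp add: sum_distrib_right[symmetric])
qed

lemma weighted_mean_subset:
  assumes fin: "finite X" and sub: "Y \<subseteq> X" and V: "\<And>y. y \<in> X \<Longrightarrow> 0 \<le> V y" "0 < (\<Sum>y\<in>Y. V y)"
    and m: "\<And>y y'. y \<in> X \<Longrightarrow> y' \<in> X \<Longrightarrow> \<bar>m y - m y'\<bar> \<le> r" and r: "0 \<le> r"
    and q: "(\<Sum>y\<in>X - Y. V y) \<le> (\<Sum>y\<in>X. V y) / 4"
  shows "\<bar>weighted_mean V m X - weighted_mean V m Y\<bar> \<le> r / 4"
proof -
  let ?\<mu> = "weighted_mean V m Y"
  have split: "(\<Sum>y\<in>X. f y) = (\<Sum>y\<in>X - Y. f y) + (\<Sum>y\<in>Y. f y)" for f :: "'a \<Rightarrow> real"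
    using sum.subset_diff[OF sub fin] .
  have pos: "0 < (\<Sum>y\<in>X. V y)"
    using split[of V] V sum_nonneg[of "X - Y" V] by force
  have 0: "(\<Sum>y\<in>Y. V y * (m y - ?\<mu>)) = 0"
  proof -
    have "(\<Sum>y\<in>Y. V y * (m y - ?\<mu>)) = (\<Sum>y\<in>Y. V y * m y) - (\<Sum>y\<in>Y. V y) * ?\<mu>"
      by (simp add: right_diff_distrib sum_subtractf sum_distrib_right)
    then show ?thesis using V(2) by (simp add: weighted_mean_def)
  qed
  have "weighted_mean V m X - ?\<mu> = (\<Sum>y\<in>X. V y * (m y - ?\<mu>)) / (\<Sum>y\<in>X. V y)"
    using pos by (simp add: weighted_mean_def[of V m X] right_diff_distrib sum_subtractf diff_divide_distrib sum_distrib_right[symmetric])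
  also have "\<dots> = (\<Sum>y\<in>X - Y. V y * (m y - ?\<mu>)) / (\<Sum>y\<in>X. V y)"
    unfolding split[of "\<lambda>y. V y * (m y - ?\<mu>)"] 0 by simp
  finally have 1: "weighted_mean V m X - ?\<mu> = (\<Sum>y\<in>X - Y. V y * (m y - ?\<mu>)) / (\<Sum>y\<in>X. V y)" .
  have "\<bar>m y - ?\<mu>\<bar> \<le> r" if "y \<in> X" for y
    using weighted_mean_close[of Y V m "m y" r] V m sub that by (auto simp: abs_minus_commute)
  then have "\<bar>\<Sum>y\<in>X - Y. V y * (m y - ?\<mu>)\<bar> \<le> (\<Sum>y\<in>X - Y. V y * r)"
    using V(1) by (intro order_trans[OF sum_abs] sum_mono) (auto simp: abs_mult intro: mult_left_mono)
  also have "\<dots> \<le> (\<Sum>y\<in>X. V y) / 4 * r" unfolding sum_distrib_right[symmetric] using q r by (intro mult_right_mono)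
  finally show ?thesis unfolding 1 using pos by (simp add: field_simps)
qed

text \<open>Both means are within \<open>r / 4\<close> of the means over the common part of the index sets, which differ by at
most \<open>l\<close>. The total coefficient 1/2 of \<open>r\<close> is what makes \<open>matching_mean_oscillation\<close> a contraction.\<close>

lemma weighted_mean_compare:
  assumes fin: "finite X" "finite Y" and V: "\<And>y. y \<in> X \<union> Y \<Longrightarrow> 0 \<le> V y" "0 < (\<Sum>y\<in>X \<inter> Y. V y)"
    and m: "\<And>y y'. y \<in> X \<Longrightarrow> y' \<in> X \<Longrightarrow> \<bar>m y - m y'\<bar> \<le> r"
    and m': "\<And>y y'. y \<in> Y \<Longrightarrow> y' \<in> Y \<Longrightarrow> \<bar>m' y - m' y'\<bar> \<le> r" and r: "0 \<le> r"
    and mm: "\<And>y. y \<in> X \<inter> Y \<Longrightarrow> \<bar>m y - m' y\<bar> \<le> l"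
    and q: "(\<Sum>y\<in>X - Y. V y) \<le> (\<Sum>y\<in>X. V y) / 4" "(\<Sum>y\<in>Y - X. V y) \<le> (\<Sum>y\<in>Y. V y) / 4"
  shows "\<bar>weighted_mean V m X - weighted_mean V m' Y\<bar> \<le> l + r / 2"
proof -
  have "X - Y = X - X \<inter> Y" "Y - X = Y - X \<inter> Y" by auto
  then have "\<bar>weighted_mean V m X - weighted_mean V m (X \<inter> Y)\<bar> \<le> r / 4"
    "\<bar>weighted_mean V m' Y - weighted_mean V m' (X \<inter> Y)\<bar> \<le> r / 4"
    using assms by (intro weighted_mean_subset; auto)+
  moreover have "\<bar>weighted_mean V m (X \<inter> Y) - weighted_mean V m' (X \<inter> Y)\<bar> \<le> l"
  proof -
    have "weighted_mean V m (X \<inter> Y) - weighted_mean V m' (X \<inter> Y) = weighted_mean V (\<lambda>y. m y - m' y) (X \<inter> Y)"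
      by (simp add: weighted_mean_def right_diff_distrib sum_subtractf diff_divide_distrib)
    then show ?thesis using weighted_mean_close[of "X \<inter> Y" V "\<lambda>y. m y - m' y" 0 l] V mm by auto
  qed
  ultimately show ?thesis by linarith
qed

definition matching_mean :: "('a \<times> 'a) set \<Rightarrow> 'a set \<Rightarrow> 'a set \<Rightarrow> (('a \<times> 'a) set \<Rightarrow> real) \<Rightarrow> real" where
  "matching_mean E S J g = (\<Sum>M\<in>perfect_matchings E S J. g M) / matching_count E S J"

lemma matching_mean_converse:
  "matching_mean (E\<inverse>) J S (\<lambda>M. g (M\<inverse>)) = matching_mean E S J g"
  by (simp add: matching_mean_def sum_perfect_matchings_converse matching_count_converse)

lemma matching_mean_bounds:
  assumes "\<And>M. M \<in> perfect_matchings E S J \<Longrightarrow> 0 \<le> g M \<and> g M \<le> 1"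
  shows "0 \<le> matching_mean E S J g" "matching_mean E S J g \<le> 1"
proof -
  show "0 \<le> matching_mean E S J g"
    unfolding matching_mean_def using assms by (intro divide_nonneg_nonneg sum_nonneg) auto
  have "(\<Sum>M\<in>perfect_matchings E S J. g M) \<le> (\<Sum>M\<in>perfect_matchings E S J. 1)"
    using assms by (intro sum_mono) auto
  then show "matching_mean E S J g \<le> 1"
    unfolding matching_mean_def matching_count_def by (auto simp: divide_le_eq)
qed

text \<open>The weights are proportional to the probabilities of the rows to be left over in a matching of all columns;
by \<open>unbalanced_count_upper\<close> no row is much likelier than the others.\<close>

lemma nonneighbour_weight:
  assumes d: "dense_between E z S J" and c: "card S = Suc (card J)" and n: "5 * z + z < card J" and s: "card {y\<in>S. (y, s) \<notin> E} \<le> z"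
  shows "(\<Sum>y\<in>{y\<in>S. (y, s) \<notin> E}. matching_count E (S - {y}) J) \<le> (\<Sum>y\<in>S. matching_count E (S - {y}) J) / 5"
proof -
  let ?V = "\<lambda>y. matching_count E (S - {y}) J"
  let ?T = "\<Sum>y\<in>S. ?V y"
  have fin: "finite S" using d by (simp add: dense_between_def)
  have T0: "0 \<le> ?T" by (intro sum_nonneg) auto
  have "(\<Sum>y\<in>{y\<in>S. (y, s) \<notin> E}. ?V y) \<le> (\<Sum>y\<in>{y\<in>S. (y, s) \<notin> E}. ?T / (real (card J) - real z))"
    using n by (intro sum_mono unbalanced_count_bound[OF d c]) auto
  also have "\<dots> \<le> real z * (?T / (real (card J) - real z))"
    unfolding sum_constant using s T0 n by (intro mult_right_mono) auto
  also have "\<dots> \<le> ?T / 5"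
  proof -
    have "real z / (real (card J) - real z) \<le> 1 / 5" using n by (simp add: field_simps)
    from mult_right_mono[OF this T0] show ?thesis by simp
  qed
  finally show ?thesis .
qed

text \<open>Compare the matchings that contain \<open>(x, j)\<close> with those that contain \<open>(x, j')\<close>. Conditioning further on the
row \<open>y\<close> that takes the column left free, the two conditional means differ by one exchange, that is by at
most \<open>2 \<kappa>\<close>, and the laws of \<open>y\<close> are proportional to the same weights on two nearly equal sets
of rows. The means as functions of \<open>y\<close> oscillate by the same quantity for a smaller graph with rows
and columns interchanged. Hence the oscillation satisfies \<open>r \<le> 2 \<kappa> + r' / 2\<close>, and after \<open>t\<close> levels
the trivial bound 1 contributes \<open>2\<^sup>-\<^sup>t\<close>.\<close>

lemma matching_mean_oscillation:
  assumes "dense_between E z S J" "card S = card J" "10 * z + 10 + t \<le> card S" "2 \<le> K"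
    and "lipschitz_upto K \<kappa> g E S J" "0 \<le> \<kappa>"
    and "\<And>M. M \<in> perfect_matchings E S J \<Longrightarrow> 0 \<le> g M \<and> g M \<le> 1"
    and "x \<in> S" "j \<in> J" "j' \<in> J" "(x, j) \<in> E" "(x, j') \<in> E"
  shows "\<bar>matching_mean E (S - {x}) (J - {j}) (\<lambda>M. g (insert (x, j) M))
     - matching_mean E (S - {x}) (J - {j'}) (\<lambda>M. g (insert (x, j') M))\<bar> \<le> 4 * \<kappa> + (1/2) ^ t"
  using assms
proof (induction t arbitrary: E S J g x j j')
  case (0 E S J g x j j')
  have b: "0 \<le> matching_mean E (S - {x}) (J - {l}) (\<lambda>M. g (insert (x, l) M))"
     "matching_mean E (S - {x}) (J - {l}) (\<lambda>M. g (insert (x, l) M)) \<le> 1" if "l \<in> J" "(x, l) \<in> E" for l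
    using 0 that by (intro matching_mean_bounds insert_perfect_matching; auto intro: insert_perfect_matching)+
  have "0 \<le> \<kappa>" by fact
  then show ?case using b[of j] b[of j'] 0 by auto
next
  case (Suc t E S J g x j j')
  note d = Suc.prems(1) and lip = Suc.prems(5)
  have x: "x \<in> S" "j \<in> J" "j' \<in> J" "(x, j) \<in> E" "(x, j') \<in> E" by fact+
  have fin: "finite S" "finite J" using d by (auto simp: dense_between_def)
  have k0: "0 \<le> \<kappa>" by fact
  show ?case
  proof (cases "j = j'")
    case True then show ?thesis using k0 by simp
  next
    case False
    define S' where "S' = S - {x}"
    define J' where "J' = J - {j} - {j'}"
    have d': "dense_between E z S' J'" using d by (rule dense_between_subset) (auto simp: S'_def J'_def)
    have dS: "dense_between E z S' (J - {l})" for l using d by (rule dense_between_subset) (auto simp: S'_def)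
    have cards: "card S' = card S - 1" "card J' = card S - 2" "card S' = Suc (card J')"
      using x fin False Suc.prems by (auto simp: S'_def J'_def)
    have fin': "finite S'" "finite J'" using fin by (auto simp: S'_def J'_def)
    \<comment> \<open>With \<open>x\<close> matched to \<open>j\<close>, the column \<open>j'\<close> goes to some row \<open>y\<close> adjacent to it, and vice versa; the number \<open>V y\<close> of ways to complete the matching is the same for both choices.\<close>
    define V where "V y = matching_count E (S' - {y}) J'" for y
    define m where "m y = matching_mean E (S' - {y}) J' (\<lambda>M. g (insert (x, j) (insert (y, j') M)))" for y
    define m' where "m' y = matching_mean E (S' - {y}) J' (\<lambda>M. g (insert (x, j') (insert (y, j) M)))" for y
    have Vpos: "0 < V y" if "y \<in> S'" for y
    proof -
      have "dense_between E z (S' - {y}) J'" using d' by (rule dense_between_subset) auto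
      then show ?thesis unfolding V_def using that fin' cards Suc.prems
        by (intro matching_count_pos[of E z]) auto
    qed
    have Jeq: "J - {j'} - {j} = J'" by (auto simp: J'_def)
    have mean1: "matching_mean E S' (J - {j}) (\<lambda>M. g (insert (x, j) M)) = weighted_mean V m {y\<in>S'. (y, j') \<in> E}"
    proof -
      have "(\<Sum>M\<in>perfect_matchings E S' (J - {j}). g (insert (x, j) M)) =
         (\<Sum>y\<in>S'. edge E y j' * (\<Sum>M\<in>perfect_matchings E (S' - {y}) J'. g (insert (x, j) (insert (y, j') M))))"
        using sum_perfect_matchings_column[of S' "J - {j}" j' "\<lambda>M. g (insert (x, j) M)" E] fin' fin x False
        by (simp add: J'_def)
      also have "\<dots> = (\<Sum>y\<in>S'. edge E y j' * (V y * m y))"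
        using Vpos by (intro sum.cong refl) (auto simp: m_def matching_mean_def V_def less_le)
      also have "\<dots> = (\<Sum>y\<in>{y\<in>S'. (y, j') \<in> E}. V y * m y)"
        using fin' by (simp add: of_bool_def if_distrib[of "\<lambda>c. c * _"] sum.inter_filter cong: if_cong)
      finally have 1: "(\<Sum>M\<in>perfect_matchings E S' (J - {j}). g (insert (x, j) M)) = (\<Sum>y\<in>{y\<in>S'. (y, j') \<in> E}. V y * m y)" .
      have "matching_count E S' (J - {j}) = (\<Sum>y\<in>S'. edge E y j' * V y)"
        using matching_count_column[of S' "J - {j}" j' E] fin' fin x False by (simp add: J'_def V_def)
      also have "\<dots> = (\<Sum>y\<in>{y\<in>S'. (y, j') \<in> E}. V y)"
        using fin' by (simp add: of_bool_def if_distrib[of "\<lambda>c. c * _"] sum.inter_filter cong: if_cong)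
      finally show ?thesis using 1 by (simp add: matching_mean_def weighted_mean_def)
    qed
    have mean2: "matching_mean E S' (J - {j'}) (\<lambda>M. g (insert (x, j') M)) = weighted_mean V m' {y\<in>S'. (y, j) \<in> E}"
    proof -
      have "(\<Sum>M\<in>perfect_matchings E S' (J - {j'}). g (insert (x, j') M)) =
         (\<Sum>y\<in>S'. edge E y j * (\<Sum>M\<in>perfect_matchings E (S' - {y}) J'. g (insert (x, j') (insert (y, j) M))))"
        using sum_perfect_matchings_column[of S' "J - {j'}" j "\<lambda>M. g (insert (x, j') M)" E] fin' fin x False
        by (simp add: Jeq)
      also have "\<dots> = (\<Sum>y\<in>S'. edge E y j * (V y * m' y))"
        using Vpos by (intro sum.cong refl) (auto simp: m'_def matching_mean_def V_def less_le)
      also have "\<dots> = (\<Sum>y\<in>{y\<in>S'. (y, j) \<in> E}. V y * m' y)"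
        using fin' by (simp add: of_bool_def if_distrib[of "\<lambda>c. c * _"] sum.inter_filter cong: if_cong)
      finally have 1: "(\<Sum>M\<in>perfect_matchings E S' (J - {j'}). g (insert (x, j') M)) = (\<Sum>y\<in>{y\<in>S'. (y, j) \<in> E}. V y * m' y)" .
      have "matching_count E S' (J - {j'}) = (\<Sum>y\<in>S'. edge E y j * V y)"
        using matching_count_column[of S' "J - {j'}" j E] fin' fin x False by (simp add: Jeq V_def)
      also have "\<dots> = (\<Sum>y\<in>{y\<in>S'. (y, j) \<in> E}. V y)"
        using fin' by (simp add: of_bool_def if_distrib[of "\<lambda>c. c * _"] sum.inter_filter cong: if_cong)
      finally show ?thesis using 1 by (simp add: matching_mean_def weighted_mean_def)
    qed
    \<comment> \<open>The fixed vertex is now the column \<open>b\<close>, matched to \<open>y\<close> or to \<open>y'\<close>, so the induction hypothesis is used with rows and columns interchanged.\<close>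
    have osc: "\<bar>matching_mean E (S' - {y}) (J - {a} - {b}) (\<lambda>M. g (insert (x, a) (insert (y, b) M)))
       - matching_mean E (S' - {y'}) (J - {a} - {b}) (\<lambda>M. g (insert (x, a) (insert (y', b) M)))\<bar> \<le> 4 * \<kappa> + (1/2) ^ t"
      if y: "y \<in> S'" "y' \<in> S'" "(y, b) \<in> E" "(y', b) \<in> E" and a: "a \<in> J" "b \<in> J" "a \<noteq> b" "(x, a) \<in> E" for y y' a b
    proof -
      let ?g = "\<lambda>M. g (insert (x, a) (M\<inverse>))"
      have "\<bar>matching_mean (E\<inverse>) (J - {a} - {b}) (S' - {y}) (\<lambda>M. ?g (insert (b, y) M))
         - matching_mean (E\<inverse>) (J - {a} - {b}) (S' - {y'}) (\<lambda>M. ?g (insert (b, y') M))\<bar> \<le> 4 * \<kappa> + (1/2) ^ t"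
      proof (rule Suc.IH)
        show "dense_between (E\<inverse>) z (J - {a}) S'" using dS by (simp add: dense_between_converse)
        show "card (J - {a}) = card S'" using a cards fin Suc.prems by simp
        show "10 * z + 10 + t \<le> card (J - {a})" using a cards fin Suc.prems by simp
        show "lipschitz_upto K \<kappa> ?g (E\<inverse>) (J - {a}) S'"
          unfolding S'_def by (intro lipschitz_upto_converse[of _ _ "\<lambda>M. g (insert (x, a) M)"] lipschitz_upto_insert lip x a)
        fix M assume "M \<in> perfect_matchings (E\<inverse>) (J - {a}) S'"
        then have "M\<inverse> \<in> perfect_matchings E S' (J - {a})" by (auto simp: perfect_matchings_converse)
        then have "insert (x, a) (M\<inverse>) \<in> perfect_matchings E S J"
          unfolding S'_def by (intro insert_perfect_matching x a)
        then show "0 \<le> ?g M \<and> ?g M \<le> 1" by (rule Suc.prems(7))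
      qed (use y a Suc.prems in auto)
      moreover have "matching_mean (E\<inverse>) (J - {a} - {b}) (S' - {y}) (\<lambda>M. ?g (insert (b, y) M)) =
        matching_mean E (S' - {y}) (J - {a} - {b}) (\<lambda>M. g (insert (x, a) (insert (y, b) M)))" for y
      proof -
        have "?g (insert (b, y) M) = g (insert (x, a) (insert (y, b) (M\<inverse>)))" for M
          by (rule arg_cong[where f=g]) auto
        then show ?thesis
          using matching_mean_converse[of E "J - {a} - {b}" "S' - {y}" "\<lambda>M. g (insert (x, a) (insert (y, b) M))"] by simp
      qed
      ultimately show ?thesis by simp
    qed
    have "\<bar>weighted_mean V m {y\<in>S'. (y, j') \<in> E} - weighted_mean V m' {y\<in>S'. (y, j) \<in> E}\<bar> \<le> 2 * \<kappa> + (4 * \<kappa> + (1/2) ^ t) / 2"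
    proof (rule weighted_mean_compare)
      let ?X = "{y\<in>S'. (y, j') \<in> E}" and ?Y = "{y\<in>S'. (y, j) \<in> E}"
      let ?T = "\<Sum>y\<in>S'. V y"
      have T0: "0 < ?T"
      proof -
        have "S' \<noteq> {}" using cards by auto
        then show ?thesis using Vpos fin' by (intro sum_pos) auto
      qed
      have non: "(\<Sum>y\<in>{y\<in>S'. (y, l) \<notin> E}. V y) \<le> ?T / 5" if l: "l = j \<or> l = j'" for l
        unfolding V_def
      proof (rule nonneighbour_weight[OF d' cards(3)])
        show "5 * z + z < card J'" using cards Suc.prems(3) by linarith
        have "card {y\<in>S'. (y, l) \<notin> E} \<le> card {y\<in>S. (y, l) \<notin> E}"
          using fin by (intro card_mono) (auto simp: S'_def)
        then show "card {y\<in>S'. (y, l) \<notin> E} \<le> z" using d x l unfolding dense_between_def by force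
      qed
      have split: "?T = (\<Sum>y\<in>{y\<in>S'. (y, l) \<in> E}. V y) + (\<Sum>y\<in>{y\<in>S'. (y, l) \<notin> E}. V y)" for l
        using fin' by (subst sum.union_disjoint[symmetric]) (auto intro: sum.cong)
      have diff: "(\<Sum>y\<in>{y\<in>S'. (y, l) \<in> E} - {y\<in>S'. (y, l') \<in> E}. V y) \<le> (\<Sum>y\<in>{y\<in>S'. (y, l) \<in> E}. V y) / 4"
        "(\<Sum>y\<in>{y\<in>S'. (y, l) \<in> E} - {y\<in>S'. (y, l') \<in> E}. V y) \<le> ?T / 5"
        if "l = j \<or> l = j'" "l' = j \<or> l' = j'" for l l'
      proof -
        have "(\<Sum>y\<in>{y\<in>S'. (y, l) \<in> E} - {y\<in>S'. (y, l') \<in> E}. V y) \<le> (\<Sum>y\<in>{y\<in>S'. (y, l') \<notin> E}. V y)"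
          using fin' Vpos by (intro sum_mono2) (auto simp: less_imp_le)
        then show "(\<Sum>y\<in>{y\<in>S'. (y, l) \<in> E} - {y\<in>S'. (y, l') \<in> E}. V y) \<le> (\<Sum>y\<in>{y\<in>S'. (y, l) \<in> E}. V y) / 4"
          "(\<Sum>y\<in>{y\<in>S'. (y, l) \<in> E} - {y\<in>S'. (y, l') \<in> E}. V y) \<le> ?T / 5"
          using non[OF that(1)] non[OF that(2)] split[of l] by linarith+
      qed
      show "(\<Sum>y\<in>?X - ?Y. V y) \<le> (\<Sum>y\<in>?X. V y) / 4" "(\<Sum>y\<in>?Y - ?X. V y) \<le> (\<Sum>y\<in>?Y. V y) / 4"
        by (rule diff(1); simp)+
      have "(\<Sum>y\<in>?X. V y) = (\<Sum>y\<in>?X \<inter> ?Y. V y) + (\<Sum>y\<in>?X - ?Y. V y)"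
        using fin' by (subst sum.union_disjoint[symmetric]) (auto intro: sum.cong)
      then show "0 < (\<Sum>y\<in>?X \<inter> ?Y. V y)"
        using diff(2)[of j' j] non[of j'] split[of j'] T0 by auto
      show "\<bar>m y - m y'\<bar> \<le> 4 * \<kappa> + (1/2) ^ t" if "y \<in> ?X" "y' \<in> ?X" for y y'
        using osc[of y y' j' j] that x False by (simp add: m_def J'_def)
      show "\<bar>m' y - m' y'\<bar> \<le> 4 * \<kappa> + (1/2) ^ t" if "y \<in> ?Y" "y' \<in> ?Y" for y y'
        using osc[of y y' j j'] that x False by (simp add: m'_def Jeq)
      show "\<bar>m y - m' y\<bar> \<le> 2 * \<kappa>" if y: "y \<in> ?X \<inter> ?Y" for y
      proof -
        let ?P = "perfect_matchings E (S' - {y}) J'"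
        have yS: "y \<in> S'" "(y, j) \<in> E" "(y, j') \<in> E" "y \<noteq> x" using y by (auto simp: S'_def)
        have *: "\<bar>g (insert (x, j) (insert (y, j') M)) - g (insert (x, j') (insert (y, j) M))\<bar> \<le> 2 * \<kappa>" if M: "M \<in> ?P" for M
        proof -
          let ?A = "insert (x, j) (insert (y, j') M)" and ?B = "insert (x, j') (insert (y, j) M)"
          have "insert (y, j') M \<in> perfect_matchings E S' (J - {j})"
            using M yS x False by (intro insert_perfect_matching) (auto simp: J'_def)
          then have A: "?A \<in> perfect_matchings E S J" unfolding S'_def by (rule insert_perfect_matching[OF x(1,2,4)])
          have "insert (y, j) M \<in> perfect_matchings E S' (J - {j'})"
            using M yS x False by (intro insert_perfect_matching) (auto simp: Jeq)
          then have B: "?B \<in> perfect_matchings E S J" unfolding S'_def by (rule insert_perfect_matching[OF x(1,3,5)])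
          have "?A - ?B \<subseteq> {(x, j), (y, j')}" by auto
          then have "card (?A - ?B) \<le> card {(x, j), (y, j')}" by (intro card_mono) auto
          also have "\<dots> \<le> 2" by (simp add: card_insert_if)
          finally have c: "card (?A - ?B) \<le> 2" .
          then have "\<bar>g ?A - g ?B\<bar> \<le> \<kappa> * real (card (?A - ?B))"
            using lip A B Suc.prems(4) unfolding lipschitz_upto_def by (meson le_trans)
          also have "\<dots> \<le> \<kappa> * 2" using c k0 by (intro mult_left_mono) auto
          finally show ?thesis by simp
        qed
        have "m y - m' y = (\<Sum>M\<in>?P. g (insert (x, j) (insert (y, j') M)) - g (insert (x, j') (insert (y, j) M))) / V y"
          by (simp add: m_def m'_def matching_mean_def V_def sum_subtractf diff_divide_distrib)
        moreover have "\<bar>\<Sum>M\<in>?P. g (insert (x, j) (insert (y, j') M)) - g (insert (x, j') (insert (y, j) M))\<bar> \<le> (\<Sum>M\<in>?P. 2 * \<kappa>)"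
          using * by (intro order_trans[OF sum_abs] sum_mono) auto
        moreover have "(\<Sum>M\<in>?P. 2 * \<kappa>) = 2 * \<kappa> * V y" by (simp add: V_def matching_count_def)
        ultimately have "m y - m' y = (\<Sum>M\<in>?P. g (insert (x, j) (insert (y, j') M)) - g (insert (x, j') (insert (y, j) M))) / V y"
          "\<bar>\<Sum>M\<in>?P. g (insert (x, j) (insert (y, j') M)) - g (insert (x, j') (insert (y, j) M))\<bar> \<le> 2 * \<kappa> * V y"
          by linarith+
        then show ?thesis using Vpos[OF yS(1)] by (simp add: divide_le_eq)
      qed
    qed (use k0 fin' Vpos in \<open>auto simp: less_imp_le\<close>)
    also have "2 * \<kappa> + (4 * \<kappa> + (1/2) ^ t) / 2 = 4 * \<kappa> + (1/2) ^ Suc t" by simp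
    finally show ?thesis unfolding mean1[symmetric] mean2[symmetric] by (simp add: S'_def)
  qed
qed

section \<open>The variance of a Lipschitz function of a random matching\<close>

text \<open>For each line (row or column), the chance that \<open>k\<close> random distinct positions in it are all non-edges, added
up over all lines. It is chosen so that deleting a random row and column does not increase it on
average and that a single line with many non-edges makes it large.\<close>

definition nonedge_potential :: "nat \<Rightarrow> ('a \<times> 'a) set \<Rightarrow> 'a set \<Rightarrow> 'a set \<Rightarrow> real" where
  "nonedge_potential k E S J =
     ((\<Sum>y\<in>S. real (card {j\<in>J. (y, j) \<notin> E} choose k)) + (\<Sum>j\<in>J. real (card {y\<in>S. (y, j) \<notin> E} choose k)))
     / real (card S choose k)"

lemma nonedge_potential_nonneg: "0 \<le> nonedge_potential k E S J"
  by (auto simp: nonedge_potential_def intro!: divide_nonneg_nonneg add_nonneg_nonneg sum_nonneg)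

lemma sum_choose_remove_one:
  assumes fin: "finite J" and Z: "Z \<subseteq> J"
  shows "(\<Sum>j\<in>J. real (card (Z - {j}) choose k)) = (real (card J) - real k) * real (card Z choose k)"
proof -
  have finZ: "finite Z" using Z fin finite_subset by blast
  have "(\<Sum>j\<in>J. real (card (Z - {j}) choose k)) =
      (\<Sum>j\<in>Z. real (card (Z - {j}) choose k)) + (\<Sum>j\<in>J - Z. real (card (Z - {j}) choose k))"
    using sum.subset_diff[OF Z fin, of "\<lambda>j. real (card (Z - {j}) choose k)"] by linarith
  also have "(\<Sum>j\<in>Z. real (card (Z - {j}) choose k)) = real (card Z * (card Z - 1 choose k))"
    using finZ by simp
  also have "card Z * (card Z - 1 choose k) = (card Z - k) * (card Z choose k)"
    by (simp add: binomial_absorb_comp)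
  also have "(\<Sum>j\<in>J - Z. real (card (Z - {j}) choose k)) = (\<Sum>j\<in>J - Z. real (card Z choose k))"
    by (intro sum.cong) auto
  also have "\<dots> = (real (card J) - real (card Z)) * real (card Z choose k)"
    using finZ Z fin card_mono[OF fin Z] by (simp add: card_Diff_subset of_nat_diff)
  also have "real ((card Z - k) * (card Z choose k)) + \<dots> = (real (card J) - real k) * real (card Z choose k)"
  proof (cases "k \<le> card Z")
    case True then show ?thesis by (simp add: of_nat_diff algebra_simps)
  next
    case False then show ?thesis by (simp add: binomial_eq_0)
  qed
  finally show ?thesis .
qed

text \<open>Removing a random one of \<open>N\<close> positions multiplies the expected number of \<open>k\<close>-subsets of a fixed
set by \<open>(N - k) / N\<close>, which is also the factor by which the normalising \<open>N choose k\<close> decreases. The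
edges of a perfect matching run through every row and every column exactly once.\<close>

lemma nonedge_potential_average:
  assumes M: "M \<in> perfect_matchings E S J" and fin: "finite S" "finite J" and k: "k < card S"
  shows "(\<Sum>e\<in>M. nonedge_potential k E (S - {fst e}) (J - {snd e})) \<le> real (card S) * nonedge_potential k E S J"
proof -
  have cSJ: "card S = card J" using perfect_matching_card[OF M] by simp
  let ?r = "\<lambda>J y. real (card {j\<in>J. (y, j) \<notin> E} choose k)"
  let ?c = "\<lambda>S j. real (card {y\<in>S. (y, j) \<notin> E} choose k)"
  let ?A = "(\<Sum>y\<in>S. ?r J y) + (\<Sum>j\<in>J. ?c S j)"
  let ?N = "real (card S)"
  have finM: "finite M" by (rule perfect_matching_finite[OF M fin])
  have bs: "(\<Sum>e\<in>M. f (snd e)) = (\<Sum>j\<in>J. f j)" "(\<Sum>e\<in>M. f (fst e)) = (\<Sum>j\<in>S. f j)" for f :: "'a \<Rightarrow> real"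
    using sum.reindex_bij_betw[OF perfect_matching_snd[OF M], of f] sum.reindex_bij_betw[OF perfect_matching_fst[OF M], of f] by auto
  have row: "(\<Sum>j\<in>J. ?r (J - {j}) y) = (?N - real k) * ?r J y" for y
  proof -
    have "{l\<in>J - {j}. (y, l) \<notin> E} = {l\<in>J. (y, l) \<notin> E} - {j}" for j by auto
    then show ?thesis using sum_choose_remove_one[OF fin(2), of "{l\<in>J. (y, l) \<notin> E}" k] cSJ by auto
  qed
  have col: "(\<Sum>x\<in>S. ?c (S - {x}) j) = (?N - real k) * ?c S j" for j
  proof -
    have "{y\<in>S - {x}. (y, j) \<notin> E} = {y\<in>S. (y, j) \<notin> E} - {x}" for x by auto
    then show ?thesis using sum_choose_remove_one[OF fin(1), of "{y\<in>S. (y, j) \<notin> E}" k] by auto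
  qed
  have R: "(\<Sum>e\<in>M. \<Sum>y\<in>S - {fst e}. ?r (J - {snd e}) y) \<le> (?N - real k) * (\<Sum>y\<in>S. ?r J y)"
  proof -
    have "(\<Sum>e\<in>M. \<Sum>y\<in>S - {fst e}. ?r (J - {snd e}) y) \<le> (\<Sum>e\<in>M. \<Sum>y\<in>S. ?r (J - {snd e}) y)"
      using fin by (intro sum_mono sum_mono2) auto
    also have "\<dots> = (\<Sum>y\<in>S. \<Sum>e\<in>M. ?r (J - {snd e}) y)" by (rule sum.swap)
    also have "\<dots> = (\<Sum>y\<in>S. \<Sum>j\<in>J. ?r (J - {j}) y)" by (intro sum.cong refl bs)
    finally show ?thesis unfolding row sum_distrib_left .
  qed
  have C: "(\<Sum>e\<in>M. \<Sum>j\<in>J - {snd e}. ?c (S - {fst e}) j) \<le> (?N - real k) * (\<Sum>j\<in>J. ?c S j)"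
  proof -
    have "(\<Sum>e\<in>M. \<Sum>j\<in>J - {snd e}. ?c (S - {fst e}) j) \<le> (\<Sum>e\<in>M. \<Sum>j\<in>J. ?c (S - {fst e}) j)"
      using fin by (intro sum_mono sum_mono2) auto
    also have "\<dots> = (\<Sum>j\<in>J. \<Sum>e\<in>M. ?c (S - {fst e}) j)" by (rule sum.swap)
    also have "\<dots> = (\<Sum>j\<in>J. \<Sum>x\<in>S. ?c (S - {x}) j)" by (intro sum.cong refl bs)
    finally show ?thesis unfolding col sum_distrib_left .
  qed
  let ?b = "real (card S - 1 choose k)"
  have bpos: "0 < ?b" using k by simp
  have Npos: "0 < real (card S choose k)" using k by simp
  have absb: "(?N - real k) * real (card S choose k) = ?N * ?b"
    using binomial_absorb_comp[of "card S" k] k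
    by (metis less_imp_le of_nat_diff of_nat_mult)
  have "(\<Sum>e\<in>M. nonedge_potential k E (S - {fst e}) (J - {snd e})) =
     (\<Sum>e\<in>M. ((\<Sum>y\<in>S - {fst e}. ?r (J - {snd e}) y) + (\<Sum>j\<in>J - {snd e}. ?c (S - {fst e}) j)) / ?b)"
  proof (rule sum.cong[OF refl])
    fix e assume "e \<in> M"
    then have "fst e \<in> S" using perfect_matching_edgeD(2)[OF M, of "fst e" "snd e"] by simp
    then show "nonedge_potential k E (S - {fst e}) (J - {snd e}) =
      ((\<Sum>y\<in>S - {fst e}. ?r (J - {snd e}) y) + (\<Sum>j\<in>J - {snd e}. ?c (S - {fst e}) j)) / ?b"
      using fin by (simp add: nonedge_potential_def)
  qed
  also have "\<dots> = ((\<Sum>e\<in>M. \<Sum>y\<in>S - {fst e}. ?r (J - {snd e}) y) + (\<Sum>e\<in>M. \<Sum>j\<in>J - {snd e}. ?c (S - {fst e}) j)) / ?b"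
    by (simp add: sum_divide_distrib[symmetric] sum.distrib)
  also have "\<dots> \<le> ((?N - real k) * ?A) / ?b"
    using R C bpos by (intro divide_right_mono) (auto simp: algebra_simps)
  also have "\<dots> = ?N * (?A / real (card S choose k))"
  proof -
    have "p * A / b = q * (A / c)" if "p * c = q * b" "0 < b" "0 < c" for p q A b c :: real
    proof -
      have "p * A / b = (p * c) * A / (b * c)" using that(2,3) by simp
      also have "\<dots> = q * (A / c)" unfolding that(1) using that(2) by simp
      finally show ?thesis .
    qed
    from this[OF absb bpos Npos] show ?thesis .
  qed
  finally show ?thesis by (simp add: nonedge_potential_def)
qed

lemma choose_Suc_ratio: "real (Suc k) * real (n choose Suc k) = real (n - k) * real (n choose k)"
  unfolding of_nat_mult[symmetric] binomial_absorption binomial_absorb_comp ..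

lemma choose_ratio_lower:
  assumes "N < 20 * z" "40 * k \<le> N"
  shows "real (N choose k) \<le> 40 ^ k * real (z choose k)"
  using assms(2)
proof (induction k)
  case (Suc k)
  have IH: "real (N choose k) \<le> 40 ^ k * real (z choose k)" using Suc by simp
  have "real (Suc k) * real (N choose Suc k) = real (N - k) * real (N choose k)" by (rule choose_Suc_ratio)
  also have "\<dots> \<le> (40 * real (z - k)) * (40 ^ k * real (z choose k))"
  proof (rule mult_mono[OF _ IH])
    have "real (N - k) = real N - real k" using Suc.prems by (intro of_nat_diff) simp
    moreover have "real z - real k \<le> real (z - k)" by linarith
    moreover have "40 * k \<le> N" using Suc.prems by simp
    then have "40 * real k \<le> real N" by linarith
    moreover have "real N < 20 * real z" using assms(1) by linarith
    ultimately show "real (N - k) \<le> 40 * real (z - k)" by linarith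
  qed auto
  also have "\<dots> = 40 ^ Suc k * (real (z - k) * real (z choose k))" by simp
  also have "\<dots> = real (Suc k) * (40 ^ Suc k * real (z choose Suc k))"
    unfolding choose_Suc_ratio[symmetric] by simp
  finally show ?case by (simp only: mult_le_cancel_left_pos of_nat_0_less_iff zero_less_Suc)
qed simp

lemma choose_ratio_upper:
  assumes "160 * z \<le> N"
  shows "160 ^ k * real (z choose k) \<le> real (N choose k)"
proof (induction k)
  case (Suc k)
  have "real (Suc k) * (160 ^ Suc k * real (z choose Suc k)) = (160 * real (z - k)) * (160 ^ k * real (z choose k))"
    using choose_Suc_ratio[of k z] by simp
  also have "\<dots> \<le> real (N - k) * real (N choose k)"
  proof (rule mult_mono[OF _ Suc])
    show "160 * real (z - k) \<le> real (N - k)"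
    proof (cases "k \<le> z")
      case True
      have "real N - real k \<le> real (N - k)" by linarith
      moreover have "real (z - k) = real z - real k" using True by (rule of_nat_diff)
      moreover have "160 * real z \<le> real N" using assms by linarith
      ultimately show ?thesis by linarith
    qed simp
  qed auto
  also have "\<dots> = real (Suc k) * real (N choose Suc k)" by (rule choose_Suc_ratio[symmetric])
  finally show ?case by (simp only: mult_le_cancel_left_pos of_nat_0_less_iff zero_less_Suc)
qed simp

text \<open>A line of which more than the fraction 1/20 is missing contributes at least \<open>40\<^sup>-\<^sup>k\<close>; the condition
\<open>40 k \<le> card S\<close> absorbs the difference between drawing with and without replacement.\<close>

lemma nonedge_potential_bad:
  assumes fin: "finite S" "finite J" and c: "card S = card J" and k: "40 * k \<le> card S"
    and bad: "\<not> dense_between E (card S div 20) S J"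
  shows "1 \<le> 40 ^ k * nonedge_potential k E S J"
proof -
  let ?R = "\<Sum>y\<in>S. real (card {j\<in>J. (y, j) \<notin> E} choose k)"
  let ?C = "\<Sum>j\<in>J. real (card {y\<in>S. (y, j) \<notin> E} choose k)"
  have pos: "0 < real (card S choose k)" using k by simp
  have "\<exists>z. card S < 20 * z \<and> real (z choose k) \<le> ?R + ?C"
  proof (cases "\<exists>y\<in>S. card S div 20 < card {j\<in>J. (y, j) \<notin> E}")
    case True
    then obtain y where y: "y \<in> S" "card S div 20 < card {j\<in>J. (y, j) \<notin> E}" by auto
    have "real (card {j\<in>J. (y, j) \<notin> E} choose k) \<le> ?R" using fin y by (intro member_le_sum) auto
    moreover have "0 \<le> ?C" by (intro sum_nonneg) auto
    moreover have "card S < 20 * card {j\<in>J. (y, j) \<notin> E}" using y(2) by linarith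
    ultimately show ?thesis by (intro exI[of _ "card {j\<in>J. (y, j) \<notin> E}"]) auto
  next
    case False
    then obtain y where y: "y \<in> J" "card S div 20 < card {x\<in>S. (x, y) \<notin> E}"
      using bad fin unfolding dense_between_def by (meson not_le)
    have "real (card {x\<in>S. (x, y) \<notin> E} choose k) \<le> ?C" using fin y by (intro member_le_sum) auto
    moreover have "0 \<le> ?R" by (intro sum_nonneg) auto
    moreover have "card S < 20 * card {x\<in>S. (x, y) \<notin> E}" using y(2) by linarith
    ultimately show ?thesis by (intro exI[of _ "card {x\<in>S. (x, y) \<notin> E}"]) auto
  qed
  then obtain z where z: "card S < 20 * z" "real (z choose k) \<le> ?R + ?C" by auto
  have "real (card S choose k) \<le> 40 ^ k * real (z choose k)" by (rule choose_ratio_lower[OF z(1) k])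
  also have "\<dots> \<le> 40 ^ k * (?R + ?C)" using z(2) by (intro mult_left_mono) auto
  finally show ?thesis using pos by (simp add: nonedge_potential_def)
qed

text \<open>In the initial graph at most the fraction 1/160 of any line is missing. The gap between 160 and the 40 of
\<open>nonedge_potential_bad\<close> leaves the factor \<open>4\<^sup>-\<^sup>k\<close>.\<close>

lemma nonedge_potential_initial:
  assumes d: "dense_between E z V W" and c: "card V = card W" and z: "160 * z \<le> card V" and k: "k \<le> card V"
  shows "40 ^ k * nonedge_potential k E V W \<le> 2 * real (card V) / 4 ^ k"
proof -
  have pos: "0 < real (card V choose k)" using k by simp
  let ?b = "real (card V choose k) / 160 ^ k"
  have zb: "real (t choose k) \<le> ?b" if "t \<le> z" for t
  proof -
    have "160 ^ k * real (t choose k) \<le> real (card V choose k)" using that z by (intro choose_ratio_upper) auto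
    then show ?thesis by (simp add: field_simps)
  qed
  have "(\<Sum>y\<in>V. real (card {j\<in>W. (y, j) \<notin> E} choose k)) + (\<Sum>j\<in>W. real (card {y\<in>V. (y, j) \<notin> E} choose k))
    \<le> (\<Sum>y\<in>V. ?b) + (\<Sum>j\<in>W. ?b)"
    using d by (intro add_mono sum_mono zb) (auto simp: dense_between_def)
  also have "\<dots> = 2 * real (card V) * ?b" using c by simp
  finally have "nonedge_potential k E V W \<le> 2 * real (card V) * ?b / real (card V choose k)"
    unfolding nonedge_potential_def using pos by (intro divide_right_mono) auto
  also have "\<dots> = 2 * real (card V) / 160 ^ k" using pos by simp
  finally have "40 ^ k * nonedge_potential k E V W \<le> 40 ^ k * (2 * real (card V) / 160 ^ k)" by (intro mult_left_mono) auto
  also have "(160::real) ^ k = 40 ^ k * 4 ^ k" by (simp add: power_mult_distrib[symmetric])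
  finally show ?thesis by simp
qed

text \<open>The variance multiplied by the number of matchings; in this form it is additive over the choice of an edge.\<close>

definition matching_sse :: "('a \<times> 'a) set \<Rightarrow> 'a set \<Rightarrow> 'a set \<Rightarrow> (('a \<times> 'a) set \<Rightarrow> real) \<Rightarrow> real" where
  "matching_sse E S J g = (\<Sum>M\<in>perfect_matchings E S J. (g M - matching_mean E S J g)\<^sup>2)"

lemma matching_sse_shift:
  assumes "finite S" "finite J"
  shows "(\<Sum>M\<in>perfect_matchings E S J. (g M - c)\<^sup>2) =
    matching_sse E S J g + matching_count E S J * (matching_mean E S J g - c)\<^sup>2"
proof (cases "matching_count E S J = 0")
  case True
  then have "perfect_matchings E S J = {}"
    using finite_perfect_matchings[OF assms] by (simp add: matching_count_def)
  then show ?thesis using True by (simp add: matching_sse_def)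
next
  case False
  let ?P = "perfect_matchings E S J" and ?\<mu> = "matching_mean E S J g"
  have 0: "(\<Sum>M\<in>?P. g M - ?\<mu>) = 0"
    using False by (simp add: matching_mean_def sum_subtractf matching_count_def)
  have "(\<Sum>M\<in>?P. (g M - c)\<^sup>2) = (\<Sum>M\<in>?P. (g M - ?\<mu>)\<^sup>2 + 2 * (?\<mu> - c) * (g M - ?\<mu>) + (?\<mu> - c)\<^sup>2)"
    by (intro sum.cong refl) (simp add: power2_eq_square algebra_simps)
  also have "\<dots> = matching_sse E S J g + 2 * (?\<mu> - c) * (\<Sum>M\<in>?P. g M - ?\<mu>) + matching_count E S J * (?\<mu> - c)\<^sup>2"
    by (simp add: sum.distrib matching_sse_def matching_count_def sum_distrib_left)
  finally show ?thesis by (simp add: 0)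
qed

text \<open>The law of total variance, conditioning on the edge at row \<open>x\<close>.\<close>

lemma matching_sse_row:
  assumes fin: "finite S" "finite J" and x: "x \<in> S"
  shows "matching_sse E S J g = (\<Sum>j\<in>J. edge E x j *
     (matching_sse E (S - {x}) (J - {j}) (\<lambda>M. g (insert (x, j) M)) +
      matching_count E (S - {x}) (J - {j}) *
       (matching_mean E (S - {x}) (J - {j}) (\<lambda>M. g (insert (x, j) M)) - matching_mean E S J g)\<^sup>2))"
  unfolding matching_sse_def[of E S J g] sum_perfect_matchings_row[OF fin x, where g="\<lambda>M. (g M - matching_mean E S J g)\<^sup>2"]
  by (intro sum.cong refl) (use fin in \<open>simp only: matching_sse_shift finite_Diff\<close>)

lemma matching_mean_row:
  assumes fin: "finite S" "finite J" and x: "x \<in> S"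
  shows "matching_mean E S J g = weighted_mean (\<lambda>j. edge E x j * matching_count E (S - {x}) (J - {j}))
     (\<lambda>j. matching_mean E (S - {x}) (J - {j}) (\<lambda>M. g (insert (x, j) M))) J"
proof -
  have "(\<Sum>M\<in>perfect_matchings E S J. g M) = (\<Sum>j\<in>J. edge E x j * matching_count E (S - {x}) (J - {j}) *
     matching_mean E (S - {x}) (J - {j}) (\<lambda>M. g (insert (x, j) M)))"
    unfolding sum_perfect_matchings_row[OF fin x, where E=E and g=g]
  proof (rule sum.cong[OF refl])
    fix j
    have "matching_count E (S - {x}) (J - {j}) * matching_mean E (S - {x}) (J - {j}) (\<lambda>M. g (insert (x, j) M))
      = (\<Sum>M\<in>perfect_matchings E (S - {x}) (J - {j}). g (insert (x, j) M))"
    proof (cases "matching_count E (S - {x}) (J - {j}) = 0")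
      case True
      then have "perfect_matchings E (S - {x}) (J - {j}) = {}"
        using finite_perfect_matchings fin by (metis card_eq_0_iff finite_Diff matching_count_def of_nat_eq_0_iff)
      then show ?thesis using True by simp
    qed (simp add: matching_mean_def)
    then show "edge E x j * (\<Sum>M\<in>perfect_matchings E (S - {x}) (J - {j}). g (insert (x, j) M)) =
      edge E x j * matching_count E (S - {x}) (J - {j}) * matching_mean E (S - {x}) (J - {j}) (\<lambda>M. g (insert (x, j) M))"
      by (simp add: mult.assoc)
  qed
  then show ?thesis
    unfolding matching_mean_def[of E S J g] weighted_mean_def matching_count_row[OF fin x, of E] by simp
qed

lemma matching_mean_close:
  assumes fin: "finite S" "finite J" and M: "M \<in> perfect_matchings E S J"
    and r: "\<And>N. N \<in> perfect_matchings E S J \<Longrightarrow> \<bar>g N - g M\<bar> \<le> r"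
  shows "\<bar>g M - matching_mean E S J g\<bar> \<le> r"
proof -
  have "matching_mean E S J g = weighted_mean (\<lambda>_. 1) g (perfect_matchings E S J)"
    by (simp add: matching_mean_def weighted_mean_def matching_count_def)
  moreover have "\<bar>weighted_mean (\<lambda>_. 1) g (perfect_matchings E S J) - g M\<bar> \<le> r"
    using finite_perfect_matchings[OF fin] M r
    by (intro weighted_mean_close) (auto simp: card_gt_0_iff)
  ultimately show ?thesis by (simp add: abs_minus_commute)
qed

lemma matching_sse_le:
  assumes fin: "finite S" "finite J" and r: "0 \<le> r"
    and g: "\<And>M N. M \<in> perfect_matchings E S J \<Longrightarrow> N \<in> perfect_matchings E S J \<Longrightarrow> \<bar>g N - g M\<bar> \<le> r"
  shows "matching_sse E S J g \<le> matching_count E S J * r\<^sup>2"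
proof -
  have "matching_sse E S J g \<le> (\<Sum>M\<in>perfect_matchings E S J. r\<^sup>2)"
    unfolding matching_sse_def
  proof (rule sum_mono)
    fix M assume M: "M \<in> perfect_matchings E S J"
    have "\<bar>g M - matching_mean E S J g\<bar> \<le> r" using matching_mean_close[OF fin M] g[OF M] by blast
    then show "(g M - matching_mean E S J g)\<^sup>2 \<le> r\<^sup>2" by (metis abs_ge_zero power2_abs power_mono)
  qed
  then show ?thesis by (simp add: matching_count_def)
qed

text \<open>Revealing the edge at a uniformly random row amounts to choosing a uniformly random edge of a random
matching.\<close>

lemma sum_pairs_matchings:
  fixes \<psi> :: "'a \<times> 'a \<Rightarrow> real"
  assumes fin: "finite S" "finite J"
  shows "(\<Sum>x\<in>S. \<Sum>j\<in>J. edge E x j * (matching_count E (S - {x}) (J - {j}) * \<psi> (x, j)))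
    = (\<Sum>M\<in>perfect_matchings E S J. \<Sum>e\<in>M. \<psi> e)"
proof -
  have "(\<Sum>j\<in>J. edge E x j * (matching_count E (S - {x}) (J - {j}) * \<psi> (x, j)))
    = (\<Sum>M\<in>perfect_matchings E S J. \<Sum>e\<in>{e\<in>M. fst e = x}. \<psi> e)" if x: "x \<in> S" for x
    unfolding sum_perfect_matchings_row[OF fin x]
  proof (intro sum.cong refl arg_cong2[where f="(*)"])
    fix j
    have "(\<Sum>M\<in>perfect_matchings E (S - {x}) (J - {j}). \<Sum>e\<in>{e\<in>insert (x, j) M. fst e = x}. \<psi> e) =
      (\<Sum>M\<in>perfect_matchings E (S - {x}) (J - {j}). \<psi> (x, j))"
    proof (rule sum.cong[OF refl])
      fix M assume M: "M \<in> perfect_matchings E (S - {x}) (J - {j})"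
      have "{e\<in>insert (x, j) M. fst e = x} = {(x, j)}"
      proof -
        have "fst e \<noteq> x" if "e \<in> M" for e
          using perfect_matching_edgeD(2)[OF M, of "fst e" "snd e"] that by auto
        then show ?thesis by auto
      qed
      then show "(\<Sum>e\<in>{e\<in>insert (x, j) M. fst e = x}. \<psi> e) = \<psi> (x, j)" by simp
    qed
    then show "matching_count E (S - {x}) (J - {j}) * \<psi> (x, j) =
       (\<Sum>M\<in>perfect_matchings E (S - {x}) (J - {j}). \<Sum>e\<in>{e\<in>insert (x, j) M. fst e = x}. \<psi> e)"
      by (simp add: matching_count_def)
  qed
  then have "(\<Sum>x\<in>S. \<Sum>j\<in>J. edge E x j * (matching_count E (S - {x}) (J - {j}) * \<psi> (x, j)))
    = (\<Sum>x\<in>S. \<Sum>M\<in>perfect_matchings E S J. \<Sum>e\<in>{e\<in>M. fst e = x}. \<psi> e)" by simp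
  also have "\<dots> = (\<Sum>M\<in>perfect_matchings E S J. \<Sum>x\<in>S. \<Sum>e\<in>{e\<in>M. fst e = x}. \<psi> e)" by (rule sum.swap)
  also have "\<dots> = (\<Sum>M\<in>perfect_matchings E S J. \<Sum>e\<in>M. \<psi> e)"
  proof (rule sum.cong[OF refl])
    fix M assume M: "M \<in> perfect_matchings E S J"
    show "(\<Sum>x\<in>S. \<Sum>e\<in>{e\<in>M. fst e = x}. \<psi> e) = (\<Sum>e\<in>M. \<psi> e)"
      using perfect_matching_finite[OF M fin] fin perfect_matching_fst[OF M]
      by (intro sum.group) (auto simp: bij_betw_def)
  qed
  finally show ?thesis .
qed

text \<open>By induction on the size, revealing one edge of the matching. In a dense graph the law of total variance
costs \<open>25 \<kappa>\<^sup>2\<close> per edge. It holds for each choice of the row to reveal; averaging over this choice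
lets the potential pass through the induction. When the graph is no longer dense, the
potential exceeds \<open>40\<^sup>-\<^sup>k\<close> and pays for the trivial bound 1. Once at most \<open>K\<close> rows are left, any two
matchings are close enough for the Lipschitz condition, which yields \<open>(\<kappa> K)\<^sup>2\<close>.\<close>

lemma matching_variance_recursion:
  assumes "finite S" "finite J" "card S = card J"
    and "lipschitz_upto K \<kappa> g E S J" "0 \<le> \<kappa>"
    and "\<And>M. M \<in> perfect_matchings E S J \<Longrightarrow> 0 \<le> g M \<and> g M \<le> 1"
    and "2 * t + 20 \<le> K" "40 * k \<le> K" "(1/2) ^ t \<le> \<kappa>"
  shows "matching_sse E S J g \<le> matching_count E S J *
    (25 * \<kappa>\<^sup>2 * real (card S) + \<kappa>\<^sup>2 * (real K)\<^sup>2 + 40 ^ k * nonedge_potential k E S J)"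
  using assms
proof (induction "card S" arbitrary: S J g)
  case 0
  have fin: "finite S" "finite J" "S = {}" "J = {}" using 0 by auto
  have "matching_sse E S J g \<le> matching_count E S J * 0\<^sup>2"
    using fin by (intro matching_sse_le) (auto simp: perfect_matchings_def)
  also have "\<dots> \<le> matching_count E S J *
    (25 * \<kappa>\<^sup>2 * real (card S) + \<kappa>\<^sup>2 * (real K)\<^sup>2 + 40 ^ k * nonedge_potential k E S J)"
    by (intro mult_left_mono) (simp_all add: nonedge_potential_nonneg)
  finally show ?case .
next
  case (Suc N S J g)
  have fin: "finite S" "finite J" and c: "card S = card J" and lip: "lipschitz_upto K \<kappa> g E S J"
    and k0: "0 \<le> \<kappa>" and K: "2 * t + 20 \<le> K" "40 * k \<le> K" "(1/2) ^ t \<le> \<kappa>" by fact+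
  note g01 = Suc.prems(6)
  let ?\<Psi> = "nonedge_potential k E"
  let ?w = "matching_count E S J"
  note pot0 = nonedge_potential_nonneg[of k E]
  have sN: "card S = Suc N" using Suc by simp
  consider "card S \<le> K" | "K < card S" "\<not> dense_between E (card S div 20) S J"
    | "K < card S" "dense_between E (card S div 20) S J" by linarith
  then show ?case
  proof cases
    case 1
    have "matching_sse E S J g \<le> ?w * (\<kappa> * real K)\<^sup>2"
    proof (rule matching_sse_le[OF fin])
      show "0 \<le> \<kappa> * real K" using k0 by simp
      fix M N assume MN: "M \<in> perfect_matchings E S J" "N \<in> perfect_matchings E S J"
      have "card (N - M) \<le> card N"
        using perfect_matching_finite[OF MN(2) fin] by (intro card_mono) auto
      also have "\<dots> \<le> K" using perfect_matching_card[OF MN(2)] 1 by simp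
      finally have cK: "card (N - M) \<le> K" .
      then have "\<bar>g N - g M\<bar> \<le> \<kappa> * real (card (N - M))" using lip MN unfolding lipschitz_upto_def by blast
      also have "\<dots> \<le> \<kappa> * real K" using cK k0 by (intro mult_left_mono) auto
      finally show "\<bar>g N - g M\<bar> \<le> \<kappa> * real K" .
    qed
    also have "\<dots> \<le> ?w * (25 * \<kappa>\<^sup>2 * real (card S) + \<kappa>\<^sup>2 * (real K)\<^sup>2 + 40 ^ k * ?\<Psi> S J)"
      using pot0[of S J] by (intro mult_left_mono) (auto simp: power_mult_distrib)
    finally show ?thesis .
  next
    case 2
    have "matching_sse E S J g \<le> ?w * 1\<^sup>2"
    proof (rule matching_sse_le[OF fin])
      fix M N assume "M \<in> perfect_matchings E S J" "N \<in> perfect_matchings E S J"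
      then show "\<bar>g N - g M\<bar> \<le> 1" using g01[of M] g01[of N] by linarith
    qed simp
    also have "\<dots> \<le> ?w * (25 * \<kappa>\<^sup>2 * real (card S) + \<kappa>\<^sup>2 * (real K)\<^sup>2 + 40 ^ k * ?\<Psi> S J)"
    proof (rule mult_left_mono)
      have "40 * k \<le> card S" using K(2) 2(1) by linarith
      from nonedge_potential_bad[OF fin c this 2(2)]
      have "1 \<le> 40 ^ k * ?\<Psi> S J" .
      moreover have "0 \<le> 25 * \<kappa>\<^sup>2 * real (card S) + \<kappa>\<^sup>2 * (real K)\<^sup>2" by simp
      ultimately have "1 \<le> 25 * \<kappa>\<^sup>2 * real (card S) + \<kappa>\<^sup>2 * (real K)\<^sup>2 + 40 ^ k * ?\<Psi> S J" by linarith
      then show "1\<^sup>2 \<le> 25 * \<kappa>\<^sup>2 * real (card S) + \<kappa>\<^sup>2 * (real K)\<^sup>2 + 40 ^ k * ?\<Psi> S J" by simp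
    qed simp
    finally show ?thesis .
  next
    case 3
    let ?m = "\<lambda>x j. matching_mean E (S - {x}) (J - {j}) (\<lambda>M. g (insert (x, j) M))"
    let ?c = "\<lambda>x j. matching_count E (S - {x}) (J - {j})"
    let ?B = "25 * \<kappa>\<^sup>2 * real (card S) + \<kappa>\<^sup>2 * (real K)\<^sup>2"
    have wpos: "0 < ?w" using 3 c K by (intro matching_count_pos[OF 3(2)]) auto
    have osc: "\<bar>?m x j - matching_mean E S J g\<bar> \<le> 5 * \<kappa>" if x: "x \<in> S" "j \<in> J" "(x, j) \<in> E" for x j
    proof -
      have "\<bar>?m x j' - ?m x j\<bar> \<le> 4 * \<kappa> + (1/2) ^ t" if "j' \<in> J" "(x, j') \<in> E" for j'
      proof (rule matching_mean_oscillation[OF 3(2) c _ _ lip k0 g01])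
        show "10 * (card S div 20) + 10 + t \<le> card S" using 3(1) K(1) by linarith
      qed (use that x K in auto)
      then have m: "\<bar>?m x j' - ?m x j\<bar> \<le> 5 * \<kappa>" if "j' \<in> J" "(x, j') \<in> E" for j'
        using that K(3) by fastforce
      define Y where "Y = {j'\<in>J. (x, j') \<in> E}"
      have Y: "(\<Sum>l\<in>J. edge E x l * f l) = (\<Sum>l\<in>Y. f l)" for f :: "'a \<Rightarrow> real"
        unfolding Y_def using fin by (simp add: of_bool_def if_distrib[of "\<lambda>c. c * _"] sum.inter_filter cong: if_cong)
      have "matching_mean E S J g = weighted_mean (?c x) (?m x) Y"
        unfolding matching_mean_row[OF fin x(1)] weighted_mean_def using Y by (simp add: mult.assoc)
      also have "\<bar>\<dots> - ?m x j\<bar> \<le> 5 * \<kappa>"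
      proof (rule weighted_mean_close)
        show "0 < sum (?c x) Y" using wpos matching_count_row[OF fin x(1), of E] Y by simp
      qed (use m in \<open>auto simp: Y_def\<close>)
      finally show ?thesis by (simp add: abs_minus_commute)
    qed
    \<comment> \<open>The induction hypothesis provides \<open>25 \<kappa>\<^sup>2\<close> less for the smaller graph, which is what the revealed edge costs.\<close>
    have rowb: "matching_sse E S J g \<le> ?w * ?B + 40 ^ k * (\<Sum>j\<in>J. edge E x j * (?c x j * ?\<Psi> (S - {x}) (J - {j})))"
      if x: "x \<in> S" for x
    proof -
      have "matching_sse E S J g = (\<Sum>j\<in>J. edge E x j * (matching_sse E (S - {x}) (J - {j}) (\<lambda>M. g (insert (x, j) M)) +
          ?c x j * (?m x j - matching_mean E S J g)\<^sup>2))" by (rule matching_sse_row[OF fin x])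
      also have "\<dots> \<le> (\<Sum>j\<in>J. edge E x j * (?c x j * ?B + 40 ^ k * (?c x j * ?\<Psi> (S - {x}) (J - {j}))))"
      proof (rule sum_mono)
        fix j assume j: "j \<in> J"
        show "edge E x j * (matching_sse E (S - {x}) (J - {j}) (\<lambda>M. g (insert (x, j) M)) +
          ?c x j * (?m x j - matching_mean E S J g)\<^sup>2) \<le> edge E x j * (?c x j * ?B + 40 ^ k * (?c x j * ?\<Psi> (S - {x}) (J - {j})))"
        proof (cases "(x, j) \<in> E")
          case True
          have cS: "card (S - {x}) = N" using fin x sN by simp
          have "matching_sse E (S - {x}) (J - {j}) (\<lambda>M. g (insert (x, j) M)) \<le> ?c x j *
            (25 * \<kappa>\<^sup>2 * real (card (S - {x})) + \<kappa>\<^sup>2 * (real K)\<^sup>2 + 40 ^ k * ?\<Psi> (S - {x}) (J - {j}))"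
          proof (rule Suc.hyps(1))
            show "lipschitz_upto K \<kappa> (\<lambda>M. g (insert (x, j) M)) E (S - {x}) (J - {j})"
              by (rule lipschitz_upto_insert[OF lip x j True])
            fix M assume "M \<in> perfect_matchings E (S - {x}) (J - {j})"
            then show "0 \<le> g (insert (x, j) M) \<and> g (insert (x, j) M) \<le> 1"
              by (intro g01 insert_perfect_matching[OF x j True])
          qed (use fin x j c sN k0 K in auto)
          moreover have "?c x j * (?m x j - matching_mean E S J g)\<^sup>2 \<le> ?c x j * (25 * \<kappa>\<^sup>2)"
          proof (rule mult_left_mono)
            have "(?m x j - matching_mean E S J g)\<^sup>2 \<le> (5 * \<kappa>)\<^sup>2"
              using osc[OF x j True] by (metis abs_ge_zero power2_abs power_mono)
            then show "(?m x j - matching_mean E S J g)\<^sup>2 \<le> 25 * \<kappa>\<^sup>2" by (simp add: power_mult_distrib)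
          qed simp
          ultimately show ?thesis using True cS sN by (simp add: algebra_simps)
        qed simp
      qed
      also have "\<dots> = (\<Sum>j\<in>J. edge E x j * ?c x j) * ?B + 40 ^ k * (\<Sum>j\<in>J. edge E x j * (?c x j * ?\<Psi> (S - {x}) (J - {j})))"
        unfolding distrib_left sum.distrib sum_distrib_right sum_distrib_left
        by (intro arg_cong2[where f="(+)"] sum.cong refl) (simp_all add: algebra_simps)
      also have "(\<Sum>j\<in>J. edge E x j * ?c x j) = ?w" by (rule matching_count_row[OF fin x, symmetric])
      finally show ?thesis .
    qed
    have "real (card S) * matching_sse E S J g = (\<Sum>x\<in>S. matching_sse E S J g)" by simp
    also have "\<dots> \<le> (\<Sum>x\<in>S. ?w * ?B + 40 ^ k * (\<Sum>j\<in>J. edge E x j * (?c x j * ?\<Psi> (S - {x}) (J - {j}))))"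
      by (intro sum_mono rowb)
    also have "\<dots> = real (card S) * (?w * ?B) + 40 ^ k * (\<Sum>x\<in>S. \<Sum>j\<in>J. edge E x j * (?c x j * ?\<Psi> (S - {x}) (J - {j})))"
      by (simp add: sum.distrib sum_distrib_left)
    also have "(\<Sum>x\<in>S. \<Sum>j\<in>J. edge E x j * (?c x j * ?\<Psi> (S - {x}) (J - {j}))) =
       (\<Sum>M\<in>perfect_matchings E S J. \<Sum>e\<in>M. ?\<Psi> (S - {fst e}) (J - {snd e}))"
      using sum_pairs_matchings[OF fin, of E "\<lambda>e. ?\<Psi> (S - {fst e}) (J - {snd e})"] by simp
    also have "\<dots> \<le> (\<Sum>M\<in>perfect_matchings E S J. real (card S) * ?\<Psi> S J)"
      using fin 3(1) K by (intro sum_mono nonedge_potential_average) auto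
    also have "\<dots> = real (card S) * (?w * ?\<Psi> S J)" by (simp add: matching_count_def)
    finally have "real (card S) * matching_sse E S J g \<le> real (card S) * (?w * (?B + 40 ^ k * ?\<Psi> S J))"
      by (simp add: algebra_simps)
    then show ?thesis using sN by simp
  qed
qed

text \<open>The leading term \<open>n L\<^sup>2\<close> is what independent increments of size \<open>L\<close> would give. The last term comes from
histories in which the graph does not stay dense and is at most \<open>2 n L\<^sup>2\<close> by the choice of \<open>k\<close>.\<close>

lemma matching_variance_bound:
  assumes d: "dense_between E z V W" and c: "card V = card W" and z: "160 * z \<le> card V"
    and g: "\<And>M x a y b. M \<in> perfect_matchings E V W \<Longrightarrow> (x, a) \<in> M \<Longrightarrow> (y, b) \<in> M \<Longrightarrow> x \<noteq> y \<Longrightarrow>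
       (x, b) \<in> E \<Longrightarrow> (y, a) \<in> E \<Longrightarrow> \<bar>g (insert (x, b) (insert (y, a) (M - {(x, a), (y, b)}))) - g M\<bar> \<le> L"
    and g01: "\<And>M. M \<in> perfect_matchings E V W \<Longrightarrow> 0 \<le> g M \<and> g M \<le> 1"
    and L: "0 \<le> L" "(1/2) ^ k \<le> L" and k: "40 * k + 20 = K" "2 * K \<le> card V" "1 \<le> k"
  shows "matching_sse E V W g \<le> matching_count E V W *
    (225 * L\<^sup>2 * real (card V) + 9 * L\<^sup>2 * (real K)\<^sup>2 + 2 * real (card V) / 4 ^ k)"
proof -
  have fin: "finite V" "finite W" using d by (auto simp: dense_between_def)
  have lip: "lipschitz_upto K (3 * L) g E V W"
    unfolding lipschitz_upto_def
  proof (intro ballI impI)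
    fix M M' assume M: "M \<in> perfect_matchings E V W" "M' \<in> perfect_matchings E V W" "card (M - M') \<le> K"
    have "card (M - M') + 4 * z < card V" using M(3) k z by linarith
    from switch_path[OF d c g L(1) M(1,2) this]
    show "\<bar>g M - g M'\<bar> \<le> 3 * L * real (card (M - M'))" by blast
  qed
  have "matching_sse E V W g \<le> matching_count E V W *
    (25 * (3 * L)\<^sup>2 * real (card V) + (3 * L)\<^sup>2 * (real K)\<^sup>2 + 40 ^ k * nonedge_potential k E V W)"
    using k L by (intro matching_variance_recursion[OF fin c lip _ g01, of k]) auto
  also have "\<dots> \<le> matching_count E V W *
    (25 * (3 * L)\<^sup>2 * real (card V) + (3 * L)\<^sup>2 * (real K)\<^sup>2 + 2 * real (card V) / 4 ^ k)"
    using nonedge_potential_initial[OF d c z, of k] k by (intro mult_left_mono add_left_mono) auto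
  finally show ?thesis by (simp add: power_mult_distrib)
qed

section \<open>Extending partial matchings\<close>

definition partial_matchings :: "('a \<times> 'a) set \<Rightarrow> nat \<Rightarrow> ('a \<times> 'a) set set" where
  "partial_matchings E q = {Q. Q \<subseteq> E \<and> inj_on fst Q \<and> inj_on snd Q \<and> finite Q \<and> card Q = q}"

lemma remove_partial_matching:
  assumes M: "M \<in> perfect_matchings E S J" and Q: "finite Q" "Q \<subseteq> M"
  shows "M - Q \<in> perfect_matchings E (S - fst ` Q) (J - snd ` Q)"
  using Q
proof (induction Q rule: finite_induct)
  case (insert e Q)
  have "M - Q \<in> perfect_matchings E (S - fst ` Q) (J - snd ` Q)" using insert by auto
  moreover have "(fst e, snd e) \<in> M - Q" using insert by auto
  ultimately have "M - Q - {(fst e, snd e)} \<in> perfect_matchings E (S - fst ` Q - {fst e}) (J - snd ` Q - {snd e})"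
    by (rule remove_perfect_matching)
  moreover have "M - Q - {(fst e, snd e)} = M - insert e Q" "S - fst ` Q - {fst e} = S - fst ` insert e Q"
    "J - snd ` Q - {snd e} = J - snd ` insert e Q" by auto
  ultimately show ?case by simp
qed (use M in simp)

lemma add_partial_matching:
  assumes "finite Q" "Q \<subseteq> E" "Q \<subseteq> S \<times> J" "inj_on fst Q" "inj_on snd Q"
    and "M \<in> perfect_matchings E (S - fst ` Q) (J - snd ` Q)"
  shows "M \<union> Q \<in> perfect_matchings E S J"
  using assms
proof (induction Q arbitrary: M rule: finite_induct)
  case (insert e Q)
  obtain x j where e: "e = (x, j)" by force
  have eQ: "x \<notin> fst ` Q" "j \<notin> snd ` Q" using insert.prems(3,4) insert.hyps(2) by (auto simp: e)
  have sets: "S - fst ` insert e Q = S - fst ` Q - {x}" "J - snd ` insert e Q = J - snd ` Q - {j}" by (auto simp: e)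
  have "insert (x, j) M \<in> perfect_matchings E (S - fst ` Q) (J - snd ` Q)"
    using insert.prems eQ unfolding sets by (intro insert_perfect_matching) (auto simp: e)
  then have "insert (x, j) M \<union> Q \<in> perfect_matchings E S J"
    using insert.prems by (intro insert.IH) auto
  then show ?case by (simp add: e)
qed simp

lemma card_matchings_containing:
  assumes Q: "Q \<in> partial_matchings E q" and E: "E \<subseteq> V \<times> W"
  shows "real (card {M \<in> perfect_matchings E V W. Q \<subseteq> M}) = matching_count E (V - fst ` Q) (W - snd ` Q)"
proof -
  have Qp: "finite Q" "Q \<subseteq> E" "inj_on fst Q" "inj_on snd Q" using Q by (auto simp: partial_matchings_def)
  have "bij_betw (\<lambda>M. M - Q) {M \<in> perfect_matchings E V W. Q \<subseteq> M} (perfect_matchings E (V - fst ` Q) (W - snd ` Q))"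
  proof (rule bij_betw_byWitness[where f'="\<lambda>M. M \<union> Q"])
    show "\<forall>M\<in>{M \<in> perfect_matchings E V W. Q \<subseteq> M}. M - Q \<union> Q = M" by auto
    show "\<forall>M\<in>perfect_matchings E (V - fst ` Q) (W - snd ` Q). M \<union> Q - Q = M"
    proof
      fix M assume M: "M \<in> perfect_matchings E (V - fst ` Q) (W - snd ` Q)"
      have "e \<notin> Q" if "e \<in> M" for e
      proof
        assume "e \<in> Q"
        then have "fst e \<in> fst ` Q" by simp
        moreover have "fst e \<in> V - fst ` Q" using perfect_matching_edgeD(2)[OF M, of "fst e" "snd e"] that by simp
        ultimately show False by simp
      qed
      then show "M \<union> Q - Q = M" by auto
    qed
    show "(\<lambda>M. M - Q) ` {M \<in> perfect_matchings E V W. Q \<subseteq> M} \<subseteq> perfect_matchings E (V - fst ` Q) (W - snd ` Q)"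
      using remove_partial_matching Qp by auto
    show "(\<lambda>M. M \<union> Q) ` perfect_matchings E (V - fst ` Q) (W - snd ` Q) \<subseteq> {M \<in> perfect_matchings E V W. Q \<subseteq> M}"
      using add_partial_matching[of Q E V W] Qp E by auto
  qed
  then show ?thesis unfolding matching_count_def by (simp add: bij_betw_same_card)
qed

lemma perfect_matching_subsets:
  assumes "M \<in> perfect_matchings E S J" "finite S" "finite J"
  shows "{Q \<in> partial_matchings E q. Q \<subseteq> M} = {Q. Q \<subseteq> M \<and> card Q = q}"
proof -
  have "finite M" "inj_on fst M" "inj_on snd M" "M \<subseteq> E"
    using perfect_matching_finite[OF assms] perfect_matching_fst[OF assms(1)] perfect_matching_snd[OF assms(1)] assms(1)
    by (auto simp: bij_betw_def perfect_matchings_def)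
  then show ?thesis unfolding partial_matchings_def
    by (auto intro: inj_on_subset finite_subset)
qed

lemma finite_partial_matchings: "finite E \<Longrightarrow> finite (partial_matchings E q)"
  by (rule finite_subset[of _ "Pow E"]) (auto simp: partial_matchings_def)

text \<open>The set \<open>J\<close> is changed into \<open>J'\<close> one column at a time.\<close>

lemma columns_exchange:
  assumes r: "regular_between E D V W" and z: "card V \<le> D + z" "10 * z \<le> card V" and n: "64 \<le> card V"
    and q: "1 \<le> q" "16 * q \<le> card V"
    and S: "S \<subseteq> V" "card S + q = card V" and J: "J \<subseteq> W" "card J = card S" and J': "J' \<subseteq> W" "card J' = card S"
  shows "matching_count E S J \<le> (1 + 5 * real q / real (card V)) ^ card (J - J') * matching_count E S J'"
  using J
proof (induction "card (J - J')" arbitrary: J)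
  case 0
  have fin: "finite W" using r by (simp add: regular_between_def)
  have finJ: "finite J" "finite J'" using fin 0 J' finite_subset by blast+
  have "J \<subseteq> J'" using 0(1) finJ by auto
  then have "J = J'" using finJ J'(2) 0(3) by (metis card_subset_eq)
  then show ?case by simp
next
  case (Suc k J)
  have fin: "finite W" "finite V" using r by (auto simp: regular_between_def)
  have finJ: "finite J" "finite J'" using fin Suc.prems J' finite_subset by blast+
  obtain s' where s': "s' \<in> J" "s' \<notin> J'" using Suc(2) by (metis Diff_iff card.empty ex_in_conv nat.distinct(1))
  have "card (J' - J) = card (J - J')"
    using finJ Suc.prems J'(2) by (metis card_le_sym_Diff le_antisym order_refl)
  then have "0 < card (J' - J)" using Suc(2) by simp
  then have "J' - J \<noteq> {}" by force
  then obtain s where s: "s \<in> J'" "s \<notin> J" by auto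
  define J0 where "J0 = J - {s'}"
  have J: "J = insert s' J0" using s' by (auto simp: J0_def)
  have "card J = Suc (card J0)" using s' finJ by (metis J0_def card_Suc_Diff1)
  then have c0: "card J0 + 1 = card S" using Suc.prems by simp
  have "matching_count E S J \<le> (1 + 5 * real q / real (card V)) * matching_count E S (insert s J0)"
    unfolding J using c0 S s s' Suc.prems J' by (intro column_exchange[OF r z n q]) (auto simp: J0_def)
  also have "\<dots> \<le> (1 + 5 * real q / real (card V)) * ((1 + 5 * real q / real (card V)) ^ k * matching_count E S J')"
  proof (rule mult_left_mono)
    have "J - J' = insert s' (insert s J0 - J')" using s s' by (auto simp: J0_def)
    moreover have "s' \<notin> insert s J0 - J'" using s s' by (auto simp: J0_def)
    ultimately have k: "k = card (insert s J0 - J')" using Suc(2) finJ by (simp add: J0_def)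
    have "card (insert s J0) = card S" using c0 s finJ by (simp add: J0_def)
    from Suc(1)[OF k _ this] show "matching_count E S (insert s J0) \<le> (1 + 5 * real q / real (card V)) ^ k * matching_count E S J'"
      using s J' Suc.prems unfolding k by (auto simp: J0_def)
  qed auto
  finally show ?case unfolding Suc(2)[symmetric] by (simp add: mult.assoc)
qed

text \<open>The matchings that contain \<open>Q\<close> are the perfect matchings of the graph without the \<open>q\<close> rows and columns of
\<open>Q\<close>. At most \<open>q\<close> exchanges of columns and \<open>q\<close> exchanges of rows lead to those of \<open>Q'\<close>.\<close>

lemma matchings_containing_ratio:
  assumes r: "regular_between E D V W" and z: "card V \<le> D + z" "10 * z \<le> card V" and n: "64 \<le> card V"
    and q: "1 \<le> q" "16 * q \<le> card V"
    and Q: "Q \<in> partial_matchings E q" "Q' \<in> partial_matchings E q"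
  shows "matching_count E (V - fst ` Q) (W - snd ` Q) \<le>
    (1 + 5 * real q / real (card V)) ^ (2 * q) * matching_count E (V - fst ` Q') (W - snd ` Q')"
proof -
  have fin: "finite W" "finite V" and cVW: "card V = card W" and E: "E \<subseteq> V \<times> W"
    using r by (auto simp: regular_between_def)
  let ?d = "1 + 5 * real q / real (card V)"
  have d1: "1 \<le> ?d" by simp
  have Qi: "fst ` R \<subseteq> V" "snd ` R \<subseteq> W" "card (fst ` R) = q" "card (snd ` R) = q" "finite R"
    if "R \<in> partial_matchings E q" for R
    using that E by (auto simp: partial_matchings_def card_image)
  have cards: "card (V - fst ` R) = card V - q" "card (W - snd ` R) = card V - q"
    if "R \<in> partial_matchings E q" for R
    using Qi[OF that] cVW by (auto simp: card_Diff_subset)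
  have "matching_count E (V - fst ` Q) (W - snd ` Q) \<le> ?d ^ card ((W - snd ` Q) - (W - snd ` Q')) * matching_count E (V - fst ` Q) (W - snd ` Q')"
    using cards[OF Q(1)] cards[OF Q(2)] q by (intro columns_exchange[OF r z n q]) auto
  also have "\<dots> \<le> ?d ^ q * matching_count E (V - fst ` Q) (W - snd ` Q')"
  proof (intro mult_right_mono power_increasing[OF _ d1])
    have "card ((W - snd ` Q) - (W - snd ` Q')) \<le> card (snd ` Q')" using Qi(5)[OF Q(2)] by (intro card_mono) auto
    then show "card ((W - snd ` Q) - (W - snd ` Q')) \<le> q" using Qi(4)[OF Q(2)] by simp
  qed simp
  also have "matching_count E (V - fst ` Q) (W - snd ` Q') \<le> ?d ^ card ((V - fst ` Q) - (V - fst ` Q')) * matching_count E (V - fst ` Q') (W - snd ` Q')"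
  proof -
    have "matching_count (E\<inverse>) (W - snd ` Q') (V - fst ` Q) \<le> (1 + 5 * real q / real (card W)) ^ card ((V - fst ` Q) - (V - fst ` Q'))
      * matching_count (E\<inverse>) (W - snd ` Q') (V - fst ` Q')"
      using cards[OF Q(1)] cards[OF Q(2)] q z n cVW
      by (intro columns_exchange[OF regular_between_converse[OF r]]) auto
    then show ?thesis by (simp add: matching_count_converse cVW)
  qed
  also have "\<dots> \<le> ?d ^ q * matching_count E (V - fst ` Q') (W - snd ` Q')"
  proof (intro mult_right_mono power_increasing[OF _ d1])
    have "card ((V - fst ` Q) - (V - fst ` Q')) \<le> card (fst ` Q')" using Qi(5)[OF Q(2)] by (intro card_mono) auto
    then show "card ((V - fst ` Q) - (V - fst ` Q')) \<le> q" using Qi(3)[OF Q(2)] by simp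
  qed simp
  finally have "matching_count E (V - fst ` Q) (W - snd ` Q) \<le> ?d ^ q * (?d ^ q * matching_count E (V - fst ` Q') (W - snd ` Q'))"
    using d1 by (simp add: mult_left_mono)
  then show ?thesis by (simp add: mult_2 power_add mult.assoc)
qed

text \<open>The \<open>q\<close> rows and \<open>q\<close> columns of \<open>Q\<close> meet \<open>2 q D\<close> edges, except that up to \<open>q\<^sup>2\<close> edges are counted twice.
Apart from this the number does not depend on \<open>Q\<close>.\<close>

lemma card_disjoint_edges:
  assumes r: "regular_between E D V W" and Q: "Q \<in> partial_matchings E q"
  shows "real (card V) * real D - 2 * real q * real D \<le> real (card {e\<in>E. fst e \<notin> fst ` Q \<and> snd e \<notin> snd ` Q})"
    "real (card {e\<in>E. fst e \<notin> fst ` Q \<and> snd e \<notin> snd ` Q}) \<le> real (card V) * real D - 2 * real q * real D + (real q)\<^sup>2"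
proof -
  have fin: "finite W" "finite V" and E: "E \<subseteq> V \<times> W"
    using r by (auto simp: regular_between_def)
  have finE: "finite E" by (rule finite_subset[OF E]) (simp add: fin)
  have Qi: "fst ` Q \<subseteq> V" "snd ` Q \<subseteq> W" "card (fst ` Q) = q" "card (snd ` Q) = q" "finite Q"
    using Q E by (auto simp: partial_matchings_def card_image)
  have rows: "card {e\<in>E. fst e \<in> I} = card I * D" if "I \<subseteq> V" for I
  proof -
    have finI: "finite I" using that fin finite_subset by blast
    have "{e\<in>E. fst e \<in> I} = (SIGMA x:I. {j\<in>W. (x, j) \<in> E})" using E by auto
    also have "card \<dots> = (\<Sum>x\<in>I. card {j\<in>W. (x, j) \<in> E})" using finI fin by (intro card_SigmaI) auto
    also have "\<dots> = (\<Sum>x\<in>I. D)" using r that by (intro sum.cong) (auto simp: regular_between_def)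
    finally show ?thesis by simp
  qed
  have cols: "card {e\<in>E. snd e \<in> I} = card I * D" if "I \<subseteq> W" for I
  proof -
    have finI: "finite I" using that fin finite_subset by blast
    have "{e\<in>E. snd e \<in> I} = prod.swap ` (SIGMA j:I. {x\<in>V. (x, j) \<in> E})" using E by (auto simp: image_iff)
    also have "card \<dots> = card (SIGMA j:I. {x\<in>V. (x, j) \<in> E})" by (intro card_image) auto
    also have "\<dots> = (\<Sum>j\<in>I. card {x\<in>V. (x, j) \<in> E})" using finI fin by (intro card_SigmaI) auto
    also have "\<dots> = (\<Sum>x\<in>I. D)" using r that by (intro sum.cong) (auto simp: regular_between_def)
    finally show ?thesis by simp
  qed
  let ?A = "{e\<in>E. fst e \<in> fst ` Q}" and ?B = "{e\<in>E. snd e \<in> snd ` Q}"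
  have "{e\<in>E. fst e \<in> V} = E" using E by auto
  then have cE: "card E = card V * D" using rows[of V] by simp
  have "{e\<in>E. fst e \<notin> fst ` Q \<and> snd e \<notin> snd ` Q} = E - (?A \<union> ?B)" by auto
  then have c1: "real (card {e\<in>E. fst e \<notin> fst ` Q \<and> snd e \<notin> snd ` Q}) = real (card E) - real (card (?A \<union> ?B))"
    using finE by (simp add: card_Diff_subset card_mono of_nat_diff)
  have c2: "card ?A + card ?B = card (?A \<union> ?B) + card (?A \<inter> ?B)"
    using finE by (intro card_Un_Int) auto
  have c3: "card ?A = q * D" "card ?B = q * D" using rows[OF Qi(1)] cols[OF Qi(2)] Qi by auto
  have c4: "card (?A \<inter> ?B) \<le> q * q"
  proof -
    have "?A \<inter> ?B \<subseteq> fst ` Q \<times> snd ` Q"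
    proof
      fix e assume "e \<in> ?A \<inter> ?B"
      then show "e \<in> fst ` Q \<times> snd ` Q" by (simp add: mem_Times_iff)
    qed
    then have "card (?A \<inter> ?B) \<le> card (fst ` Q \<times> snd ` Q)" using Qi(5) by (intro card_mono) auto
    then show ?thesis using Qi by (simp add: card_cartesian_product)
  qed
  have "real q * real D + real q * real D = real (card (?A \<union> ?B)) + real (card (?A \<inter> ?B))"
    using arg_cong[OF c2[unfolded c3], of real] by simp
  moreover have "real (card (?A \<inter> ?B)) \<le> (real q)\<^sup>2"
    using of_nat_mono[OF c4, where 'a=real] by (simp add: power2_eq_square)
  moreover have "real (card E) = real (card V) * real D" using cE by simp
  ultimately show "real (card V) * real D - 2 * real q * real D \<le> real (card {e\<in>E. fst e \<notin> fst ` Q \<and> snd e \<notin> snd ` Q})"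
    "real (card {e\<in>E. fst e \<notin> fst ` Q \<and> snd e \<notin> snd ` Q}) \<le> real (card V) * real D - 2 * real q * real D + (real q)\<^sup>2"
    unfolding c1 by linarith+
qed

text \<open>Both sides count the pairs of a matching with \<open>q + 1\<close> edges and one of its edges.\<close>

lemma partial_matchings_count_step:
  assumes finE: "finite E"
  shows "real (Suc q) * real (card (partial_matchings E (Suc q))) =
    (\<Sum>Q\<in>partial_matchings E q. real (card {e\<in>E. fst e \<notin> fst ` Q \<and> snd e \<notin> snd ` Q}))"
proof -
  let ?P = "partial_matchings E"
  let ?X = "SIGMA Q:?P q. {e\<in>E. fst e \<notin> fst ` Q \<and> snd e \<notin> snd ` Q}"
  let ?Y = "SIGMA R:?P (Suc q). R"
  have "bij_betw (\<lambda>(Q, e). (insert e Q, e)) ?X ?Y"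
  proof (rule bij_betw_byWitness[where f'="\<lambda>(R, e). (R - {e}, e)"])
    have ne: "e \<notin> Q" if "fst e \<notin> fst ` Q" for e :: "'a \<times> 'a" and Q using that by auto
    show "\<forall>x\<in>?X. (case case x of (Q, e) \<Rightarrow> (insert e Q, e) of (R, e) \<Rightarrow> (R - {e}, e)) = x"
    proof
      fix p assume "p \<in> ?X"
      then obtain Q e where p: "p = (Q, e)" "fst e \<notin> fst ` Q" by auto
      then have "e \<notin> Q" by (intro ne)
      then show "(case case p of (Q, e) \<Rightarrow> (insert e Q, e) of (R, e) \<Rightarrow> (R - {e}, e)) = p" by (simp add: p)
    qed
    show "\<forall>x\<in>?Y. (case case x of (R, e) \<Rightarrow> (R - {e}, e) of (Q, e) \<Rightarrow> (insert e Q, e)) = x"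
    proof
      fix p assume "p \<in> ?Y"
      then obtain R e where p: "p = (R, e)" "e \<in> R" by auto
      then show "(case case p of (R, e) \<Rightarrow> (R - {e}, e) of (Q, e) \<Rightarrow> (insert e Q, e)) = p" by (simp add: insert_absorb)
    qed
    show "(\<lambda>(Q, e). (insert e Q, e)) ` ?X \<subseteq> ?Y"
    proof
      fix p assume "p \<in> (\<lambda>(Q, e). (insert e Q, e)) ` ?X"
      then obtain Q x j where "Q \<in> ?P q" "(x, j) \<in> E" "fst (x, j) \<notin> fst ` Q" "snd (x, j) \<notin> snd ` Q"
        and p: "p = (insert (x, j) Q, x, j)" by auto
      then have Q: "inj_on fst Q" "inj_on snd Q" "finite Q" "card Q = q" "Q \<subseteq> E" "x \<notin> fst ` Q" "j \<notin> snd ` Q" "(x, j) \<in> E" "(x, j) \<notin> Q"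
        using ne[of "(x, j)" Q] by (auto simp: partial_matchings_def)
      then have "insert (x, j) Q \<in> ?P (Suc q)" unfolding partial_matchings_def by simp
      then show "p \<in> ?Y" by (simp add: p)
    qed
    show "(\<lambda>(R, e). (R - {e}, e)) ` ?Y \<subseteq> ?X"
    proof
      fix p assume "p \<in> (\<lambda>(R, e). (R - {e}, e)) ` ?Y"
      then obtain R x j where R: "R \<in> ?P (Suc q)" "(x, j) \<in> R" and p: "p = (R - {(x, j)}, x, j)" by auto
      then have inj: "inj_on fst R" "inj_on snd R" "finite R" "card R = Suc q" "R \<subseteq> E" by (auto simp: partial_matchings_def)
      have "R - {(x, j)} \<in> ?P q"
        using inj R(2) by (auto simp: partial_matchings_def intro: inj_on_subset)
      moreover have "x \<notin> fst ` (R - {(x, j)})" "j \<notin> snd ` (R - {(x, j)})"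
        using inj_on_image_set_diff[OF inj(1), of R "{(x, j)}"] inj_on_image_set_diff[OF inj(2), of R "{(x, j)}"] R(2) by auto
      ultimately show "p \<in> ?X" unfolding p using R(2) inj(5) by auto
    qed
  qed
  then have "card ?X = card ?Y" by (rule bij_betw_same_card)
  moreover have "card ?X = (\<Sum>Q\<in>?P q. card {e\<in>E. fst e \<notin> fst ` Q \<and> snd e \<notin> snd ` Q})"
    using finite_partial_matchings[OF finE] finE by (intro card_SigmaI) auto
  moreover have "card ?Y = (\<Sum>R\<in>?P (Suc q). card R)"
    using finite_partial_matchings[OF finE] by (intro card_SigmaI) (auto simp: partial_matchings_def)
  moreover have "(\<Sum>R\<in>?P (Suc q). card R) = (\<Sum>R\<in>?P (Suc q). Suc q)"
    by (intro sum.cong refl) (auto simp: partial_matchings_def)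
  ultimately have "Suc q * card (?P (Suc q)) = (\<Sum>Q\<in>?P q. card {e\<in>E. fst e \<notin> fst ` Q \<and> snd e \<notin> snd ` Q})"
    by (simp add: mult.commute)
  from arg_cong[OF this, of real] show ?thesis by (simp only: of_nat_mult of_nat_sum)
qed

section \<open>The chance that two random matchings are disjoint\<close>

lemma alternating_choose_sum: "(\<Sum>q\<le>K. (-1) ^ q * real (Suc T choose q)) = (-1) ^ K * real (T choose K)"
proof (induction K)
  case (Suc K)
  have "(\<Sum>q\<le>Suc K. (-1) ^ q * real (Suc T choose q)) = (-1) ^ K * real (T choose K) + (-1) ^ Suc K * real (Suc T choose Suc K)"
    using Suc by simp
  then show ?case by (simp add: algebra_simps)
qed simp

text \<open>The error of a truncated inclusion-exclusion sum is at most the first term left out; here \<open>T\<close> is the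
number of events that occur.\<close>

lemma bonferroni_truncation:
  "\<bar>of_bool (T = 0) - (\<Sum>q<K. (-1) ^ q * real (T choose q))\<bar> \<le> real (T choose K)"
proof (cases T)
  case 0
  have "(\<Sum>q<K. (-1) ^ q * real (0 choose q)) = (\<Sum>q<K. of_bool (q = 0))"
    by (intro sum.cong refl) (auto simp: binomial_eq_0)
  also have "\<dots> = of_bool (0 < K)" by (simp add: of_bool_def)
  finally have "(\<Sum>q<K. (-1) ^ q * real (0 choose q)) = of_bool (0 < K)" .
  then show ?thesis using 0 by (cases K) auto
next
  case (Suc t)
  show ?thesis
  proof (cases K)
    case (Suc k)
    have "(\<Sum>q<K. (-1) ^ q * real (T choose q)) = (-1) ^ k * real (t choose k)"
      unfolding Suc \<open>T = Suc t\<close> lessThan_Suc_atMost by (rule alternating_choose_sum)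
    then show ?thesis using Suc \<open>T = Suc t\<close> by (simp add: abs_mult)
  qed (use Suc in simp)
qed

lemma power4_le_power3: "real q ^ 4 \<le> 81 * 3 ^ q"
proof (cases "q \<le> 4")
  case True
  then have "q = 0 \<or> q = 1 \<or> q = 2 \<or> q = 3 \<or> q = 4" by auto
  then show ?thesis by auto
next
  case False
  then have "4 \<le> q" by simp
  then show ?thesis
  proof (induction q rule: dec_induct)
    case (step q)
    have "real (Suc q) \<le> 5/4 * real q" using step by simp
    then have "real (Suc q) ^ 4 \<le> (5/4 * real q) ^ 4" by (intro power_mono) auto
    also have "\<dots> = (5/4) ^ 4 * real q ^ 4" by (rule power_mult_distrib)
    also have "\<dots> \<le> 3 * real q ^ 4" by (intro mult_right_mono) (auto simp: power4_eq_xxxx)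
    also have "\<dots> \<le> 3 * (81 * 3 ^ q)" using step by simp
    finally show ?case by simp
  qed auto
qed

lemma poisson_weighted_sum:
  assumes "0 \<le> l" "l \<le> 2"
  shows "(\<Sum>q\<le>K. real q ^ 4 * (l ^ q / fact q)) \<le> 81 * exp 6"
proof -
  have "(\<Sum>q\<le>K. real q ^ 4 * (l ^ q / fact q)) \<le> (\<Sum>q\<le>K. 81 * (6 ^ q / fact q))"
  proof (rule sum_mono)
    fix q
    have "real q ^ 4 * (l ^ q / fact q) \<le> 81 * 3 ^ q * (2 ^ q / fact q)"
      using assms power4_le_power3[of q] by (intro mult_mono divide_right_mono power_mono) auto
    also have "\<dots> = 81 * (6 ^ q / fact q)" by (simp flip: power_mult_distrib)
    finally show "real q ^ 4 * (l ^ q / fact q) \<le> 81 * (6 ^ q / fact q)" .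
  qed
  also have "\<dots> = 81 * (\<Sum>q\<le>K. 6 ^ q / fact q)" by (simp add: sum_distrib_left)
  also have "(\<Sum>q\<le>K. 6 ^ q / fact q) \<le> exp (6::real)"
  proof -
    have "(\<Sum>q\<in>{..K}. inverse (fact q) *\<^sub>R (6::real) ^ q) \<le> (\<Sum>q. inverse (fact q) *\<^sub>R (6::real) ^ q)"
      using summable_exp_generic[of "6::real"] by (intro sum_le_suminf) (auto simp: divide_inverse)
    then show ?thesis by (simp add: exp_def divide_inverse mult.commute)
  qed
  finally show ?thesis by simp
qed

text \<open>If the binomial moments \<open>c q\<close> are those of a Poisson variable with mean \<open>l\<close> up to the relative error
\<open>\<epsilon> q\<^sup>4\<close>, then the probability \<open>H\<close> of the value 0 is \<open>exp (- l)\<close> up to a multiple of \<open>\<epsilon>\<close>, since \<open>q\<^sup>4\<close> has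
bounded mean under the Poisson law. The last summand is the truncation error.\<close>

lemma bonferroni_exp:
  assumes l: "0 \<le> l" "l \<le> 2" and e: "0 \<le> \<epsilon>"
    and c: "\<And>q. q \<le> K \<Longrightarrow> \<bar>c q - l ^ q / fact q\<bar> \<le> \<epsilon> * real q ^ 4 * (l ^ q / fact q)"
    and H: "\<bar>H - (\<Sum>q<K. (-1) ^ q * c q)\<bar> \<le> c K"
  shows "\<bar>H - exp (- l)\<bar> \<le> 81 * exp 6 * \<epsilon> + (1 + exp 2) * (2 ^ K / fact K)"
proof -
  obtain t where t: "\<bar>t\<bar> \<le> \<bar>-l\<bar>" "exp (- l) = (\<Sum>q<K. (- l) ^ q / fact q) + exp t / fact K * (- l) ^ K"
    using Maclaurin_exp_le[of "-l" K] by auto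
  have lK: "l ^ K / fact K \<le> 2 ^ K / fact K" using l by (intro divide_right_mono power_mono) auto
  have "\<bar>exp t / fact K * (- l) ^ K\<bar> = exp t * (l ^ K / fact K)" using l by (simp add: abs_mult power_abs)
  also have "\<dots> \<le> exp 2 * (2 ^ K / fact K)"
    using t(1) l lK by (intro mult_mono) auto
  finally have tail: "\<bar>exp t / fact K * (- l) ^ K\<bar> \<le> exp 2 * (2 ^ K / fact K)" .
  have "\<bar>(\<Sum>q<K. (-1) ^ q * c q) - (\<Sum>q<K. (- l) ^ q / fact q)\<bar> = \<bar>\<Sum>q<K. (-1) ^ q * (c q - l ^ q / fact q)\<bar>"
    by (simp add: sum_subtractf right_diff_distrib power_minus[of l])
  also have "\<dots> \<le> (\<Sum>q<K. \<epsilon> * (real q ^ 4 * (l ^ q / fact q)))"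
    using c by (intro order_trans[OF sum_abs] sum_mono) (auto simp: abs_mult mult.assoc)
  finally have mid: "\<bar>(\<Sum>q<K. (-1) ^ q * c q) - (\<Sum>q<K. (- l) ^ q / fact q)\<bar> \<le> (\<Sum>q<K. \<epsilon> * (real q ^ 4 * (l ^ q / fact q)))" .
  have cK: "c K \<le> \<epsilon> * (real K ^ 4 * (l ^ K / fact K)) + 2 ^ K / fact K"
    using c[of K] lK by (simp add: mult.assoc)
  have "(\<Sum>q<K. \<epsilon> * (real q ^ 4 * (l ^ q / fact q))) + \<epsilon> * (real K ^ 4 * (l ^ K / fact K)) = \<epsilon> * (\<Sum>q\<le>K. real q ^ 4 * (l ^ q / fact q))"
    by (simp add: sum_distrib_left lessThan_Suc_atMost[symmetric] distrib_left)
  also have "\<dots> \<le> \<epsilon> * (81 * exp 6)" using e poisson_weighted_sum[OF l] by (intro mult_left_mono)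
  finally have "(\<Sum>q<K. \<epsilon> * (real q ^ 4 * (l ^ q / fact q))) + \<epsilon> * (real K ^ 4 * (l ^ K / fact K)) \<le> 81 * exp 6 * \<epsilon>"
    by (simp only: mult.commute[of \<epsilon> "81 * exp 6"])
  moreover have "(1 + exp 2) * (2 ^ K / fact K) = 2 ^ K / fact K + exp 2 * (2 ^ K / (fact K :: real))"
    by (simp only: distrib_right mult_1)
  ultimately show ?thesis using H mid tail t(2) cK by linarith
qed

text \<open>The fraction 1/160 is the one with which \<open>nonedge_potential_initial\<close> starts.\<close>

locale dense_regular_graph =
  fixes E :: "('a \<times> 'a) set" and V W :: "'a set" and D z n :: nat
  assumes r: "regular_between E D V W" and n_def: "n = card V"
    and z: "n \<le> D + z" "160 * z \<le> n" and n: "64 \<le> n"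
begin

lemma fin: "finite V" "finite W" and cVW: "card W = n" and EVW: "E \<subseteq> V \<times> W" and finE: "finite E"
proof -
  show "finite V" "finite W" "card W = n" "E \<subseteq> V \<times> W" using r n_def by (auto simp: regular_between_def)
  then show "finite E" using finite_subset by fastforce
qed

lemma dens: "dense_between E z V W"
  using r z n_def by (intro regular_imp_dense) (auto simp: regular_between_def)

lemma count_pos: "0 < matching_count E V W"
  using z n n_def cVW by (intro matching_count_pos[OF dens]) auto

lemma D_lower: "159/160 * real n \<le> real D" and D_pos: "0 < real D"
proof -
  have "real n \<le> real D + real z" "160 * real z \<le> real n" using z by linarith+
  then show "159/160 * real n \<le> real D" by linarith
  then show "0 < real D" using n by linarith
qed

text \<open>Divided by the number of all perfect matchings, this is the probability that a random one contains \<open>Q\<close>.\<close>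

definition containing where
  "containing Q = real (card {M \<in> perfect_matchings E V W. Q \<subseteq> M})"

text \<open>A random perfect matching contains \<open>n choose q\<close> partial matchings of size \<open>q\<close>. This is the value that the
sum of the squared probabilities to contain \<open>Q\<close> would take if these probabilities were all equal.\<close>

definition uniform_moment where
  "uniform_moment q = (real (n choose q))\<^sup>2 / real (card (partial_matchings E q))"

lemma fin_matchings: "finite (perfect_matchings E V W)"
  using finite_perfect_matchings fin by blast

lemma sum_containing: "(\<Sum>Q\<in>partial_matchings E q. containing Q) = real (n choose q) * matching_count E V W"
proof -
  have "(\<Sum>Q\<in>partial_matchings E q. containing Q) = (\<Sum>Q\<in>partial_matchings E q. \<Sum>M\<in>perfect_matchings E V W. of_bool (Q \<subseteq> M))"
    using fin_matchings by (simp add: containing_def of_bool_def sum.If_cases Int_def)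
  also have "\<dots> = (\<Sum>M\<in>perfect_matchings E V W. \<Sum>Q\<in>partial_matchings E q. of_bool (Q \<subseteq> M))" by (rule sum.swap)
  also have "\<dots> = (\<Sum>M\<in>perfect_matchings E V W. real (n choose q))"
  proof (rule sum.cong[OF refl])
    fix M assume M: "M \<in> perfect_matchings E V W"
    have "(\<Sum>Q\<in>partial_matchings E q. of_bool (Q \<subseteq> M)) = real (card {Q\<in>partial_matchings E q. Q \<subseteq> M})"
      using finite_partial_matchings[OF finE] by (simp add: of_bool_def sum.If_cases Int_def)
    also have "\<dots> = real (n choose q)"
      unfolding perfect_matching_subsets[OF M fin]
      using n_subsets[of M q] perfect_matching_finite[OF M fin] perfect_matching_card[OF M] n_def by simp
    finally show "(\<Sum>Q\<in>partial_matchings E q. of_bool (Q \<subseteq> M)) = real (n choose q)" .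
  qed
  finally show ?thesis by (simp add: matching_count_def)
qed

lemma card_partial_pos:
  assumes "q \<le> n" shows "0 < real (card (partial_matchings E q))"
proof (rule ccontr)
  assume "\<not> ?thesis"
  then have "partial_matchings E q = {}" using finite_partial_matchings[OF finE, of q] by simp
  then show False using sum_containing[of q] count_pos assms by simp
qed

text \<open>The quotient of consecutive values involves the average number of edges disjoint from a partial matching,
which \<open>card_disjoint_edges\<close> gives up to \<open>q\<^sup>2\<close> out of about \<open>n D\<close>. The main term \<open>n D - 2 q D\<close> agrees
to first order in \<open>q / n\<close> with the factor \<open>(n - q)\<^sup>2\<close> coming from the squared binomial coefficient, so
the relative error is \<open>O(q\<^sup>2 / n\<^sup>2)\<close> and not merely \<open>O(q / n)\<close>.\<close>

lemma uniform_moment_step: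
  assumes q: "Suc q \<le> n" "4 * q \<le> n"
  shows "\<exists>\<phi>. uniform_moment (Suc q) = uniform_moment q * (real n / real D) / real (Suc q) * \<phi> \<and> \<bar>\<phi> - 1\<bar> \<le> 2 * (real q)\<^sup>2 / (real n)\<^sup>2"
proof -
  let ?a = "real (card (partial_matchings E q))" and ?a' = "real (card (partial_matchings E (Suc q)))"
  have pos: "0 < ?a" "0 < ?a'" using q card_partial_pos[of q] card_partial_pos[of "Suc q"] by auto
  define X where "X = real (Suc q) * ?a' / ?a"
  have X: "real (Suc q) * ?a' = X * ?a" using pos by (simp add: X_def)
  have npos: "0 < real n" using n by simp
  have step: "real (Suc q) * ?a' = (\<Sum>Q\<in>partial_matchings E q. real (card {e\<in>E. fst e \<notin> fst ` Q \<and> snd e \<notin> snd ` Q}))"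
    by (rule partial_matchings_count_step[OF finE])
  have "(\<Sum>Q\<in>partial_matchings E q. real n * real D - 2 * real q * real D) \<le> X * ?a"
    unfolding X[symmetric] step n_def using card_disjoint_edges[OF r] by (intro sum_mono) auto
  then have X1: "real n * real D - 2 * real q * real D \<le> X" using pos by (simp add: mult.commute)
  have "X * ?a \<le> (\<Sum>Q\<in>partial_matchings E q. real n * real D - 2 * real q * real D + (real q)\<^sup>2)"
    unfolding X[symmetric] step n_def using card_disjoint_edges[OF r] by (intro sum_mono) auto
  then have X2: "X \<le> real n * real D - 2 * real q * real D + (real q)\<^sup>2" using pos by (simp add: mult.commute)
  have q4: "4 * real q \<le> real n" using q by linarith
  \<comment> \<open>\<open>Y\<close> is the average number of disjoint edges, rescaled so that it can be compared with \<open>(n - q)\<^sup>2\<close>.\<close>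
  define Y where "Y = X * real n / real D"
  have "(real n * real D - 2 * real q * real D) * real n / real D \<le> Y"
    unfolding Y_def using X1 D_pos by (intro divide_right_mono mult_right_mono) auto
  moreover have "(real n * real D - 2 * real q * real D) * real n / real D = real n * real n - 2 * real q * real n"
    using D_pos by (simp add: field_simps)
  ultimately have Y1: "real n * real n - 2 * real q * real n \<le> Y" by simp
  have "Y \<le> (real n * real D - 2 * real q * real D + (real q)\<^sup>2) * real n / real D"
    unfolding Y_def using X2 D_pos by (intro divide_right_mono mult_right_mono) auto
  also have "\<dots> = real n * real n - 2 * real q * real n + (real q)\<^sup>2 * (real n / real D)"
    using D_pos by (simp add: field_simps)
  also have "(real q)\<^sup>2 * (real n / real D) \<le> (real q)\<^sup>2 * 2"
    using D_lower D_pos npos by (intro mult_left_mono) (auto simp: divide_le_eq)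
  finally have Y2: "Y \<le> real n * real n - 2 * real q * real n + 2 * (real q)\<^sup>2" by simp
  have Yh: "real n * real n / 2 \<le> Y"
  proof -
    have "4 * real q * real n \<le> real n * real n" using q4 npos by (intro mult_right_mono) auto
    then show ?thesis using Y1 by linarith
  qed
  have Ypos: "0 < Y" using Yh npos by (smt (verit) divide_pos_pos mult_pos_pos)
  define \<phi> where "\<phi> = (real n - real q)\<^sup>2 / Y"
  have "\<phi> - 1 = ((real n - real q)\<^sup>2 - Y) / Y" using Ypos by (simp add: \<phi>_def diff_divide_distrib)
  moreover have "\<bar>(real n - real q)\<^sup>2 - Y\<bar> \<le> (real q)\<^sup>2"
  proof -
    have "(real n - real q)\<^sup>2 = real n * real n - 2 * real q * real n + (real q)\<^sup>2"
      unfolding power2_diff by (simp add: power2_eq_square)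
    then show ?thesis using Y1 Y2 unfolding abs_le_iff by linarith
  qed
  ultimately have "\<bar>\<phi> - 1\<bar> \<le> (real q)\<^sup>2 / Y" using Ypos by (simp add: divide_right_mono)
  also have "\<dots> \<le> (real q)\<^sup>2 / (real n * real n / 2)" using Yh Ypos npos by (intro divide_left_mono) auto
  also have "\<dots> = 2 * (real q)\<^sup>2 / (real n)\<^sup>2" by (simp add: power2_eq_square)
  finally have p: "\<bar>\<phi> - 1\<bar> \<le> 2 * (real q)\<^sup>2 / (real n)\<^sup>2" .
  have ch: "real (n choose Suc q) = real (n choose q) * (real n - real q) / real (Suc q)"
    using choose_Suc_ratio[of q n] q by (simp add: field_simps of_nat_diff)
  have a': "?a' = ?a * X / real (Suc q)" using X by (simp add: field_simps)
  have Xpos: "0 < X" using X pos by (metis X_def divide_pos_pos mult_pos_pos of_nat_0_less_iff zero_less_Suc)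
  have "uniform_moment (Suc q) = (real (n choose q) * (real n - real q) / real (Suc q))\<^sup>2 / (?a * X / real (Suc q))"
    unfolding uniform_moment_def ch a' ..
  also have "\<dots> = (real (n choose q))\<^sup>2 / ?a * (real n - real q)\<^sup>2 / X / real (Suc q)"
    by (simp add: power_divide power_mult_distrib power2_eq_square mult_ac)
  also have "\<dots> = uniform_moment q * (real n / real D) / real (Suc q) * \<phi>"
    using npos D_pos Xpos by (simp add: uniform_moment_def \<phi>_def Y_def)
  finally show ?thesis using p by blast
qed

lemma uniform_moment_estimate:
  assumes "q\<^sup>2 \<le> n" "16 * q \<le> n"
  shows "(1 - 2 * real q ^ 3 / (real n)\<^sup>2) * ((real n / real D) ^ q / fact q) \<le> uniform_moment q \<and>
    uniform_moment q \<le> (1 + 4 * real q ^ 3 / (real n)\<^sup>2) * ((real n / real D) ^ q / fact q)"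
  using assms
proof (induction q)
  case 0
  have "partial_matchings E 0 = {{}}" by (auto simp: partial_matchings_def)
  then have "uniform_moment 0 = 1" by (simp add: uniform_moment_def)
  then show ?case by auto
next
  case (Suc q)
  let ?l = "real n / real D" and ?N = "(real n)\<^sup>2" and ?q = "real q"
  have qq: "q\<^sup>2 \<le> n" "16 * q \<le> n" "q \<le> n" "Suc q \<le> n"
    using Suc.prems by (auto simp: power2_eq_square)
  have npos: "0 < ?N" using n by simp
  have q2: "?q ^ 2 \<le> real n" using qq(1) by (metis of_nat_le_iff of_nat_power)
  have q3: "?q ^ 3 \<le> ?N / 16"
  proof -
    have "?q ^ 3 = ?q ^ 2 * ?q" by (simp add: power2_eq_square power3_eq_cube)
    also have "\<dots> \<le> real n * (real n / 16)" using q2 qq(2) by (intro mult_mono) auto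
    finally show ?thesis by (simp add: power2_eq_square)
  qed
  obtain \<phi> where p: "uniform_moment (Suc q) = uniform_moment q * ?l / real (Suc q) * \<phi>" "\<bar>\<phi> - 1\<bar> \<le> 2 * ?q\<^sup>2 / ?N"
    using uniform_moment_step[of q] qq by auto
  let ?e = "?l ^ q / fact q" and ?e' = "?l ^ Suc q / fact (Suc q)"
  have e': "?e' = ?e * ?l / real (Suc q)" by (simp add: field_simps)
  have e0: "0 \<le> ?e'" using D_pos by simp
  have frac: "0 \<le> 2 * ?q\<^sup>2 / ?N" "2 * ?q\<^sup>2 / ?N \<le> 1"
  proof -
    have "2 * ?q\<^sup>2 \<le> 2 * real n" using q2 by simp
    also have "\<dots> \<le> ?N" using n by (simp add: power2_eq_square)
    finally show "2 * ?q\<^sup>2 / ?N \<le> 1" using npos by simp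
  qed simp
  have p1: "1 - 2 * ?q\<^sup>2 / ?N \<le> \<phi>" "\<phi> \<le> 1 + 2 * ?q\<^sup>2 / ?N" "0 \<le> \<phi>" using p(2) frac by linarith+
  define x where "x = 2 * ?q ^ 3 / ?N"
  define y where "y = 2 * ?q\<^sup>2 / ?N"
  have xy: "0 \<le> x" "x \<le> 1/8" "0 \<le> y" "y \<le> 1" using q3 npos frac by (auto simp: x_def y_def field_simps)
  have IH: "(1 - x) * ?e \<le> uniform_moment q" "uniform_moment q \<le> (1 + 2 * x) * ?e"
    using Suc.IH qq by (auto simp: x_def)
  have e00: "0 \<le> ?e" using D_pos by simp
  have sf0: "0 \<le> uniform_moment q" by (simp add: uniform_moment_def)
  have low: "(1 - 2 * real (Suc q) ^ 3 / ?N) \<le> (1 - x) * (1 - y)"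
  proof -
    have "x + y \<le> 2 * real (Suc q) ^ 3 / ?N"
    proof -
      have "2 * ?q ^ 3 + 2 * ?q\<^sup>2 \<le> 2 * real (Suc q) ^ 3" by (simp add: power3_eq_cube power2_eq_square algebra_simps)
      then have "(2 * ?q ^ 3 + 2 * ?q\<^sup>2) / ?N \<le> 2 * real (Suc q) ^ 3 / ?N" by (intro divide_right_mono) auto
      then show ?thesis by (simp add: x_def y_def add_divide_distrib)
    qed
    moreover have "0 \<le> x * y" using xy by simp
    ultimately show ?thesis by (simp add: algebra_simps)
  qed
  have up: "(1 + 2 * x) * (1 + y) \<le> 1 + 4 * real (Suc q) ^ 3 / ?N"
  proof -
    have "2 * x + 2 * y \<le> 4 * real (Suc q) ^ 3 / ?N"
    proof -
      have "4 * ?q ^ 3 + 4 * ?q\<^sup>2 \<le> 4 * real (Suc q) ^ 3" by (simp add: power3_eq_cube power2_eq_square algebra_simps)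
      then have "(4 * ?q ^ 3 + 4 * ?q\<^sup>2) / ?N \<le> 4 * real (Suc q) ^ 3 / ?N" by (intro divide_right_mono) auto
      then show ?thesis by (simp add: x_def y_def add_divide_distrib)
    qed
    moreover have "2 * x * y \<le> y" using xy mult_right_mono[of "2 * x" 1 y] by simp
    ultimately show ?thesis by (simp add: algebra_simps)
  qed
  have sfS: "uniform_moment (Suc q) = (uniform_moment q * \<phi>) * (?l / real (Suc q))" using p(1) by simp
  have e'': "?e' = ?e * (?l / real (Suc q))" using e' by simp
  have ls: "0 \<le> ?l / real (Suc q)" using D_pos by simp
  have "(1 - 2 * real (Suc q) ^ 3 / ?N) * ?e' \<le> uniform_moment (Suc q)"
  proof -
    have "(1 - 2 * real (Suc q) ^ 3 / ?N) * ?e \<le> ((1 - x) * (1 - y)) * ?e" using low e00 by (intro mult_right_mono)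
    also have "\<dots> = ((1 - x) * ?e) * (1 - y)" by simp
    also have "\<dots> \<le> uniform_moment q * \<phi>" using IH p1 xy sf0 by (intro mult_mono) (auto simp: y_def)
    finally show ?thesis unfolding sfS e'' using ls by (simp only: mult.assoc[symmetric]) (intro mult_right_mono, auto)
  qed
  moreover have "uniform_moment (Suc q) \<le> (1 + 4 * real (Suc q) ^ 3 / ?N) * ?e'"
  proof -
    have "uniform_moment q * \<phi> \<le> ((1 + 2 * x) * ?e) * (1 + y)" using IH p1 xy sf0 e00 by (intro mult_mono) (auto simp: y_def)
    also have "\<dots> = ((1 + 2 * x) * (1 + y)) * ?e" by simp
    also have "\<dots> \<le> (1 + 4 * real (Suc q) ^ 3 / ?N) * ?e" using up e00 by (intro mult_right_mono)
    finally show ?thesis unfolding sfS e'' using ls by (simp only: mult.assoc[symmetric]) (intro mult_right_mono, auto)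
  qed
  ultimately show ?case ..
qed

definition avoid where
  "avoid P = real (card {M \<in> perfect_matchings E V W. M \<inter> P = {}}) / matching_count E V W"

lemma avoid_eq: "avoid P = matching_count (E - P) V W / matching_count E V W"
proof -
  have "perfect_matchings (E - P) V W = {M \<in> perfect_matchings E V W. M \<inter> P = {}}"
    by (auto simp: perfect_matchings_def)
  then show ?thesis by (simp add: avoid_def matching_count_def)
qed

lemma avoid_bounds: "0 \<le> avoid P" "avoid P \<le> 1"
proof -
  have "card {M \<in> perfect_matchings E V W. M \<inter> P = {}} \<le> card (perfect_matchings E V W)"
    using fin_matchings by (intro card_mono) auto
  then show "0 \<le> avoid P" "avoid P \<le> 1"
    using count_pos by (auto simp: avoid_def matching_count_def)
qed

text \<open>The binomial moments of the number of edges that a random perfect matching shares with \<open>P\<close>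
(\<open>hit_moment_eq\<close>).\<close>

definition hit_moment where
  "hit_moment P q = (\<Sum>Q\<in>{Q\<in>partial_matchings E q. Q \<subseteq> P}. containing Q) / matching_count E V W"

lemma hit_moment_eq:
  assumes P: "P \<in> perfect_matchings E V W"
  shows "hit_moment P q = (\<Sum>M\<in>perfect_matchings E V W. real (card (M \<inter> P) choose q)) / matching_count E V W"
proof -
  let ?A = "{Q\<in>partial_matchings E q. Q \<subseteq> P}"
  have finA: "finite ?A" using finite_partial_matchings[OF finE] by simp
  have "(\<Sum>Q\<in>?A. containing Q) = (\<Sum>Q\<in>?A. \<Sum>M\<in>perfect_matchings E V W. of_bool (Q \<subseteq> M))"
    using fin_matchings by (simp add: containing_def of_bool_def sum.If_cases Int_def)
  also have "\<dots> = (\<Sum>M\<in>perfect_matchings E V W. \<Sum>Q\<in>?A. of_bool (Q \<subseteq> M))" by (rule sum.swap)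
  also have "\<dots> = (\<Sum>M\<in>perfect_matchings E V W. real (card (M \<inter> P) choose q))"
  proof (rule sum.cong[OF refl])
    fix M assume M: "M \<in> perfect_matchings E V W"
    have "(\<Sum>Q\<in>?A. of_bool (Q \<subseteq> M)) = real (card (?A \<inter> {Q. Q \<subseteq> M}))"
      using finA by (simp add: of_bool_def sum.If_cases)
    also have "?A \<inter> {Q. Q \<subseteq> M} = {Q\<in>{Q\<in>partial_matchings E q. Q \<subseteq> M}. Q \<subseteq> P}" by auto
    also have "\<dots> = {Q. Q \<subseteq> M \<inter> P \<and> card Q = q}"
      unfolding perfect_matching_subsets[OF M fin] by auto
    also have "card \<dots> = card (M \<inter> P) choose q"
      using perfect_matching_finite[OF M fin] by (intro n_subsets) auto
    finally show "(\<Sum>Q\<in>?A. of_bool (Q \<subseteq> M)) = real (card (M \<inter> P) choose q)" .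
  qed
  finally show ?thesis by (simp add: hit_moment_def)
qed

lemma avoid_bonferroni:
  assumes P: "P \<in> perfect_matchings E V W"
  shows "\<bar>avoid P - (\<Sum>q<K. (-1) ^ q * hit_moment P q)\<bar> \<le> hit_moment P K"
proof -
  let ?PM = "perfect_matchings E V W" and ?w = "matching_count E V W"
  have av: "avoid P = (\<Sum>M\<in>?PM. of_bool (card (M \<inter> P) = 0)) / ?w"
  proof -
    have "(\<Sum>M\<in>?PM. of_bool (card (M \<inter> P) = 0)) = (\<Sum>M\<in>?PM. (of_bool (M \<inter> P = {}) :: real))"
      using perfect_matching_finite[OF _ fin] by (intro sum.cong refl) auto
    also have "\<dots> = real (card {M \<in> ?PM. M \<inter> P = {}})"
      using fin_matchings by (simp add: of_bool_def sum.If_cases Int_def)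
    finally show ?thesis by (simp add: avoid_def)
  qed
  have "(\<Sum>q<K. (-1) ^ q * hit_moment P q) = (\<Sum>M\<in>?PM. \<Sum>q<K. (-1) ^ q * real (card (M \<inter> P) choose q)) / ?w"
    unfolding hit_moment_eq[OF P] by (subst sum.swap) (simp add: sum_distrib_left sum_divide_distrib)
  then have "avoid P - (\<Sum>q<K. (-1) ^ q * hit_moment P q) =
     (\<Sum>M\<in>?PM. of_bool (card (M \<inter> P) = 0) - (\<Sum>q<K. (-1) ^ q * real (card (M \<inter> P) choose q))) / ?w"
    unfolding av by (simp add: sum_subtractf diff_divide_distrib)
  also have "\<bar>\<dots>\<bar> \<le> (\<Sum>M\<in>?PM. real (card (M \<inter> P) choose K)) / ?w"
  proof -
    have "\<bar>\<Sum>M\<in>?PM. of_bool (card (M \<inter> P) = 0) - (\<Sum>q<K. (-1) ^ q * real (card (M \<inter> P) choose q))\<bar>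
      \<le> (\<Sum>M\<in>?PM. real (card (M \<inter> P) choose K))"
      using bonferroni_truncation by (intro order_trans[OF sum_abs] sum_mono)
    then show ?thesis using count_pos by (simp add: divide_right_mono)
  qed
  finally show ?thesis unfolding hit_moment_eq[OF P] .
qed

lemma containing_nonneg: "0 \<le> containing Q"
  by (simp add: containing_def)

lemma containing_ratio:
  assumes q: "20 * q\<^sup>2 \<le> n" "16 * q \<le> n" and Q: "Q \<in> partial_matchings E q" "Q' \<in> partial_matchings E q"
  shows "containing Q \<le> (1 + 20 * (real q)\<^sup>2 / real n) * containing Q'"
proof (cases "q = 0")
  case True
  then have "Q = Q'" using Q by (auto simp: partial_matchings_def)
  then show ?thesis using True by simp
next
  case False
  let ?y = "10 * (real q)\<^sup>2 / real n"
  have npos: "0 < real n" using n by simp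
  have q2: "20 * (real q)\<^sup>2 \<le> real n" using of_nat_mono[OF q(1), where 'a=real] by simp
  have y: "0 \<le> ?y" "?y \<le> 1" using q2 npos by (auto simp: divide_le_eq)
  have "(1 + 5 * real q / real n) ^ (2 * q) \<le> exp (5 * real q / real n) ^ (2 * q)"
    by (intro power_mono) auto
  also have "\<dots> = exp ?y" by (simp add: exp_of_nat_mult[symmetric] power2_eq_square)
  also have "\<dots> \<le> 1 + ?y + ?y\<^sup>2" using y by (intro exp_bound)
  also have "?y\<^sup>2 \<le> ?y" using y mult_left_mono[of ?y 1 ?y] by (simp add: power2_eq_square)
  finally have e: "(1 + 5 * real q / real n) ^ (2 * q) \<le> 1 + 20 * (real q)\<^sup>2 / real n" by simp
  have "containing Q \<le> (1 + 5 * real q / real n) ^ (2 * q) * containing Q'"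
    unfolding containing_def card_matchings_containing[OF Q(1) EVW] card_matchings_containing[OF Q(2) EVW]
    unfolding n_def using False z n n_def q Q by (intro matchings_containing_ratio[OF r, of z]) auto
  also have "\<dots> \<le> (1 + 20 * (real q)\<^sup>2 / real n) * containing Q'"
    using e containing_nonneg by (intro mult_right_mono)
  finally show ?thesis .
qed

text \<open>All probabilities to contain a partial matching of size \<open>q\<close> are close to each other and hence to their
average \<open>A\<close>.\<close>

lemma containing_near_average:
  assumes q: "20 * q\<^sup>2 \<le> n" "16 * q \<le> n" and Q: "Q \<in> partial_matchings E q"
  defines "A \<equiv> real (n choose q) * matching_count E V W / real (card (partial_matchings E q))"
  defines "\<eta> \<equiv> 20 * (real q)\<^sup>2 / real n"
  shows "containing Q \<le> (1 + \<eta>) * A" "(1 - \<eta>) * A \<le> containing Q" "\<eta> \<le> 1" "0 \<le> A"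
proof -
  let ?P = "partial_matchings E q"
  have qn: "q \<le> n" using q by linarith
  note a = card_partial_pos[OF qn]
  have npos: "0 < real n" using n by simp
  have q2: "20 * (real q)\<^sup>2 \<le> real n" using of_nat_mono[OF q(1), where 'a=real] by simp
  show eta: "\<eta> \<le> 1" using q2 npos by (simp add: \<eta>_def divide_le_eq)
  have eta0: "0 \<le> \<eta>" by (simp add: \<eta>_def)
  have sum: "(\<Sum>Q\<in>?P. containing Q) = real (card ?P) * A"
    using a by (simp add: A_def sum_containing)
  show A0: "0 \<le> A" by (simp add: A_def)
  have "real (card ?P) * containing Q \<le> (\<Sum>Q'\<in>?P. (1 + \<eta>) * containing Q')"
    using containing_ratio[OF q Q] by (subst sum_constant[symmetric], intro sum_mono) (auto simp: \<eta>_def)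
  also have "\<dots> = real (card ?P) * ((1 + \<eta>) * A)" by (simp add: sum_distrib_left[symmetric] sum)
  finally show "containing Q \<le> (1 + \<eta>) * A" using a by simp
  have "(\<Sum>Q'\<in>?P. containing Q') \<le> (\<Sum>Q'\<in>?P. (1 + \<eta>) * containing Q)"
    using containing_ratio[OF q _ Q] by (intro sum_mono) (auto simp: \<eta>_def)
  then have "real (card ?P) * A \<le> real (card ?P) * ((1 + \<eta>) * containing Q)" by (simp add: sum)
  then have "A \<le> (1 + \<eta>) * containing Q" using a by simp
  then have "(1 - \<eta>) * A \<le> (1 - \<eta>) * ((1 + \<eta>) * containing Q)" using eta by (intro mult_left_mono) auto
  also have "\<dots> = (1 - \<eta>\<^sup>2) * containing Q" by (simp add: power2_eq_square algebra_simps)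
  also have "\<dots> \<le> 1 * containing Q" using containing_nonneg by (intro mult_right_mono) auto
  finally show "(1 - \<eta>) * A \<le> containing Q" by simp
qed

lemma power_comparisons:
  assumes "20 * q\<^sup>2 \<le> n"
  shows "real q ^ 2 \<le> real q ^ 4" "real q ^ 3 \<le> real q ^ 4" "real q ^ 3 \<le> (real n)\<^sup>2" "real q \<le> real n"
proof -
  have "q ^ 2 \<le> q ^ 4" "q ^ 3 \<le> q ^ 4" by (cases "q = 0"; simp add: power_increasing)+
  then show a: "real q ^ 2 \<le> real q ^ 4" "real q ^ 3 \<le> real q ^ 4" by (metis of_nat_le_iff of_nat_power)+
  have "20 * (real q)\<^sup>2 \<le> real n" using of_nat_mono[OF assms, where 'a=real] by simp
  then have q2: "(real q)\<^sup>2 \<le> real n" using zero_le_power2[of "real q"] by linarith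
  have "real q ^ 4 = ((real q)\<^sup>2)\<^sup>2" by simp
  also have "\<dots> \<le> (real n)\<^sup>2" using q2 by (intro power_mono) auto
  finally show "real q ^ 3 \<le> (real n)\<^sup>2" using a by linarith
  have "real q \<le> (real q)\<^sup>2" by (cases "q = 0") (auto simp: power2_eq_square)
  then show "real q \<le> real n" using q2 by linarith
qed

text \<open>A fixed \<open>P\<close> has \<open>n choose q\<close> subsets of size \<open>q\<close>, each of nearly average probability. The relative error
\<open>O(q\<^sup>2 / n)\<close> of a single probability enters in full.\<close>

lemma hit_moment_estimate:
  assumes P: "P \<in> perfect_matchings E V W" and q: "20 * q\<^sup>2 \<le> n" "16 * q \<le> n"
  shows "\<bar>hit_moment P q - (real n / real D) ^ q / fact q\<bar> \<le> 104 / real n * real q ^ 4 * ((real n / real D) ^ q / fact q)"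
proof -
  let ?w = "matching_count E V W" and ?a = "real (card (partial_matchings E q))" and ?C = "real (n choose q)"
  let ?A = "?C * ?w / ?a" and ?\<eta> = "20 * (real q)\<^sup>2 / real n" and ?N = "(real n)\<^sup>2"
  let ?e = "(real n / real D) ^ q / fact q" and ?X = "{Q\<in>partial_matchings E q. Q \<subseteq> P}"
  have npos: "0 < real n" using n by simp
  have e0: "0 \<le> ?e" by simp
  have cX: "real (card ?X) = ?C"
    unfolding perfect_matching_subsets[OF P fin]
    using n_subsets[of P q] perfect_matching_finite[OF P fin] perfect_matching_card[OF P] n_def by simp
  have sf: "?C * ?A / ?w = uniform_moment q" using count_pos by (simp add: uniform_moment_def power2_eq_square)
  have q': "q\<^sup>2 \<le> n" using q by simp
  note est = uniform_moment_estimate[OF q' q(2)] and pc = power_comparisons[OF q(1)]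
  have sf0: "0 \<le> uniform_moment q" by (simp add: uniform_moment_def)
  have eta0: "0 \<le> ?\<eta>" by simp
  have "(\<Sum>Q\<in>?X. containing Q) \<le> (\<Sum>Q\<in>?X. (1 + ?\<eta>) * ?A)"
    using containing_near_average(1)[OF q] by (intro sum_mono) auto
  then have "hit_moment P q \<le> real (card ?X) * ((1 + ?\<eta>) * ?A) / ?w"
    unfolding hit_moment_def using count_pos by (intro divide_right_mono) auto
  also have "\<dots> = (1 + ?\<eta>) * uniform_moment q" unfolding cX sf[symmetric] by simp
  also have "\<dots> \<le> (1 + ?\<eta>) * ((1 + 4 * real q ^ 3 / ?N) * ?e)" using est eta0 by (intro mult_left_mono) auto
  also have "\<dots> = ((1 + ?\<eta>) * (1 + 4 * real q ^ 3 / ?N)) * ?e" by simp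
  also have "\<dots> \<le> (1 + 104 / real n * real q ^ 4) * ?e"
  proof (rule mult_right_mono[OF _ e0])
    have n1: "1 \<le> real n" using n by simp
    have a: "?\<eta> \<le> 20 * (real q ^ 4 / real n)" using pc npos by (simp add: divide_right_mono)
    have b: "4 * real q ^ 3 / ?N \<le> 4 * (real q ^ 4 / real n)"
    proof -
      have "real q ^ 3 / ?N \<le> real q ^ 4 / real n"
        using pc n1 npos by (intro frac_le) (auto simp: power2_eq_square)
      then show ?thesis by simp
    qed
    have "4 * real q ^ 3 / ?N \<le> 4" using pc npos by (simp add: divide_le_eq)
    then have c: "?\<eta> * (4 * real q ^ 3 / ?N) \<le> 20 * (real q ^ 4 / real n) * 4"
      using a eta0 by (intro mult_mono) auto
    have "(1 + u) * (1 + v) = 1 + u + v + u * v" for u v :: real by (simp add: algebra_simps)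
    then have "(1 + ?\<eta>) * (1 + 4 * real q ^ 3 / ?N) = 1 + ?\<eta> + 4 * real q ^ 3 / ?N + ?\<eta> * (4 * real q ^ 3 / ?N)" .
    also have "\<dots> \<le> 1 + 20 * (real q ^ 4 / real n) + 4 * (real q ^ 4 / real n) + 20 * (real q ^ 4 / real n) * 4"
      using a b c by linarith
    finally show "(1 + ?\<eta>) * (1 + 4 * real q ^ 3 / ?N) \<le> 1 + 104 / real n * real q ^ 4" by simp
  qed
  finally have up: "hit_moment P q \<le> (1 + 104 / real n * real q ^ 4) * ?e" .
  have "(\<Sum>Q\<in>?X. (1 - ?\<eta>) * ?A) \<le> (\<Sum>Q\<in>?X. containing Q)"
    using containing_near_average(2)[OF q] by (intro sum_mono) auto
  then have "real (card ?X) * ((1 - ?\<eta>) * ?A) / ?w \<le> hit_moment P q"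
    unfolding hit_moment_def using count_pos by (intro divide_right_mono) auto
  moreover have "real (card ?X) * ((1 - ?\<eta>) * ?A) / ?w = (1 - ?\<eta>) * uniform_moment q" unfolding cX sf[symmetric] by simp
  moreover have "(1 - ?\<eta>) * ((1 - 2 * real q ^ 3 / ?N) * ?e) \<le> (1 - ?\<eta>) * uniform_moment q"
  proof -
    have "20 * (real q)\<^sup>2 \<le> real n" using of_nat_mono[OF q(1), where 'a=real] by simp
    then have "?\<eta> \<le> 1" using npos by (simp add: divide_le_eq)
    then show ?thesis using est by (intro mult_left_mono) auto
  qed
  moreover have "(1 - 104 / real n * real q ^ 4) * ?e \<le> ((1 - ?\<eta>) * (1 - 2 * real q ^ 3 / ?N)) * ?e"
  proof (rule mult_right_mono[OF _ e0])
    have n1: "1 \<le> real n" using n by simp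
    have a: "?\<eta> \<le> 20 * (real q ^ 4 / real n)" using pc npos by (simp add: divide_right_mono)
    have b: "2 * real q ^ 3 / ?N \<le> 2 * (real q ^ 4 / real n)"
    proof -
      have "real q ^ 3 / ?N \<le> real q ^ 4 / real n"
        using pc n1 npos by (intro frac_le) (auto simp: power2_eq_square)
      then show ?thesis by simp
    qed
    have c: "0 \<le> ?\<eta> * (2 * real q ^ 3 / ?N)" by simp
    have d: "0 \<le> real q ^ 4 / real n" by simp
    have "(1 - u) * (1 - v) = 1 - u - v + u * v" for u v :: real by (simp add: algebra_simps)
    then have "(1 - ?\<eta>) * (1 - 2 * real q ^ 3 / ?N) = 1 - ?\<eta> - 2 * real q ^ 3 / ?N + ?\<eta> * (2 * real q ^ 3 / ?N)" .
    moreover have "104 / real n * real q ^ 4 = 104 * (real q ^ 4 / real n)" by simp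
    ultimately show "1 - 104 / real n * real q ^ 4 \<le> (1 - ?\<eta>) * (1 - 2 * real q ^ 3 / ?N)"
      using a b c d by linarith
  qed
  ultimately have low: "(1 - 104 / real n * real q ^ 4) * ?e \<le> hit_moment P q" by (simp only: mult.assoc)
  show ?thesis using up low unfolding left_diff_distrib distrib_right by (simp only: mult_1 abs_le_iff) linarith
qed

text \<open>For two independent random perfect matchings, the probability that both contain \<open>Q\<close> is the square of the
probability for one.\<close>

lemma mean_hit_moment:
  "(\<Sum>P\<in>perfect_matchings E V W. hit_moment P q) / matching_count E V W =
    (\<Sum>Q\<in>partial_matchings E q. (containing Q)\<^sup>2) / (matching_count E V W)\<^sup>2"
proof -
  have "(\<Sum>P\<in>perfect_matchings E V W. \<Sum>Q\<in>{Q\<in>partial_matchings E q. Q \<subseteq> P}. containing Q) =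
    (\<Sum>P\<in>perfect_matchings E V W. \<Sum>Q\<in>partial_matchings E q. of_bool (Q \<subseteq> P) * containing Q)"
  proof (rule sum.cong[OF refl])
    fix P
    show "(\<Sum>Q\<in>{Q\<in>partial_matchings E q. Q \<subseteq> P}. containing Q) = (\<Sum>Q\<in>partial_matchings E q. of_bool (Q \<subseteq> P) * containing Q)"
      using finite_partial_matchings[OF finE]
      by (simp add: of_bool_def if_distrib[of "\<lambda>c. c * _"] sum.inter_filter cong: if_cong)
  qed
  also have "\<dots> = (\<Sum>Q\<in>partial_matchings E q. \<Sum>P\<in>perfect_matchings E V W. of_bool (Q \<subseteq> P) * containing Q)" by (rule sum.swap)
  also have "\<dots> = (\<Sum>Q\<in>partial_matchings E q. (containing Q)\<^sup>2)"
  proof (rule sum.cong[OF refl])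
    fix Q
    have "(\<Sum>P\<in>perfect_matchings E V W. of_bool (Q \<subseteq> P)) = containing Q"
      using fin_matchings by (simp add: containing_def of_bool_def sum.If_cases Int_def)
    then show "(\<Sum>P\<in>perfect_matchings E V W. of_bool (Q \<subseteq> P) * containing Q) = (containing Q)\<^sup>2"
      by (simp only: sum_distrib_right[symmetric] power2_eq_square)
  qed
  finally show ?thesis by (simp add: hit_moment_def sum_divide_distrib[symmetric] power2_eq_square)
qed

text \<open>A sum of squares is the square of the average times the number of summands plus the sum of the
squared deviations. The spread \<open>O(q\<^sup>2 / n)\<close> of the probabilities is thereby squared, which improves
\<open>hit_moment_estimate\<close> by the factor \<open>n\<close>.\<close>

lemma mean_hit_moment_estimate:
  assumes q: "20 * q\<^sup>2 \<le> n" "16 * q \<le> n"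
  shows "\<bar>(\<Sum>P\<in>perfect_matchings E V W. hit_moment P q) / matching_count E V W - (real n / real D) ^ q / fact q\<bar>
    \<le> 2004 / (real n)\<^sup>2 * real q ^ 4 * ((real n / real D) ^ q / fact q)"
proof -
  let ?w = "matching_count E V W" and ?a = "real (card (partial_matchings E q))" and ?C = "real (n choose q)"
  let ?A = "?C * ?w / ?a" and ?\<eta> = "20 * (real q)\<^sup>2 / real n" and ?N = "(real n)\<^sup>2"
  let ?e = "(real n / real D) ^ q / fact q" and ?X = "partial_matchings E q"
  let ?m = "(\<Sum>P\<in>perfect_matchings E V W. hit_moment P q) / matching_count E V W"
  have npos: "0 < real n" using n by simp
  have e0: "0 \<le> ?e" by simp
  have qn: "q \<le> n" using q by linarith
  note a = card_partial_pos[OF qn]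
  have q': "q\<^sup>2 \<le> n" using q by simp
  note est = uniform_moment_estimate[OF q' q(2)] and pc = power_comparisons[OF q(1)]
  have sf0: "0 \<le> uniform_moment q" by (simp add: uniform_moment_def)
  have sumA: "(\<Sum>Q\<in>?X. containing Q) = ?a * ?A" using a by (simp add: sum_containing)
  have "(\<Sum>Q\<in>?X. (containing Q)\<^sup>2) = (\<Sum>Q\<in>?X. (containing Q - ?A)\<^sup>2 + 2 * ?A * containing Q - ?A\<^sup>2)"
    by (intro sum.cong refl) (simp add: power2_eq_square algebra_simps)
  also have "\<dots> = (\<Sum>Q\<in>?X. (containing Q - ?A)\<^sup>2) + 2 * ?A * (\<Sum>Q\<in>?X. containing Q) - ?a * ?A\<^sup>2"
    by (simp only: sum.distrib sum_subtractf sum_constant sum_distrib_left)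
  also have "\<dots> = (\<Sum>Q\<in>?X. (containing Q - ?A)\<^sup>2) + ?a * ?A\<^sup>2"
    unfolding sumA by (simp add: power2_eq_square)
  finally have sq: "(\<Sum>Q\<in>?X. (containing Q)\<^sup>2) = (\<Sum>Q\<in>?X. (containing Q - ?A)\<^sup>2) + ?a * ?A\<^sup>2" .
  have sf: "?a * ?A\<^sup>2 / ?w\<^sup>2 = uniform_moment q"
    using count_pos a by (simp add: uniform_moment_def power2_eq_square)
  have "(\<Sum>Q\<in>?X. (containing Q - ?A)\<^sup>2) \<le> (\<Sum>Q\<in>?X. (?\<eta> * ?A)\<^sup>2)"
  proof (rule sum_mono)
    fix Q assume Q: "Q \<in> ?X"
    have "\<bar>containing Q - ?A\<bar> \<le> ?\<eta> * ?A"
      using containing_near_average(1,2)[OF q Q] unfolding distrib_right left_diff_distrib mult_1 abs_le_iff by linarith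
    then show "(containing Q - ?A)\<^sup>2 \<le> (?\<eta> * ?A)\<^sup>2" by (metis abs_ge_zero power2_abs power_mono)
  qed
  also have "\<dots> = ?\<eta>\<^sup>2 * (?a * ?A\<^sup>2)" by (simp only: sum_constant power_mult_distrib) simp
  finally have "(\<Sum>Q\<in>?X. (containing Q)\<^sup>2) \<le> (1 + ?\<eta>\<^sup>2) * (?a * ?A\<^sup>2)" unfolding sq by (simp add: distrib_right)
  then have "?m \<le> (1 + ?\<eta>\<^sup>2) * (?a * ?A\<^sup>2) / ?w\<^sup>2" unfolding mean_hit_moment by (intro divide_right_mono) auto
  also have "\<dots> = (1 + ?\<eta>\<^sup>2) * uniform_moment q" unfolding sf[symmetric] by simp
  also have "\<dots> \<le> (1 + ?\<eta>\<^sup>2) * ((1 + 4 * real q ^ 3 / ?N) * ?e)" using est by (intro mult_left_mono) auto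
  also have "\<dots> = ((1 + ?\<eta>\<^sup>2) * (1 + 4 * real q ^ 3 / ?N)) * ?e" by simp
  also have "\<dots> \<le> (1 + 2004 / ?N * real q ^ 4) * ?e"
  proof (rule mult_right_mono[OF _ e0])
    have a: "?\<eta>\<^sup>2 = 400 * (real q ^ 4 / ?N)" by (simp add: power_divide power_mult_distrib)
    have b: "4 * real q ^ 3 / ?N \<le> 4 * (real q ^ 4 / ?N)" using pc by (simp add: divide_right_mono)
    have "4 * real q ^ 3 / ?N \<le> 4" using pc npos by (simp add: divide_le_eq)
    then have c: "?\<eta>\<^sup>2 * (4 * real q ^ 3 / ?N) \<le> 400 * (real q ^ 4 / ?N) * 4"
      unfolding a by (intro mult_left_mono) auto
    have "(1 + u) * (1 + v) = 1 + u + v + u * v" for u v :: real by (simp add: algebra_simps)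
    then have "(1 + ?\<eta>\<^sup>2) * (1 + 4 * real q ^ 3 / ?N) = 1 + ?\<eta>\<^sup>2 + 4 * real q ^ 3 / ?N + ?\<eta>\<^sup>2 * (4 * real q ^ 3 / ?N)" .
    also have "\<dots> \<le> 1 + 400 * (real q ^ 4 / ?N) + 4 * (real q ^ 4 / ?N) + 400 * (real q ^ 4 / ?N) * 4"
      using a b c by linarith
    finally show "(1 + ?\<eta>\<^sup>2) * (1 + 4 * real q ^ 3 / ?N) \<le> 1 + 2004 / ?N * real q ^ 4" by simp
  qed
  finally have up: "?m \<le> (1 + 2004 / ?N * real q ^ 4) * ?e" .
  have "?a * ?A\<^sup>2 \<le> (\<Sum>Q\<in>?X. (containing Q)\<^sup>2)" unfolding sq by (simp add: sum_nonneg)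
  then have "uniform_moment q \<le> ?m" unfolding mean_hit_moment sf[symmetric] by (intro divide_right_mono) auto
  moreover have "(1 - 2004 / ?N * real q ^ 4) * ?e \<le> (1 - 2 * real q ^ 3 / ?N) * ?e"
  proof (rule mult_right_mono[OF _ e0])
    have "real q ^ 3 / ?N \<le> real q ^ 4 / ?N" using pc by (simp add: divide_right_mono)
    moreover have "0 \<le> real q ^ 4 / ?N" by simp
    moreover have "2004 / ?N * real q ^ 4 = 2004 * (real q ^ 4 / ?N)" "2 * real q ^ 3 / ?N = 2 * (real q ^ 3 / ?N)" by simp_all
    ultimately show "1 - 2004 / ?N * real q ^ 4 \<le> 1 - 2 * real q ^ 3 / ?N" by linarith
  qed
  ultimately have low: "(1 - 2004 / ?N * real q ^ 4) * ?e \<le> ?m" using est by linarith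
  show ?thesis using up low unfolding left_diff_distrib distrib_right by (simp only: mult_1 abs_le_iff) linarith
qed

lemma ratio_le_two: "0 \<le> real n / real D" "real n / real D \<le> 2"
  using D_lower D_pos by (auto simp: divide_le_eq)

lemma avoid_estimate:
  assumes P: "P \<in> perfect_matchings E V W" and K: "20 * K\<^sup>2 \<le> n" "16 * K \<le> n"
  shows "\<bar>avoid P - exp (- (real n / real D))\<bar> \<le> 81 * exp 6 * (104 / real n) + (1 + exp 2) * (2 ^ K / fact K)"
proof (rule bonferroni_exp[OF ratio_le_two _ _ avoid_bonferroni[OF P]])
  fix q assume "q \<le> K"
  then have "q\<^sup>2 \<le> K\<^sup>2" by simp
  then have "20 * q\<^sup>2 \<le> n" "16 * q \<le> n" using K \<open>q \<le> K\<close> by linarith+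
  then show "\<bar>hit_moment P q - (real n / real D) ^ q / fact q\<bar> \<le> 104 / real n * real q ^ 4 * ((real n / real D) ^ q / fact q)"
    by (rule hit_moment_estimate[OF P])
qed simp

lemma mean_avoid_estimate:
  assumes K: "20 * K\<^sup>2 \<le> n" "16 * K \<le> n"
  shows "\<bar>matching_mean E V W avoid - exp (- (real n / real D))\<bar> \<le> 81 * exp 6 * (2004 / (real n)\<^sup>2) + (1 + exp 2) * (2 ^ K / fact K)"
proof -
  let ?PM = "perfect_matchings E V W" and ?w = "matching_count E V W"
  let ?c = "\<lambda>q. (\<Sum>P\<in>?PM. hit_moment P q) / ?w"
  have b: "\<bar>matching_mean E V W avoid - (\<Sum>q<K. (-1) ^ q * ?c q)\<bar> \<le> ?c K"
  proof -
    have "(\<Sum>q<K. (-1) ^ q * ?c q) = (\<Sum>P\<in>?PM. \<Sum>q<K. (-1) ^ q * hit_moment P q) / ?w"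
      by (subst sum.swap) (simp add: sum_distrib_left sum_divide_distrib)
    then have "matching_mean E V W avoid - (\<Sum>q<K. (-1) ^ q * ?c q) = (\<Sum>P\<in>?PM. avoid P - (\<Sum>q<K. (-1) ^ q * hit_moment P q)) / ?w"
      by (simp add: matching_mean_def sum_subtractf diff_divide_distrib)
    also have "\<bar>\<dots>\<bar> \<le> ?c K"
    proof -
      have "\<bar>\<Sum>P\<in>?PM. avoid P - (\<Sum>q<K. (-1) ^ q * hit_moment P q)\<bar> \<le> (\<Sum>P\<in>?PM. hit_moment P K)"
        using avoid_bonferroni by (intro order_trans[OF sum_abs] sum_mono)
      then show ?thesis using count_pos by (simp add: divide_right_mono)
    qed
    finally show ?thesis .
  qed
  show ?thesis
  proof (rule bonferroni_exp[OF ratio_le_two _ _ b])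
    fix q assume "q \<le> K"
    then have "q\<^sup>2 \<le> K\<^sup>2" by simp
    then have "20 * q\<^sup>2 \<le> n" "16 * q \<le> n" using K \<open>q \<le> K\<close> by linarith+
    then show "\<bar>?c q - (real n / real D) ^ q / fact q\<bar> \<le> 2004 / (real n)\<^sup>2 * real q ^ 4 * ((real n / real D) ^ q / fact q)"
      by (rule mean_hit_moment_estimate)
  qed simp
qed
end

section \<open>Mean and variance of the chance to avoid a random matching\<close>

text \<open>The constant 11 exceeds \<open>4\<^sup>4 / 4!\<close>, the largest value of the quotient.\<close>

lemma four_power_le_fact: "(4::real) ^ k \<le> 11 * fact k"
proof (cases "k \<le> 4")
  case True
  then have "k = 0 \<or> k = 1 \<or> k = 2 \<or> k = 3 \<or> k = 4" by auto
  then show ?thesis by (auto simp: fact_numeral)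
next
  case False
  then have "4 \<le> k" by simp
  then show ?thesis
  proof (induction k rule: dec_induct)
    case (step k)
    have "(4::real) ^ Suc k \<le> 4 * (11 * fact k)" using step by simp
    also have "\<dots> \<le> real (Suc k) * (11 * fact k)" using step by (intro mult_right_mono) auto
    finally show ?case by simp
  qed (simp add: fact_numeral)
qed

lemma regular_remove_matching:
  assumes r: "regular_between E D V W" and P: "P \<in> perfect_matchings E V W"
  shows "regular_between (E - P) (D - 1) V W"
proof -
  have fin: "finite V" "finite W" using r by (auto simp: regular_between_def)
  have "card {j\<in>W. (x, j) \<in> E - P} = D - 1" if x: "x \<in> V" for x
  proof -
    obtain j0 where j0: "(x, j0) \<in> P" using perfect_matching_partner(1)[OF P x] by auto
    have "(x, j) \<in> P \<longleftrightarrow> j = j0" for j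
      using j0 perfect_matching_unique(1)[OF P j0] by blast
    then have "{j\<in>W. (x, j) \<in> E - P} = {j\<in>W. (x, j) \<in> E} - {j0}" by auto
    moreover have "j0 \<in> {j\<in>W. (x, j) \<in> E}" using perfect_matching_edgeD[OF P j0] by auto
    ultimately show ?thesis using r x fin by (simp add: regular_between_def)
  qed
  moreover have "card {x\<in>V. (x, j) \<in> E - P} = D - 1" if j: "j \<in> W" for j
  proof -
    obtain x0 where x0: "(x0, j) \<in> P" using perfect_matching_partner(2)[OF P j] by auto
    have "(x, j) \<in> P \<longleftrightarrow> x = x0" for x
      using x0 perfect_matching_unique(2)[OF P x0] by blast
    then have "{x\<in>V. (x, j) \<in> E - P} = {x\<in>V. (x, j) \<in> E} - {x0}" by auto
    moreover have "x0 \<in> {x\<in>V. (x, j) \<in> E}" using perfect_matching_edgeD[OF P x0] by auto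
    ultimately show ?thesis using r j fin by (simp add: regular_between_def)
  qed
  ultimately show ?thesis using r by (auto simp: regular_between_def)
qed

context dense_regular_graph begin

text \<open>Exchanging two edges of \<open>P\<close> exchanges two edges of the graph without \<open>P\<close>, which is regular of degree
\<open>D - 1\<close>.\<close>

lemma avoid_switch:
  assumes P: "P \<in> perfect_matchings E V W" and e: "(x, a) \<in> P" "(y, b) \<in> P" "x \<noteq> y" "(x, b) \<in> E" "(y, a) \<in> E"
  shows "\<bar>avoid (insert (x, b) (insert (y, a) (P - {(x, a), (y, b)}))) - avoid P\<bar> \<le> 1920 * (real z + 1)\<^sup>2 / real n ^ 4"
proof -
  let ?P' = "insert (x, b) (insert (y, a) (P - {(x, a), (y, b)}))"
  let ?F = "E - P"
  have ab: "a \<noteq> b" using perfect_matching_unique(2)[OF P e(1), of y] e by blast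
  have nP: "(x, b) \<notin> P" "(y, a) \<notin> P" using perfect_matching_unique(1)[OF P e(1), of b] perfect_matching_unique(1)[OF P e(2), of a] ab by blast+
  have in1: "x \<in> V" "y \<in> V" "a \<in> W" "b \<in> W" using perfect_matching_edgeD[OF P] e by auto
  have eq: "E - ?P' = ?F - {(x, b), (y, a)} \<union> {(x, a), (y, b)}"
    using e ab nP perfect_matching_edgeD(1)[OF P] by auto
  have "\<bar>matching_count (?F - {(x, b), (y, a)} \<union> {(x, a), (y, b)}) V W - matching_count ?F V W\<bar>
    \<le> 1920 * real (z + 1) ^ 2 / real (card V) ^ 4 * matching_count ?F V W"
    using e ab nP in1 z n n_def D_pos
    by (intro switch_bound[OF regular_remove_matching[OF r P]]) auto
  then have *: "\<bar>matching_count (E - ?P') V W - matching_count ?F V W\<bar> \<le> 1920 * (real z + 1)\<^sup>2 / real n ^ 4 * matching_count ?F V W"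
    unfolding eq by (simp add: n_def add.commute)
  have "\<bar>avoid ?P' - avoid P\<bar> = \<bar>matching_count (E - ?P') V W - matching_count ?F V W\<bar> / matching_count E V W"
    unfolding avoid_eq using count_pos by (simp flip: diff_divide_distrib)
  also have "\<dots> \<le> 1920 * (real z + 1)\<^sup>2 / real n ^ 4 * matching_count ?F V W / matching_count E V W"
    using * count_pos by (intro divide_right_mono) auto
  also have "\<dots> = 1920 * (real z + 1)\<^sup>2 / real n ^ 4 * avoid P" by (simp add: avoid_eq)
  also have "\<dots> \<le> 1920 * (real z + 1)\<^sup>2 / real n ^ 4 * 1" using avoid_bounds by (intro mult_left_mono) auto
  finally show ?thesis by simp
qed

text \<open>The bound \<open>n L\<^sup>2\<close> with \<open>L = O((z + 1)\<^sup>2 / n\<^sup>4)\<close> is \<open>O((z + 1)\<^sup>4 / n\<^sup>7)\<close>; three of the four factors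
\<open>z + 1\<close> are estimated by \<open>n\<close>. The conditions on \<open>k\<close> make the other terms of \<open>matching_variance_bound\<close>
no larger.\<close>

lemma avoid_sse:
  assumes k: "1 \<le> k" "n ^ 4 \<le> 2 ^ k" "(40 * k + 20)\<^sup>2 \<le> n" "2 * (40 * k + 20) \<le> n"
  shows "matching_sse E V W avoid \<le> matching_count E V W * (236 * 1920\<^sup>2 * (real z + 1) / real n ^ 4)"
proof -
  let ?L = "1920 * (real z + 1)\<^sup>2 / real n ^ 4" and ?K = "40 * k + 20"
  have npos: "0 < real n" using n by simp
  have half: "(1/2) ^ k \<le> ?L"
  proof -
    have "real n ^ 4 \<le> 2 ^ k" using of_nat_mono[OF k(2), where 'a=real] by simp
    then have "1 / 2 ^ k \<le> 1 / real n ^ 4" using npos by (intro divide_left_mono) auto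
    also have "\<dots> \<le> ?L"
    proof (intro divide_right_mono)
      have "1 \<le> (real z + 1)\<^sup>2" by (simp add: power2_eq_square algebra_simps)
      then show "1 \<le> 1920 * (real z + 1)\<^sup>2" by linarith
    qed simp
    finally show ?thesis by (simp add: power_one_over)
  qed
  have "matching_sse E V W avoid \<le> matching_count E V W *
    (225 * ?L\<^sup>2 * real (card V) + 9 * ?L\<^sup>2 * (real ?K)\<^sup>2 + 2 * real (card V) / 4 ^ k)"
    using k z n_def cVW half avoid_bounds
    by (intro matching_variance_bound[OF dens _ _ avoid_switch]) auto
  also have "\<dots> \<le> matching_count E V W * (236 * ?L\<^sup>2 * real n)"
  proof (intro mult_left_mono)
    have "(real ?K)\<^sup>2 \<le> real n" using of_nat_mono[OF k(3), where 'a=real] by simp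
    then have "9 * ?L\<^sup>2 * (real ?K)\<^sup>2 \<le> 9 * ?L\<^sup>2 * real n" by (intro mult_left_mono) auto
    moreover have "2 * real n / 4 ^ k \<le> 2 * (?L\<^sup>2 * real n)"
    proof -
      have "((1/2::real) ^ k)\<^sup>2 = 1 / 4 ^ k"
        by (simp add: power2_eq_square power_one_over[symmetric] flip: power_mult_distrib)
      moreover have "((1/2) ^ k)\<^sup>2 \<le> ?L\<^sup>2" using half by (intro power_mono) auto
      ultimately have "1 / 4 ^ k \<le> ?L\<^sup>2" by simp
      then have "1 / 4 ^ k * (2 * real n) \<le> ?L\<^sup>2 * (2 * real n)" by (intro mult_right_mono) auto
      then show ?thesis by simp
    qed
    ultimately show "225 * ?L\<^sup>2 * real (card V) + 9 * ?L\<^sup>2 * (real ?K)\<^sup>2 + 2 * real (card V) / 4 ^ k \<le> 236 * ?L\<^sup>2 * real n"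
      unfolding n_def[symmetric] by linarith
  qed simp
  also have "\<dots> \<le> matching_count E V W * (236 * 1920\<^sup>2 * (real z + 1) / real n ^ 4)"
  proof (intro mult_left_mono)
    have zn: "real z + 1 \<le> real n" using z n by linarith
    have "?L\<^sup>2 * real n = 1920\<^sup>2 * ((real z + 1) ^ 4 * real n / real n ^ 8)"
      by (simp add: power_divide power_mult_distrib flip: power_mult)
    also have "(real z + 1) ^ 4 * real n / real n ^ 8 = ((real z + 1) / real n) ^ 3 * ((real z + 1) / real n ^ 4)"
    proof -
      have e8: "real n ^ 8 = real n * (real n ^ 3 * real n ^ 4)" by (simp flip: power_add power_Suc)
      have e4: "(real z + 1) ^ 4 = (real z + 1) ^ 3 * (real z + 1)" by (simp add: power4_eq_xxxx power3_eq_cube)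
      show ?thesis unfolding e8 e4 using npos by (simp add: power_divide)
    qed
    also have "\<dots> \<le> 1 * ((real z + 1) / real n ^ 4)"
      using zn npos by (intro mult_right_mono power_le_one) (auto simp: divide_le_eq)
    finally have "?L\<^sup>2 * real n \<le> 1920\<^sup>2 * (1 * ((real z + 1) / real n ^ 4))" by simp
    then have "236 * (?L\<^sup>2 * real n) \<le> 236 * (1920\<^sup>2 * (1 * ((real z + 1) / real n ^ 4)))"
      by (rule mult_left_mono) simp
    also have "\<dots> = 236 * 1920\<^sup>2 * (real z + 1) / real n ^ 4" by simp
    finally show "236 * ?L\<^sup>2 * real n \<le> 236 * 1920\<^sup>2 * (real z + 1) / real n ^ 4" by (simp only: mult.assoc)
  qed simp
  finally show ?thesis .
qed

lemma truncation_tail: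
  assumes k: "n ^ 4 \<le> 2 ^ k"
  shows "2 ^ k / fact k \<le> 11 / (real n)\<^sup>2"
proof -
  have npos: "1 \<le> real n" using n by simp
  have "real n ^ 4 \<le> 2 ^ k" using of_nat_mono[OF k, where 'a=real] by simp
  then have "(real n)\<^sup>2 \<le> 2 ^ k" using power_increasing[of 2 4 "real n"] npos by linarith
  then have "2 ^ k * (real n)\<^sup>2 \<le> 2 ^ k * 2 ^ k" by (intro mult_left_mono) auto
  also have "\<dots> = 4 ^ k" by (simp flip: power_mult_distrib)
  also have "\<dots> \<le> 11 * fact k" by (rule four_power_le_fact)
  finally show ?thesis using npos by (simp add: field_simps)
qed

text \<open>The truncation length is the number \<open>k\<close> used for the variance; \<open>n\<^sup>4 \<le> 2\<^sup>k\<close> makes the truncation error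
\<open>O(n\<^sup>-\<^sup>2)\<close>.\<close>

lemma avoid_summary:
  assumes k: "1 \<le> k" "n ^ 4 \<le> 2 ^ k" "(40 * k + 20)\<^sup>2 \<le> n" "2 * (40 * k + 20) \<le> n"
  defines "A \<equiv> 81 * exp 6 * 2004 + (1 + exp 2) * 11"
  shows "\<bar>matching_mean E V W avoid - exp (- (real n / real D))\<bar> \<le> A / (real n)\<^sup>2"
    and "P \<in> perfect_matchings E V W \<Longrightarrow> \<bar>avoid P - exp (- (real n / real D))\<bar> \<le> A / real n"
proof -
  have kk: "20 * k\<^sup>2 \<le> n" "16 * k \<le> n"
  proof -
    have "20 * k\<^sup>2 \<le> (40 * k + 20)\<^sup>2" by (simp add: power2_eq_square algebra_simps)
    then show "20 * k\<^sup>2 \<le> n" using k(3) by linarith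
    have "16 * k \<le> 2 * (40 * k + 20)" by simp
    then show "16 * k \<le> n" using k(4) by (rule le_trans)
  qed
  have n1: "1 \<le> real n" using n by simp
  have tail: "(1 + exp 2) * (2 ^ k / fact k) \<le> (1 + exp 2) * (11 / (real n)\<^sup>2)"
    using truncation_tail[OF k(2)] by (intro mult_left_mono) (auto intro: add_nonneg_nonneg)
  have "81 * exp 6 * (2004 / (real n)\<^sup>2) + (1 + exp 2) * (11 / (real n)\<^sup>2) = A / (real n)\<^sup>2"
    by (simp add: A_def add_divide_distrib)
  then show "\<bar>matching_mean E V W avoid - exp (- (real n / real D))\<bar> \<le> A / (real n)\<^sup>2"
    using mean_avoid_estimate[OF kk] tail by linarith
  assume P: "P \<in> perfect_matchings E V W"
  have "1 / (real n)\<^sup>2 \<le> 1 / real n" using n1 by (simp add: power2_eq_square field_simps)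
  then have "(1 + exp 2) * 11 * (1 / (real n)\<^sup>2) \<le> (1 + exp 2) * 11 * (1 / real n)"
    by (intro mult_left_mono) (auto intro: add_nonneg_nonneg)
  moreover have "81 * exp 6 * (104 / real n) \<le> 81 * exp 6 * (2004 / real n)"
    using n1 by (intro mult_left_mono divide_right_mono) auto
  moreover have "81 * exp 6 * (2004 / real n) + (1 + exp 2) * 11 * (1 / real n) = A / real n"
    by (simp add: A_def add_divide_distrib)
  moreover have "(1 + exp 2) * (11 / (real n)\<^sup>2) = (1 + exp 2) * 11 * (1 / (real n)\<^sup>2)" by simp
  ultimately show "\<bar>avoid P - exp (- (real n / real D))\<bar> \<le> A / real n"
    using avoid_estimate[OF P kk] tail by linarith
qed

end

section \<open>The ratio of consecutive approximations\<close>

lemma ln_one_minus_cubic: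
  fixes u :: real assumes u: "0 \<le> u" "u \<le> 1/2"
  shows "ln (1 - u) + u + u\<^sup>2 / 2 \<le> 0" "- (u ^ 3) \<le> ln (1 - u) + u + u\<^sup>2 / 2"
proof -
  have d: "((\<lambda>t. ln (1 - t) + t + t\<^sup>2 / 2) has_real_derivative - (t\<^sup>2 / (1 - t))) (at t)"
    if "0 \<le> t" "t \<le> u" for t
  proof -
    have t: "t < 1" using that u by simp
    show ?thesis using t
      by (auto intro!: derivative_eq_intros simp: field_simps power2_eq_square)
  qed
  have "(\<lambda>t. ln (1 - t) + t + t\<^sup>2 / 2) u \<le> (\<lambda>t. ln (1 - t) + t + t\<^sup>2 / 2) 0"
  proof (rule DERIV_nonpos_imp_nonincreasing[OF u(1)])
    fix t assume t: "0 \<le> t" "t \<le> u"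
    show "\<exists>y. ((\<lambda>t. ln (1 - t) + t + t\<^sup>2 / 2) has_real_derivative y) (at t) \<and> y \<le> 0"
      using d[OF t] t u by (intro exI[of _ "- (t\<^sup>2 / (1 - t))"]) auto
  qed
  then show "ln (1 - u) + u + u\<^sup>2 / 2 \<le> 0" by simp
  have "(\<lambda>t. ln (1 - t) + t + t\<^sup>2 / 2 + t ^ 3) 0 \<le> (\<lambda>t. ln (1 - t) + t + t\<^sup>2 / 2 + t ^ 3) u"
  proof (rule DERIV_nonneg_imp_nondecreasing[OF u(1)])
    fix t assume t: "0 \<le> t" "t \<le> u"
    have "t\<^sup>2 / (1 - t) \<le> t\<^sup>2 / (1/2)" using t u by (intro divide_left_mono) auto
    then have "t\<^sup>2 / (1 - t) \<le> 2 * t\<^sup>2" by simp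
    then have "0 \<le> - (t\<^sup>2 / (1 - t)) + 3 * t\<^sup>2" using zero_le_power2[of t] by linarith
    moreover have "((\<lambda>t. ln (1 - t) + t + t\<^sup>2 / 2 + t ^ 3) has_real_derivative - (t\<^sup>2 / (1 - t)) + 3 * t\<^sup>2) (at t)"
      by (rule DERIV_add[OF d[OF t]]) (auto intro!: derivative_eq_intros)
    ultimately show "\<exists>y. ((\<lambda>t. ln (1 - t) + t + t\<^sup>2 / 2 + t ^ 3) has_real_derivative y) (at t) \<and> 0 \<le> y" by blast
  qed
  then show "- (u ^ 3) \<le> ln (1 - u) + u + u\<^sup>2 / 2" by simp
qed

text \<open>The quotient of \<open>extension_approx\<close> at \<open>m + 1\<close> and at \<open>m\<close> (\<open>extension_approx_Suc\<close>).\<close>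

definition approx_ratio :: "nat \<Rightarrow> nat \<Rightarrow> real" where
  "approx_ratio m n = (let d = real n - real m in
     ((d - 1) / d) ^ n * exp ((real m + 1) / (2 * (d - 1)) - real m / (2 * d)))"

text \<open>With \<open>u = 1 / d\<close>, the logarithm is \<open>n ln (1 - u) + n u\<^sup>2 / 2 + O(n u\<^sup>3)\<close>. The factor
\<open>exp (m / (2 d))\<close> in the approximation is what supplies \<open>n u\<^sup>2 / 2\<close> and cancels the second-order term
of \<open>ln (1 - u)\<close>.\<close>

lemma approx_ratio_estimate:
  assumes m: "2 * m \<le> n" and n: "64 \<le> n"
  shows "\<bar>approx_ratio m n - exp (- (real n / real (n - m)))\<bar> \<le> 16 / (real n)\<^sup>2" "exp (-3) \<le> approx_ratio m n"
proof -
  define d where "d = real n - real m"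
  define u where "u = 1 / d"
  have rd: "real (n - m) = d" using m by (simp add: d_def of_nat_diff)
  have dn: "real n / 2 \<le> d" using m unfolding d_def by linarith
  have npos: "64 \<le> real n" using n by simp
  have dpos: "32 \<le> d" using dn npos by linarith
  have u: "0 \<le> u" "u \<le> 1/2" using dpos by (auto simp: u_def field_simps)
  have nd: "real n / d \<le> 2" using dn dpos by (simp add: divide_le_eq)
  have pos: "0 < (d - 1) / d" using dpos by simp
  have one: "(d - 1) / d = 1 - u" using dpos by (simp add: u_def diff_divide_distrib)
  have ex: "(real m + 1) / (2 * (d - 1)) - real m / (2 * d) = real n * u\<^sup>2 / 2 + real n * u\<^sup>2 / 2 * (1 / (d - 1))"
  proof -
    have m: "real m = real n - d" by (simp add: d_def)
    have "(real m + 1) / (2 * (d - 1)) - real m / (2 * d) = real n / (2 * d * (d - 1))"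
      unfolding m using dpos by (simp add: field_simps)
    also have "\<dots> = real n * u\<^sup>2 / 2 * (1 + 1 / (d - 1))"
      using dpos by (simp add: u_def power2_eq_square field_simps)
    finally show ?thesis by (simp add: distrib_left)
  qed
  \<comment> \<open>All that is left of the logarithm after removing \<open>- n / d\<close>.\<close>
  define x where "x = real n * (ln (1 - u) + u + u\<^sup>2 / 2) + real n * u\<^sup>2 / 2 * (1 / (d - 1))"
  have "ln (approx_ratio m n) = real n * ln (1 - u) + (real n * u\<^sup>2 / 2 + real n * u\<^sup>2 / 2 * (1 / (d - 1)))"
  proof -
    have "approx_ratio m n = (1 - u) ^ n * exp (real n * u\<^sup>2 / 2 + real n * u\<^sup>2 / 2 * (1 / (d - 1)))"
      unfolding approx_ratio_def Let_def d_def[symmetric] one ex ..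
    then show ?thesis using pos by (simp add: one ln_mult ln_realpow)
  qed
  also have "\<dots> = x - real n * u" by (simp add: x_def algebra_simps)
  finally have lnr: "ln (approx_ratio m n) = x - real n / d" by (simp add: u_def)
  have rpos: "0 < approx_ratio m n"
    unfolding approx_ratio_def Let_def d_def[symmetric] using pos by simp
  have ratio: "approx_ratio m n = exp (- (real n / d)) * exp x"
    using lnr rpos by (metis exp_add exp_ln add.commute uminus_add_conv_diff)
  have u3: "real n * u ^ 3 \<le> 8 / (real n)\<^sup>2"
  proof -
    have "real n * u ^ 3 = real n / d ^ 3" by (simp add: u_def power_one_over)
    also have "\<dots> \<le> real n / (real n / 2) ^ 3"
      using dn npos dpos by (intro divide_left_mono power_mono mult_pos_pos) auto
    also have "\<dots> = 8 / (real n)\<^sup>2" using npos by (simp add: power2_eq_square power3_eq_cube)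
    finally show ?thesis .
  qed
  have xb: "\<bar>x\<bar> \<le> 8 / (real n)\<^sup>2"
  proof -
    have "1 / (d - 1) \<le> 2 * u" using dpos by (simp add: u_def field_simps)
    then have "real n * u\<^sup>2 / 2 * (1 / (d - 1)) \<le> real n * u\<^sup>2 / 2 * (2 * u)" by (intro mult_left_mono) auto
    also have "\<dots> = real n * u ^ 3" by (simp add: power2_eq_square power3_eq_cube)
    finally have a: "real n * u\<^sup>2 / 2 * (1 / (d - 1)) \<le> real n * u ^ 3" .
    have b: "0 \<le> real n * u\<^sup>2 / 2 * (1 / (d - 1))" using dpos by simp
    have c: "real n * (ln (1 - u) + u + u\<^sup>2 / 2) \<le> 0" using ln_one_minus_cubic(1)[OF u] by (simp add: mult_nonneg_nonpos)
    have "real n * (- (u ^ 3)) \<le> real n * (ln (1 - u) + u + u\<^sup>2 / 2)" using ln_one_minus_cubic(2)[OF u] by (intro mult_left_mono) auto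
    then have d: "- (real n * u ^ 3) \<le> real n * (ln (1 - u) + u + u\<^sup>2 / 2)" by simp
    show ?thesis using a b c d u3 unfolding x_def by linarith
  qed
  have x1: "\<bar>x\<bar> \<le> 1/2"
  proof -
    have "64\<^sup>2 \<le> (real n)\<^sup>2" using npos by (intro power_mono) auto
    then have "8 / (real n)\<^sup>2 \<le> 8 / 64\<^sup>2" using npos by (intro divide_left_mono mult_pos_pos zero_less_power) linarith+
    then show ?thesis using xb by simp
  qed
  have "\<bar>exp x - 1\<bar> \<le> 2 * \<bar>x\<bar>"
  proof -
    have "1 + x \<le> exp x" by simp
    moreover have "exp x \<le> 1 + 2 * \<bar>x\<bar>"
    proof -
      have "exp x \<le> exp \<bar>x\<bar>" by simp
      also have "\<dots> \<le> 1 + \<bar>x\<bar> + \<bar>x\<bar>\<^sup>2" using x1 by (intro exp_bound) auto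
      also have "\<bar>x\<bar>\<^sup>2 \<le> \<bar>x\<bar>" using x1 mult_left_mono[of "\<bar>x\<bar>" 1 "\<bar>x\<bar>"] by (simp add: power2_eq_square)
      finally show ?thesis by simp
    qed
    ultimately show ?thesis by linarith
  qed
  then have ex1: "\<bar>exp x - 1\<bar> \<le> 16 / (real n)\<^sup>2" using xb by simp
  have "approx_ratio m n - exp (- (real n / d)) = exp (- (real n / d)) * (exp x - 1)"
    unfolding ratio by (simp add: algebra_simps)
  then have "\<bar>approx_ratio m n - exp (- (real n / d))\<bar> = exp (- (real n / d)) * \<bar>exp x - 1\<bar>" by (simp add: abs_mult)
  also have "\<dots> \<le> 1 * (16 / (real n)\<^sup>2)" using ex1 dpos by (intro mult_mono) auto
  finally show "\<bar>approx_ratio m n - exp (- (real n / real (n - m)))\<bar> \<le> 16 / (real n)\<^sup>2" unfolding rd by simp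
  have "-3 \<le> - (real n / d) + x" using nd x1 by linarith
  then have "exp (-3) \<le> exp (- (real n / d) + x)" by (simp only: exp_le_cancel_iff)
  then show "exp (-3) \<le> approx_ratio m n" unfolding ratio exp_add .
qed

section \<open>From Latin rectangles to matchings\<close>

definition free_cells :: "nat \<Rightarrow> nat list list \<Rightarrow> (nat \<times> nat) set" where
  "free_cells n R = {(c, s). c < n \<and> s \<in> {1..n} \<and> (\<forall>r\<in>set R. r ! c \<noteq> s)}"

definition row_graph :: "nat \<Rightarrow> nat list \<Rightarrow> (nat \<times> nat) set" where
  "row_graph n r = (\<lambda>c. (c, r ! c)) ` {..<n}"

definition extensions :: "nat \<Rightarrow> nat list list \<Rightarrow> nat list set" where
  "extensions n R = {r. R @ [r] \<in> latin_rectangles (Suc (length R)) n}"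

lemma extension_count_eq: "extension_count n R = card (extensions n R)"
  by (simp add: extension_count_def extensions_def)

lemma latin_rectanglesD:
  assumes "R \<in> latin_rectangles m n"
  shows "m \<le> n" "length R = m" "\<And>r. r \<in> set R \<Longrightarrow> length r = n \<and> distinct r \<and> set r = {1..n}"
    "\<And>c. c < n \<Longrightarrow> distinct (map (\<lambda>r. r ! c) R)"
  using assms by (auto simp: latin_rectangles_def)

lemma free_cells_append: "free_cells n (R @ [r]) = free_cells n R - row_graph n r"
  by (auto simp: free_cells_def row_graph_def)

lemma latin_rectangles_snoc:
  assumes R: "R \<in> latin_rectangles m n" and m: "m < n"
  shows "R @ [r] \<in> latin_rectangles (Suc m) n \<longleftrightarrow>
    length r = n \<and> distinct r \<and> set r = {1..n} \<and> row_graph n r \<subseteq> free_cells n R"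
proof -
  have "R @ [r] \<in> latin_rectangles (Suc m) n \<longleftrightarrow>
    (length r = n \<and> distinct r \<and> set r = {1..n}) \<and> (\<forall>c<n. \<forall>r'\<in>set R. r' ! c \<noteq> r ! c)"
    using R m by (auto simp: latin_rectangles_def) (metis image_eqI, metis)
  moreover have "row_graph n r \<subseteq> free_cells n R \<longleftrightarrow> (\<forall>c<n. \<forall>r'\<in>set R. r' ! c \<noteq> r ! c)"
    if "length r = n" "set r = {1..n}"
  proof -
    have "r ! c \<in> {1..n}" if "c < n" for c using \<open>length r = n\<close> \<open>set r = {1..n}\<close> that by (metis nth_mem)
    then show ?thesis by (auto simp: row_graph_def free_cells_def)
  qed
  ultimately show ?thesis by blast
qed

text \<open>The \<open>m\<close> rows use \<open>m\<close> distinct symbols in each column and put each symbol into \<open>m\<close> distinct columns.\<close>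

lemma free_cells_regular:
  assumes R: "R \<in> latin_rectangles m n"
  shows "regular_between (free_cells n R) (n - m) {..<n} {1..n}"
proof -
  note L = latin_rectanglesD[OF R]
  have rc: "r ! c \<in> {1..n}" if "r \<in> set R" "c < n" for r c
  proof -
    have "r ! c \<in> set r" using L(3)[OF that(1)] that(2) by (intro nth_mem) auto
    then show ?thesis using L(3)[OF that(1)] by simp
  qed
  have "card {s\<in>{1..n}. (c, s) \<in> free_cells n R} = n - m" if c: "c \<in> {..<n}" for c
  proof -
    let ?C = "set (map (\<lambda>r. r ! c) R)"
    have "{s\<in>{1..n}. (c, s) \<in> free_cells n R} = {1..n} - ?C"
      using c by (auto simp: free_cells_def)
    moreover have "card ?C = m" using distinct_card[OF L(4)[of c]] c L(2) by simp
    moreover have "?C \<subseteq> {1..n}" using rc c by auto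
    ultimately show ?thesis by (simp add: card_Diff_subset)
  qed
  moreover have "card {c\<in>{..<n}. (c, s) \<in> free_cells n R} = n - m" if s: "s \<in> {1..n}" for s
  proof -
    let ?C = "\<lambda>i. {c\<in>{..<n}. R ! i ! c = s}"
    have one: "card (?C i) = 1" if i: "i < m" for i
    proof -
      have Ri: "length (R ! i) = n" "distinct (R ! i)" "set (R ! i) = {1..n}" using L(2,3) i by auto
      then obtain c where c: "c < n" "R ! i ! c = s" using s by (metis in_set_conv_nth)
      then have "?C i = {c}" using Ri by (auto simp: nth_eq_iff_index_eq)
      then show ?thesis by simp
    qed
    have "{c\<in>{..<n}. (c, s) \<in> free_cells n R} = {..<n} - (\<Union>i<m. ?C i)"
      using s L(2) by (auto simp: free_cells_def all_set_conv_all_nth)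
    moreover have "card (\<Union>i<m. ?C i) = m"
    proof -
    have "card (\<Union>i<m. ?C i) = (\<Sum>i<m. card (?C i))"
    proof (rule card_UN_disjoint)
      show "\<forall>i\<in>{..<m}. \<forall>j\<in>{..<m}. i \<noteq> j \<longrightarrow> ?C i \<inter> ?C j = {}"
      proof (intro ballI impI)
        fix i j assume ij: "i \<in> {..<m}" "j \<in> {..<m}" "i \<noteq> j"
        have ne: "R ! i ! c \<noteq> R ! j ! c" if "c < n" for c
          using L(4)[OF that] ij L(2) by (auto simp: distinct_conv_nth)
        show "?C i \<inter> ?C j = {}"
        proof (rule equals0I)
          fix c assume "c \<in> ?C i \<inter> ?C j"
          then have "c < n" "R ! i ! c = R ! j ! c" by auto
          then show False using ne by blast
        qed
      qed
    qed auto
    also have "(\<Sum>i<m. card (?C i)) = (\<Sum>i<m. 1)"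
      by (rule sum.cong[OF refl]) (use one in blast)
    finally show ?thesis by simp
    qed
    moreover have sub: "(\<Union>i<m. ?C i) \<subseteq> {..<n}" by auto
    moreover have "card ({..<n} - (\<Union>i<m. ?C i)) = card {..<n} - card (\<Union>i<m. ?C i)"
      using sub finite_subset[OF sub] by (intro card_Diff_subset) auto
    ultimately show ?thesis by simp
  qed
  ultimately show ?thesis by (auto simp: regular_between_def free_cells_def)
qed

text \<open>A row is a permutation of the symbols, and its graph is a perfect matching.\<close>

lemma extensions_bij:
  assumes R: "R \<in> latin_rectangles m n" and m: "m < n"
  shows "bij_betw (row_graph n) (extensions n R) (perfect_matchings (free_cells n R) {..<n} {1..n})"
proof -
  have ext: "extensions n R = {r. length r = n \<and> distinct r \<and> set r = {1..n} \<and> row_graph n r \<subseteq> free_cells n R}"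
    unfolding extensions_def latin_rectanglesD(2)[OF R] latin_rectangles_snoc[OF R m] ..
  have gr: "(c, s) \<in> row_graph n r \<longleftrightarrow> c < n \<and> s = r ! c" for c s r by (auto simp: row_graph_def)
  show ?thesis
    unfolding bij_betw_def
  proof
    show "inj_on (row_graph n) (extensions n R)"
    proof (rule inj_onI)
      fix r r' assume r: "r \<in> extensions n R" "r' \<in> extensions n R" "row_graph n r = row_graph n r'"
      have "r ! c = r' ! c" if "c < n" for c
        using r(3) gr[of c "r ! c" r] gr[of c "r ! c" r'] that by auto
      then show "r = r'" using r by (intro nth_equalityI) (auto simp: ext)
    qed
    show "row_graph n ` extensions n R = perfect_matchings (free_cells n R) {..<n} {1..n}"
    proof
      show "row_graph n ` extensions n R \<subseteq> perfect_matchings (free_cells n R) {..<n} {1..n}"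
      proof
        fix M assume "M \<in> row_graph n ` extensions n R"
        then obtain r where M: "M = row_graph n r" and r: "length r = n" "distinct r" "set r = {1..n}" "row_graph n r \<subseteq> free_cells n R"
          by (auto simp: ext)
        have rs: "r ! c \<in> {1..n}" if "c < n" for c using r that by (metis nth_mem)
        have "\<exists>!c. (c, s) \<in> M" if "s \<in> {1..n}" for s
        proof -
          have "s \<in> set r" using that r(3) by simp
          then obtain c where c: "c < n" "r ! c = s" by (auto simp: in_set_conv_nth r(1))
          have "c' = c" if "c' < n" "r ! c' = s" for c'
            using nth_eq_iff_index_eq[OF r(2), of c' c] that c r(1) by simp
          note uniq = this
          show ?thesis
          proof (rule ex1I[of _ c])
            show "(c, s) \<in> M" using c by (simp add: M gr)
            fix c' assume "(c', s) \<in> M"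
            then have "c' < n" "r ! c' = s" by (simp_all add: M gr)
            then show "c' = c" by (rule uniq)
          qed
        qed
        moreover have "M \<subseteq> {..<n} \<times> {1..n}" using rs unfolding M row_graph_def by auto
        ultimately show "M \<in> perfect_matchings (free_cells n R) {..<n} {1..n}"
          using r(4) unfolding perfect_matchings_def mem_Collect_eq M by (simp add: gr)
      qed
      show "perfect_matchings (free_cells n R) {..<n} {1..n} \<subseteq> row_graph n ` extensions n R"
      proof
        fix M assume M: "M \<in> perfect_matchings (free_cells n R) {..<n} {1..n}"
        have "\<forall>c\<in>{..<n}. \<exists>s. (c, s) \<in> M" using perfect_matching_partner(1)[OF M] by auto
        then obtain f where f: "\<forall>c\<in>{..<n}. (c, f c) \<in> M"
          using bchoice[of "{..<n}" "\<lambda>c s. (c, s) \<in> M"] by blast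
        define r where "r = map f [0..<n]"
        have rM: "row_graph n r = M"
        proof
          show "row_graph n r \<subseteq> M" using f by (auto simp: row_graph_def r_def)
          show "M \<subseteq> row_graph n r"
          proof clarify
            fix c s assume cs: "(c, s) \<in> M"
            then have "c < n" using perfect_matching_edgeD(2)[OF M] by auto
            moreover have "(c, f c) \<in> M" using f \<open>c < n\<close> by simp
            then have "s = f c" by (rule perfect_matching_unique(1)[OF M cs])
            ultimately show "(c, s) \<in> row_graph n r" by (simp add: gr r_def)
          qed
        qed
        have "inj_on f {..<n}"
        proof (rule inj_onI)
          fix c c' assume c: "c \<in> {..<n}" "c' \<in> {..<n}" "f c = f c'"
          have "(c, f c) \<in> M" using f c(1) by blast
          moreover have "(c', f c) \<in> M" using f c(2) unfolding c(3) by blast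
          ultimately show "c = c'" by (rule perfect_matching_unique(2)[OF M])
        qed
        then have "distinct r" by (simp add: r_def distinct_map lessThan_atLeast0)
        moreover have "set r = {1..n}"
        proof -
          have "set r = f ` {..<n}" by (auto simp: r_def)
          also have "\<dots> = {1..n}"
          proof
            show "f ` {..<n} \<subseteq> {1..n}" using f perfect_matching_edgeD(3)[OF M] by blast
            show "{1..n} \<subseteq> f ` {..<n}"
            proof
              fix s assume "s \<in> {1..n}"
              then obtain c where c: "(c, s) \<in> M" using perfect_matching_partner(2)[OF M] by auto
              then have "c \<in> {..<n}" using perfect_matching_edgeD(2)[OF M] by auto
              moreover from this have "(c, f c) \<in> M" using f by blast
              then have "s = f c" by (rule perfect_matching_unique(1)[OF M c])
              ultimately show "s \<in> f ` {..<n}" by simp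
            qed
          qed
          finally show ?thesis .
        qed
        moreover have "row_graph n r \<subseteq> free_cells n R" unfolding rM using M by (auto simp: perfect_matchings_def)
        ultimately have "r \<in> extensions n R" by (simp add: ext r_def)
        then show "M \<in> row_graph n ` extensions n R" using rM by blast
      qed
    qed
  qed
qed

lemma extension_count_matchings:
  assumes R: "R \<in> latin_rectangles m n" and m: "m < n"
  shows "real (extension_count n R) = matching_count (free_cells n R) {..<n} {1..n}"
  using bij_betw_same_card[OF extensions_bij[OF assms]] by (simp add: extension_count_eq matching_count_def)

lemma sum_extensions:
  assumes R: "R \<in> latin_rectangles m n" and m: "m < n"
  shows "(\<Sum>r\<in>extensions n R. f (row_graph n r)) = (\<Sum>P\<in>perfect_matchings (free_cells n R) {..<n} {1..n}. f P)"
  by (rule sum.reindex_bij_betw[OF extensions_bij[OF assms]])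

lemma finite_extensions:
  assumes R: "R \<in> latin_rectangles m n" and m: "m < n"
  shows "finite (extensions n R)"
  using bij_betw_finite[OF extensions_bij[OF assms]] finite_perfect_matchings by blast

lemma finite_latin_rectangles: "finite (latin_rectangles m n)"
proof (rule finite_subset)
  show "latin_rectangles m n \<subseteq> {R. set R \<subseteq> {r. set r \<subseteq> {1..n} \<and> length r = n} \<and> length R = m}"
    by (auto simp: latin_rectangles_def)
  show "finite {R. set R \<subseteq> {r. set r \<subseteq> {1..n} \<and> length r = n} \<and> length R = m}"
    by (intro finite_lists_length_eq) auto
qed

text \<open>Each rectangle with \<open>m + 1\<close> rows arises from exactly one rectangle with \<open>m\<close> rows, by removing the last row.\<close>

lemma sum_latin_rectangles_Suc:
  fixes f :: "nat list list \<Rightarrow> real"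
  assumes m: "m < n"
  shows "(\<Sum>R\<in>latin_rectangles (Suc m) n. f R) = (\<Sum>R\<in>latin_rectangles m n. \<Sum>r\<in>extensions n R. f (R @ [r]))"
proof -
  let ?S = "SIGMA R:latin_rectangles m n. extensions n R"
  have "(\<Sum>R\<in>latin_rectangles m n. \<Sum>r\<in>extensions n R. f (R @ [r])) = (\<Sum>(R, r)\<in>?S. f (R @ [r]))"
    using finite_latin_rectangles finite_extensions m by (subst sum.Sigma) auto
  also have "\<dots> = (\<Sum>R\<in>latin_rectangles (Suc m) n. f R)"
  proof (rule sum.reindex_bij_witness[where i="\<lambda>R. (butlast R, last R)" and j="\<lambda>(R, r). R @ [r]"])
    fix R assume R: "R \<in> latin_rectangles (Suc m) n"
    then have "R \<noteq> []" by (auto simp: latin_rectangles_def)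
    then obtain R0 r where R': "R = R0 @ [r]" by (cases R rule: rev_cases) auto
    have "R0 \<in> latin_rectangles m n"
      using R by (auto simp: latin_rectangles_def R')
    then show "(butlast R, last R) \<in> ?S"
      using R latin_rectanglesD(2)[of R0 m n] by (simp add: extensions_def R')
    show "(case (butlast R, last R) of (R, r) \<Rightarrow> R @ [r]) = R" by (simp add: R')
  next
    fix p assume "p \<in> ?S"
    then show "(case p of (R, r) \<Rightarrow> R @ [r]) \<in> latin_rectangles (Suc m) n"
      using latin_rectanglesD(2) by (fastforce simp: extensions_def)
  qed auto
  finally show ?thesis by simp
qed

lemma extension_count_Nil: "extension_count n [] = fact n" if "0 < n"
proof -
  have "extensions n [] = {r. distinct r \<and> set r = {1..n}}"
    using that by (auto simp: extensions_def latin_rectangles_def distinct_card[symmetric])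
  also have "\<dots> = permutations_of_set {1..n}" by (auto simp: permutations_of_set_def)
  finally show ?thesis by (simp add: extension_count_eq)
qed

lemma extension_approx_pos: "m < n \<Longrightarrow> 0 < extension_approx m n"
  by (auto simp: extension_approx_def Let_def)

lemma extension_approx_Suc:
  assumes "Suc m < n"
  shows "extension_approx (Suc m) n = approx_ratio m n * extension_approx m n"
proof -
  define d where "d = real n - real m"
  have d: "0 < d" "real n - real (Suc m) = d - 1" using assms by (auto simp: d_def)
  have n: "0 < real n" using assms by simp
  have ap: "extension_approx (Suc m) n = fact n * ((d - 1) / real n) ^ n * exp ((real m + 1) / (2 * (d - 1)))"
    unfolding extension_approx_def Let_def d(2) by (simp add: add.commute)
  have pw: "((d - 1) / real n) ^ n = ((d - 1) / d) ^ n * (d / real n) ^ n"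
    using d(1) by (simp flip: power_mult_distrib)
  have ex: "exp ((real m + 1) / (2 * (d - 1))) = exp ((real m + 1) / (2 * (d - 1)) - real m / (2 * d)) * exp (real m / (2 * d))"
    by (simp flip: exp_add)
  have rhs: "approx_ratio m n * extension_approx m n = ((d - 1) / d) ^ n *
     exp ((real m + 1) / (2 * (d - 1)) - real m / (2 * d)) * (fact n * (d / real n) ^ n * exp (real m / (2 * d)))"
    unfolding approx_ratio_def extension_approx_def Let_def d_def[symmetric] ..
  show ?thesis unfolding ap pw ex rhs by (simp only: mult_ac)
qed

text \<open>The factor by which the quotient of \<open>extension_count\<close> and \<open>extension_approx\<close> changes when the row \<open>r\<close> is
appended.\<close>

definition growth_factor :: "nat \<Rightarrow> nat list list \<Rightarrow> nat list \<Rightarrow> real" where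
  "growth_factor n R r = real (extension_count n (R @ [r])) / (real (extension_count n R) * approx_ratio (length R) n)"

text \<open>The number of extensions changes by the factor \<open>avoid\<close> of the new row, whose mean, variance and range are
known for the graph of free cells; dividing by \<open>approx_ratio\<close> costs at most the factor \<open>exp 3\<close>. The
constant \<open>A\<close> is absolute.\<close>

lemma growth_factor_estimates:
  assumes n: "64 \<le> n" and m: "160 * m \<le> n" and R: "R \<in> latin_rectangles m n"
    and k: "1 \<le> k" "n ^ 4 \<le> 2 ^ k" "(40 * k + 20)\<^sup>2 \<le> n" "2 * (40 * k + 20) \<le> n"
  defines "A1 \<equiv> 81 * exp 6 * 2004 + (1 + exp 2) * 11 + (16::real)"
  defines "A \<equiv> A1 * exp 3 + (236 * 1920\<^sup>2 + A1\<^sup>2) * exp 6"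
  shows "0 < extension_count n R"
    and "\<And>r. r \<in> extensions n R \<Longrightarrow> \<bar>growth_factor n R r - 1\<bar> \<le> A / real n"
    and "\<bar>\<Sum>r\<in>extensions n R. growth_factor n R r - 1\<bar> \<le> real (card (extensions n R)) * (A / (real n)\<^sup>2)"
    and "(\<Sum>r\<in>extensions n R. (growth_factor n R r - 1)\<^sup>2) \<le> real (card (extensions n R)) * (A * (real m + 1) / real n ^ 4)"
proof -
  let ?E = "free_cells n R" and ?w = "real (extension_count n R)" and ?b = "approx_ratio m n"
  interpret dense_regular_graph ?E "{..<n}" "{1..n}" "n - m" m n
    by unfold_locales (use free_cells_regular[OF R] n m in auto)
  have mn: "m < n" "Suc m < n" using m n by linarith+
  have w: "?w = matching_count ?E {..<n} {1..n}" by (rule extension_count_matchings[OF R mn(1)])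
  show pos: "0 < extension_count n R" using count_pos w by simp
  have len: "length R = m" by (rule latin_rectanglesD(2)[OF R])
  have npos: "1 \<le> real n" using n by simp
  note S = avoid_summary[OF k]
  have m2: "2 * m \<le> n" using m by linarith
  note B = approx_ratio_estimate[OF m2 n]
  have bpos: "0 < ?b" using B(2) by (rule less_le_trans[OF exp_gt_zero])
  have binv: "1 / ?b \<le> exp 3"
  proof -
    have "1 / ?b \<le> 1 / exp (-3)" using B(2) bpos by (intro divide_left_mono) auto
    then show ?thesis by (simp add: exp_minus divide_inverse)
  qed
  have A1: "16 \<le> A1" by (simp add: A1_def add_nonneg_nonneg)
  have n2: "1 / (real n)\<^sup>2 \<le> 1 / real n" using npos by (simp add: power2_eq_square field_simps)
  have mean: "\<bar>matching_mean ?E {..<n} {1..n} avoid - ?b\<bar> \<le> A1 / (real n)\<^sup>2"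
  proof -
    have "A1 / (real n)\<^sup>2 = (81 * exp 6 * 2004 + (1 + exp 2) * 11) / (real n)\<^sup>2 + 16 / (real n)\<^sup>2"
      by (simp add: A1_def add_divide_distrib)
    then show ?thesis using S(1) B(1) by linarith
  qed
  have dev: "\<bar>avoid P - ?b\<bar> \<le> A1 / real n" if "P \<in> perfect_matchings ?E {..<n} {1..n}" for P
  proof -
    have "A1 / real n = (81 * exp 6 * 2004 + (1 + exp 2) * 11) / real n + 16 * (1 / real n)"
      by (simp add: A1_def add_divide_distrib)
    moreover have "16 / (real n)\<^sup>2 = 16 * (1 / (real n)\<^sup>2)" by simp
    ultimately show ?thesis using S(2)[OF that] B(1) n2 by linarith
  qed
  have g: "growth_factor n R r = avoid (row_graph n r) / ?b" if "r \<in> extensions n R" for r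
  proof -
    have "R @ [r] \<in> latin_rectangles (Suc m) n" using that len by (simp add: extensions_def)
    from extension_count_matchings[OF this mn(2)]
    have "real (extension_count n (R @ [r])) = matching_count (?E - row_graph n r) {..<n} {1..n}"
      by (simp add: free_cells_append)
    then show ?thesis unfolding growth_factor_def len avoid_eq w by simp
  qed
  have g1: "growth_factor n R r - 1 = (avoid (row_graph n r) - ?b) * (1 / ?b)" if "r \<in> extensions n R" for r
    using g[OF that] bpos by (simp add: field_simps)
  have A1A: "A1 * exp 3 \<le> A" "(236 * 1920\<^sup>2 + A1\<^sup>2) * exp 6 \<le> A" using A1 by (auto simp: A_def)
  show "\<bar>growth_factor n R r - 1\<bar> \<le> A / real n" if r: "r \<in> extensions n R" for r
  proof -
    have "row_graph n r \<in> perfect_matchings ?E {..<n} {1..n}"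
      using extensions_bij[OF R mn(1)] r by (auto simp: bij_betw_def)
    from dev[OF this] have "\<bar>growth_factor n R r - 1\<bar> \<le> A1 / real n * exp 3"
      unfolding g1[OF r] abs_mult using binv bpos A1 by (intro mult_mono) auto
    also have "\<dots> = A1 * exp 3 / real n" by simp
    also have "\<dots> \<le> A / real n" using A1A by (intro divide_right_mono) auto
    finally show ?thesis .
  qed
  have cw: "real (card (extensions n R)) = ?w" by (simp add: extension_count_eq)
  have s1: "(\<Sum>r\<in>extensions n R. growth_factor n R r - 1) = ?w * (matching_mean ?E {..<n} {1..n} avoid - ?b) * (1 / ?b)"
  proof -
    have "(\<Sum>r\<in>extensions n R. growth_factor n R r - 1) = (\<Sum>r\<in>extensions n R. (avoid (row_graph n r) - ?b) * (1 / ?b))"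
      by (intro sum.cong refl g1)
    also have "\<dots> = (\<Sum>P\<in>perfect_matchings ?E {..<n} {1..n}. (avoid P - ?b) * (1 / ?b))"
      by (rule sum_extensions[OF R mn(1)])
    also have "\<dots> = ((\<Sum>P\<in>perfect_matchings ?E {..<n} {1..n}. avoid P) - ?w * ?b) * (1 / ?b)"
      unfolding sum_distrib_right[symmetric] by (simp add: sum_subtractf w matching_count_def)
    also have "(\<Sum>P\<in>perfect_matchings ?E {..<n} {1..n}. avoid P) = ?w * matching_mean ?E {..<n} {1..n} avoid"
      using count_pos by (simp add: matching_mean_def w)
    finally show ?thesis by (simp only: right_diff_distrib)
  qed
  have "\<bar>\<Sum>r\<in>extensions n R. growth_factor n R r - 1\<bar> = ?w * \<bar>matching_mean ?E {..<n} {1..n} avoid - ?b\<bar> * (1 / ?b)"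
    unfolding s1 abs_mult using bpos by simp
  also have "\<dots> \<le> ?w * (A1 / (real n)\<^sup>2) * exp 3"
    using mean binv bpos A1 by (intro mult_mono mult_left_mono) auto
  also have "\<dots> = ?w * (A1 * exp 3 / (real n)\<^sup>2)" by simp
  also have "\<dots> \<le> ?w * (A / (real n)\<^sup>2)" using A1A by (intro mult_left_mono divide_right_mono) auto
  finally show "\<bar>\<Sum>r\<in>extensions n R. growth_factor n R r - 1\<bar> \<le> real (card (extensions n R)) * (A / (real n)\<^sup>2)"
    unfolding cw .
  have "(\<Sum>r\<in>extensions n R. (growth_factor n R r - 1)\<^sup>2) = (\<Sum>r\<in>extensions n R. (avoid (row_graph n r) - ?b)\<^sup>2 * (1 / ?b)\<^sup>2)"
    by (intro sum.cong refl) (simp only: g1 power_mult_distrib)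
  also have "\<dots> = (\<Sum>P\<in>perfect_matchings ?E {..<n} {1..n}. (avoid P - ?b)\<^sup>2 * (1 / ?b)\<^sup>2)"
    by (rule sum_extensions[OF R mn(1)])
  also have "\<dots> = (matching_sse ?E {..<n} {1..n} avoid + ?w * (matching_mean ?E {..<n} {1..n} avoid - ?b)\<^sup>2) * (1 / ?b)\<^sup>2"
    unfolding sum_distrib_right[symmetric] w by (subst matching_sse_shift) auto
  also have "\<dots> \<le> (?w * ((236 * 1920\<^sup>2 + A1\<^sup>2) * (real m + 1) / real n ^ 4)) * exp 6"
  proof (intro mult_mono)
    have "(1 / ?b)\<^sup>2 \<le> (exp 3)\<^sup>2" using binv bpos by (intro power_mono) auto
    also have "\<dots> = exp 6" by (simp flip: exp_of_nat_mult exp_double)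
    finally show "(1 / ?b)\<^sup>2 \<le> exp 6" .
    have "(matching_mean ?E {..<n} {1..n} avoid - ?b)\<^sup>2 \<le> (A1 / (real n)\<^sup>2)\<^sup>2"
      using mean by (metis abs_ge_zero power2_abs power_mono)
    also have "\<dots> = A1\<^sup>2 * 1 / real n ^ 4" by (simp add: power_divide flip: power_mult)
    also have "\<dots> \<le> A1\<^sup>2 * (real m + 1) / real n ^ 4" by (intro divide_right_mono mult_left_mono) auto
    finally have "?w * (matching_mean ?E {..<n} {1..n} avoid - ?b)\<^sup>2 \<le> ?w * (A1\<^sup>2 * (real m + 1) / real n ^ 4)"
      by (intro mult_left_mono) auto
    moreover have "matching_sse ?E {..<n} {1..n} avoid \<le> ?w * (236 * 1920\<^sup>2 * (real m + 1) / real n ^ 4)"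
      unfolding w by (rule avoid_sse[OF k])
    ultimately show "matching_sse ?E {..<n} {1..n} avoid + ?w * (matching_mean ?E {..<n} {1..n} avoid - ?b)\<^sup>2
      \<le> ?w * ((236 * 1920\<^sup>2 + A1\<^sup>2) * (real m + 1) / real n ^ 4)"
      unfolding distrib_right add_divide_distrib distrib_left[of ?w] by linarith
  qed auto
  also have "\<dots> = ?w * ((236 * 1920\<^sup>2 + A1\<^sup>2) * exp 6 * (real m + 1) / real n ^ 4)" by simp
  also have "\<dots> \<le> ?w * (A * (real m + 1) / real n ^ 4)"
    using A1A by (intro mult_left_mono divide_right_mono mult_right_mono) auto
  finally show "(\<Sum>r\<in>extensions n R. (growth_factor n R r - 1)\<^sup>2) \<le> real (card (extensions n R)) * (A * (real m + 1) / real n ^ 4)"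
    unfolding cw .
qed

section \<open>Powers of factors close to one\<close>

lemma exp_quadratic_upper: "\<bar>y\<bar> \<le> 1 \<Longrightarrow> exp y \<le> 1 + y + y\<^sup>2" for y :: real
proof (cases "0 \<le> y")
  case True
  assume "\<bar>y\<bar> \<le> 1"
  then show ?thesis using True by (intro exp_bound) auto
next
  case False
  assume "\<bar>y\<bar> \<le> 1"
  have "1 - y \<le> exp (- y)" using exp_ge_add_one_self[of "- y"] by simp
  then have "(1 - y) * exp y \<le> exp (- y) * exp y" by (intro mult_right_mono) auto
  also have "\<dots> = 1" by (simp flip: exp_add)
  also have "1 \<le> (1 - y) * (1 + y + y\<^sup>2)"
  proof -
    have "(1 - y) * (1 + y + y\<^sup>2) = 1 - y ^ 3" by (simp add: power2_eq_square power3_eq_cube algebra_simps)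
    moreover have "y ^ 3 \<le> 0" using False by (simp add: power3_eq_cube mult_nonneg_nonpos mult_nonpos_nonpos)
    ultimately show ?thesis by simp
  qed
  finally have "(1 - y) * exp y \<le> (1 - y) * (1 + y + y\<^sup>2)" .
  then show ?thesis using False by (simp add: mult_le_cancel_left_pos)
qed

lemma power_near_one:
  fixes x :: real
  assumes x: "real p * \<bar>x\<bar> \<le> 1" "\<bar>x\<bar> \<le> 1"
  shows "(1 + x) ^ p \<le> 1 + real p * x + (real p)\<^sup>2 * x\<^sup>2" "1 + real p * x \<le> (1 + x) ^ p"
    "\<bar>(1 + x) ^ p - 1\<bar> \<le> 2 * real p * \<bar>x\<bar>" "(1 + x) ^ p \<le> 3" "0 \<le> (1 + x) ^ p"
proof -
  have x0: "0 \<le> 1 + x" using x by linarith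
  have px: "\<bar>real p * x\<bar> \<le> 1" using x by (simp add: abs_mult)
  have "(1 + x) ^ p \<le> exp x ^ p" using x0 by (intro power_mono) auto
  also have "\<dots> = exp (real p * x)" by (simp add: exp_of_nat_mult)
  also have "\<dots> \<le> 1 + real p * x + (real p * x)\<^sup>2" by (rule exp_quadratic_upper[OF px])
  finally show u: "(1 + x) ^ p \<le> 1 + real p * x + (real p)\<^sup>2 * x\<^sup>2" by (simp add: power_mult_distrib)
  show l: "1 + real p * x \<le> (1 + x) ^ p" using x by (intro Bernoulli_inequality) auto
  have sq: "(real p)\<^sup>2 * x\<^sup>2 \<le> real p * \<bar>x\<bar>"
  proof -
    have "(real p)\<^sup>2 * x\<^sup>2 = (real p * \<bar>x\<bar>) * (real p * \<bar>x\<bar>)" by (simp add: power2_eq_square)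
    also have "\<dots> \<le> 1 * (real p * \<bar>x\<bar>)" using x by (intro mult_right_mono) auto
    finally show ?thesis by simp
  qed
  have ab: "real p * x \<le> real p * \<bar>x\<bar>" "- (real p * \<bar>x\<bar>) \<le> real p * x"
    by (auto simp: abs_if mult_left_mono)
  have nn: "0 \<le> real p * \<bar>x\<bar>" by simp
  show "\<bar>(1 + x) ^ p - 1\<bar> \<le> 2 * real p * \<bar>x\<bar>"
    unfolding abs_le_iff mult.assoc[of 2] using u l sq ab nn by linarith
  show "(1 + x) ^ p \<le> 3" using u sq ab x(1) by linarith
  show "0 \<le> (1 + x) ^ p" using x0 by simp
qed

text \<open>Here \<open>\<eta>\<close> stands for the factors by which the appended rows change the normalised count: within \<open>a\<close> of 1,
with bias \<open>\<alpha>\<close> and second moment \<open>\<beta>\<close> around 1.\<close>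

context
  fixes S :: "'r set" and \<eta> :: "'r \<Rightarrow> real" and a \<alpha> \<beta> :: real and p :: nat
  assumes close: "\<And>r. r \<in> S \<Longrightarrow> \<bar>\<eta> r - 1\<bar> \<le> a" and a: "real p * a \<le> 1" "a \<le> 1"
    and first: "\<bar>\<Sum>r\<in>S. \<eta> r - 1\<bar> \<le> real (card S) * \<alpha>"
    and second: "(\<Sum>r\<in>S. (\<eta> r - 1)\<^sup>2) \<le> real (card S) * \<beta>"
begin

lemma scaled_deviation:
  assumes "r \<in> S" shows "real p * \<bar>\<eta> r - 1\<bar> \<le> 1" "\<bar>\<eta> r - 1\<bar> \<le> 1"
proof -
  show "\<bar>\<eta> r - 1\<bar> \<le> 1" using close[OF assms] a by linarith
  have "real p * \<bar>\<eta> r - 1\<bar> \<le> real p * a" using close[OF assms] by (intro mult_left_mono) auto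
  then show "real p * \<bar>\<eta> r - 1\<bar> \<le> 1" using a by linarith
qed

lemma sum_powers_upper: "(\<Sum>r\<in>S. \<eta> r ^ p) \<le> real (card S) * (1 + real p * \<alpha> + (real p)\<^sup>2 * \<beta>)"
proof -
  have "(\<Sum>r\<in>S. \<eta> r ^ p) \<le> (\<Sum>r\<in>S. 1 + real p * (\<eta> r - 1) + (real p)\<^sup>2 * (\<eta> r - 1)\<^sup>2)"
    using power_near_one(1)[OF scaled_deviation] by (intro sum_mono) auto
  also have "\<dots> = real (card S) + real p * (\<Sum>r\<in>S. \<eta> r - 1) + (real p)\<^sup>2 * (\<Sum>r\<in>S. (\<eta> r - 1)\<^sup>2)"
    by (simp only: sum.distrib sum_distrib_left[symmetric] sum_constant mult_1_right)
  also have "\<dots> \<le> real (card S) + real p * (real (card S) * \<alpha>) + (real p)\<^sup>2 * (real (card S) * \<beta>)"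
    using first second by (intro add_mono mult_left_mono) auto
  finally show ?thesis by (simp add: algebra_simps)
qed

lemma sum_powers_lower: "real (card S) * (1 - real p * \<alpha>) \<le> (\<Sum>r\<in>S. \<eta> r ^ p)"
proof -
  have "real (card S) + real p * (- (real (card S) * \<alpha>)) \<le> real (card S) + real p * (\<Sum>r\<in>S. \<eta> r - 1)"
    using first by (intro add_mono mult_left_mono) auto
  also have "\<dots> = (\<Sum>r\<in>S. 1 + real p * (\<eta> r - 1))"
    by (simp only: sum.distrib sum_distrib_left[symmetric] sum_constant mult_1_right)
  also have "\<dots> \<le> (\<Sum>r\<in>S. \<eta> r ^ p)"
    using power_near_one(2)[OF scaled_deviation] by (intro sum_mono) auto
  finally show ?thesis by (simp add: algebra_simps)
qed

text \<open>The factor \<open>y \<eta> - 1\<close> is split into \<open>(y - 1) + y (\<eta> - 1)\<close>. In the cross term the linear part of \<open>\<eta> - 1\<close>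
averages to the bias \<open>\<alpha>\<close>, so the deviation \<open>\<bar>\<eta> - 1\<bar>\<close> itself never appears to the first power.\<close>

lemma sum_powers_deviation:
  assumes y: "0 \<le> y"
  shows "(\<Sum>r\<in>S. \<eta> r ^ p * (y * \<eta> r - 1)\<^sup>2) \<le> real (card S) *
    ((y - 1)\<^sup>2 * (1 + real p * \<alpha> + (real p)\<^sup>2 * \<beta>) + 2 * \<bar>y - 1\<bar> * y * (\<alpha> + 2 * real p * \<beta>) + 3 * y\<^sup>2 * \<beta>)"
proof -
  let ?c = "real (card S)"
  have "(\<Sum>r\<in>S. \<eta> r ^ p * (y * \<eta> r - 1)\<^sup>2) = (\<Sum>r\<in>S. (y - 1)\<^sup>2 * \<eta> r ^ p
     + 2 * (y - 1) * y * (\<eta> r ^ p * (\<eta> r - 1)) + y\<^sup>2 * (\<eta> r ^ p * (\<eta> r - 1)\<^sup>2))"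
    by (intro sum.cong refl) (simp add: power2_eq_square algebra_simps)
  also have "\<dots> = (y - 1)\<^sup>2 * (\<Sum>r\<in>S. \<eta> r ^ p) + 2 * (y - 1) * y * (\<Sum>r\<in>S. \<eta> r ^ p * (\<eta> r - 1))
     + y\<^sup>2 * (\<Sum>r\<in>S. \<eta> r ^ p * (\<eta> r - 1)\<^sup>2)"
    by (simp only: sum.distrib sum_distrib_left[symmetric])
  also have "\<dots> \<le> (y - 1)\<^sup>2 * (?c * (1 + real p * \<alpha> + (real p)\<^sup>2 * \<beta>)) + 2 * \<bar>y - 1\<bar> * y * (?c * (\<alpha> + 2 * real p * \<beta>))
     + y\<^sup>2 * (3 * (?c * \<beta>))"
  proof (intro add_mono)
    show "(y - 1)\<^sup>2 * (\<Sum>r\<in>S. \<eta> r ^ p) \<le> (y - 1)\<^sup>2 * (?c * (1 + real p * \<alpha> + (real p)\<^sup>2 * \<beta>))"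
      using sum_powers_upper by (intro mult_left_mono) auto
    have "(\<Sum>r\<in>S. \<eta> r ^ p * (\<eta> r - 1)) = (\<Sum>r\<in>S. \<eta> r - 1) + (\<Sum>r\<in>S. (\<eta> r ^ p - 1) * (\<eta> r - 1))"
      by (simp add: sum.distrib[symmetric] algebra_simps)
    also have "\<bar>\<dots>\<bar> \<le> \<bar>\<Sum>r\<in>S. \<eta> r - 1\<bar> + (\<Sum>r\<in>S. \<bar>(\<eta> r ^ p - 1) * (\<eta> r - 1)\<bar>)"
      by (rule order_trans[OF abs_triangle_ineq]) (simp add: sum_abs)
    also have "(\<Sum>r\<in>S. \<bar>(\<eta> r ^ p - 1) * (\<eta> r - 1)\<bar>) \<le> (\<Sum>r\<in>S. 2 * real p * (\<eta> r - 1)\<^sup>2)"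
    proof (rule sum_mono)
      fix r assume "r \<in> S"
      then have "\<bar>\<eta> r ^ p - 1\<bar> \<le> 2 * real p * \<bar>\<eta> r - 1\<bar>" using power_near_one(3)[OF scaled_deviation] by auto
      then have "\<bar>\<eta> r ^ p - 1\<bar> * \<bar>\<eta> r - 1\<bar> \<le> 2 * real p * \<bar>\<eta> r - 1\<bar> * \<bar>\<eta> r - 1\<bar>" by (intro mult_right_mono) auto
      then show "\<bar>(\<eta> r ^ p - 1) * (\<eta> r - 1)\<bar> \<le> 2 * real p * (\<eta> r - 1)\<^sup>2" by (simp add: abs_mult power2_eq_square)
    qed
    also have "\<dots> = 2 * real p * (\<Sum>r\<in>S. (\<eta> r - 1)\<^sup>2)" by (simp add: sum_distrib_left)
    also have "\<dots> \<le> 2 * real p * (?c * \<beta>)" using second by (intro mult_left_mono) auto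
    finally have "\<bar>\<Sum>r\<in>S. \<eta> r ^ p * (\<eta> r - 1)\<bar> \<le> ?c * \<alpha> + 2 * real p * (?c * \<beta>)" using first by linarith
    then have b: "\<bar>\<Sum>r\<in>S. \<eta> r ^ p * (\<eta> r - 1)\<bar> \<le> ?c * (\<alpha> + 2 * real p * \<beta>)" by (simp add: algebra_simps)
    have "2 * (y - 1) * y * (\<Sum>r\<in>S. \<eta> r ^ p * (\<eta> r - 1)) \<le> \<bar>2 * (y - 1) * y * (\<Sum>r\<in>S. \<eta> r ^ p * (\<eta> r - 1))\<bar>" by simp
    also have "\<dots> = 2 * \<bar>y - 1\<bar> * y * \<bar>\<Sum>r\<in>S. \<eta> r ^ p * (\<eta> r - 1)\<bar>" unfolding abs_mult using y by simp
    also have "\<dots> \<le> 2 * \<bar>y - 1\<bar> * y * (?c * (\<alpha> + 2 * real p * \<beta>))" using b y by (intro mult_left_mono) auto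
    finally show "2 * (y - 1) * y * (\<Sum>r\<in>S. \<eta> r ^ p * (\<eta> r - 1)) \<le> 2 * \<bar>y - 1\<bar> * y * (?c * (\<alpha> + 2 * real p * \<beta>))" .
    have "(\<Sum>r\<in>S. \<eta> r ^ p * (\<eta> r - 1)\<^sup>2) \<le> (\<Sum>r\<in>S. 3 * (\<eta> r - 1)\<^sup>2)"
      using power_near_one(4)[OF scaled_deviation] by (intro sum_mono mult_right_mono) auto
    also have "\<dots> \<le> 3 * (?c * \<beta>)" using second by (simp flip: sum_distrib_left)
    finally show "y\<^sup>2 * (\<Sum>r\<in>S. \<eta> r ^ p * (\<eta> r - 1)\<^sup>2) \<le> y\<^sup>2 * (3 * (?c * \<beta>))" by (intro mult_left_mono) auto
  qed
  also have "\<dots> = ?c * ((y - 1)\<^sup>2 * (1 + real p * \<alpha> + (real p)\<^sup>2 * \<beta>) + 2 * \<bar>y - 1\<bar> * y * (\<alpha> + 2 * real p * \<beta>) + 3 * y\<^sup>2 * \<beta>)"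
    by (simp add: algebra_simps)
  finally show ?thesis .
qed
end

section \<open>Moments of the normalised extension count\<close>

text \<open>What the summation over rectangles requires of the growth factors up to row \<open>M\<close>: an absolute constant
\<open>A\<close>, and \<open>M\<close> small compared with \<open>n / A\<close>.\<close>

locale extension_moments =
  fixes n M :: nat and A :: real
  assumes A: "1 \<le> A" and small: "4 * A * (real M + 2) \<le> real n"
    and positive: "\<And>m R. m < M \<Longrightarrow> R \<in> latin_rectangles m n \<Longrightarrow> 0 < extension_count n R"
    and near: "\<And>m R r. m < M \<Longrightarrow> R \<in> latin_rectangles m n \<Longrightarrow> r \<in> extensions n R \<Longrightarrow>
      \<bar>growth_factor n R r - 1\<bar> \<le> A / real n"
    and first: "\<And>m R. m < M \<Longrightarrow> R \<in> latin_rectangles m n \<Longrightarrow>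
      \<bar>\<Sum>r\<in>extensions n R. growth_factor n R r - 1\<bar> \<le> real (card (extensions n R)) * (A / (real n)\<^sup>2)"
    and second: "\<And>m R. m < M \<Longrightarrow> R \<in> latin_rectangles m n \<Longrightarrow>
      (\<Sum>r\<in>extensions n R. (growth_factor n R r - 1)\<^sup>2) \<le> real (card (extensions n R)) * (A * (real m + 1) / real n ^ 4)"
begin

text \<open>The exponent of the normalised count grows by one with each row that is removed and by at most 2 through the
square in \<open>deviation\<close>, so \<open>pmax\<close> bounds all exponents. The number \<open>\<delta>\<close> bounds the relative error that one
row causes in a power with exponent up to \<open>pmax\<close>.\<close>

definition pmax :: real where "pmax = real M + 2"
definition \<delta> :: real where "\<delta> = 2 * pmax * A / (real n)\<^sup>2"
definition Y where "Y m R = real (extension_count n R) / extension_approx m n"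
text \<open>The predicted number of rectangles with \<open>m\<close> rows.\<close>

definition total where "total m = (\<Prod>i<m. extension_approx i n)"
definition moment where "moment m p = (\<Sum>R\<in>latin_rectangles m n. Y m R ^ p) / total m"
definition deviation where "deviation m p = (\<Sum>R\<in>latin_rectangles m n. Y m R ^ p * (Y m R - 1)\<^sup>2) / total m"

lemma pmax_ge_2: "2 \<le> pmax" and n_ge_8: "8 \<le> real n" and pmax_A_le: "4 * (pmax * A) \<le> real n" and pmax_le: "4 * pmax \<le> real n" and M_less: "Suc M < n"
proof -
  show "2 \<le> pmax" by (simp add: pmax_def)
  show pmax_A_le: "4 * (pmax * A) \<le> real n" using small by (simp add: pmax_def mult_ac)
  have "pmax * 1 \<le> pmax * A" using A \<open>2 \<le> pmax\<close> by (intro mult_left_mono) auto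
  then show pmax_le: "4 * pmax \<le> real n" using pmax_A_le by linarith
  then show "8 \<le> real n" using \<open>2 \<le> pmax\<close> by linarith
  show "Suc M < n" using pmax_le \<open>2 \<le> pmax\<close> by (simp add: pmax_def)
qed

lemma delta_nonneg: "0 \<le> \<delta>" and delta_pmax: "\<delta> * pmax \<le> 1/8 * A"
proof -
  have npos: "0 < real n" using n_ge_8 by linarith
  show "0 \<le> \<delta>" using pmax_ge_2 A by (simp add: \<delta>_def)
  have "\<delta> * pmax = 2 * A * ((pmax / real n) * (pmax / real n))" by (simp add: \<delta>_def power2_eq_square)
  also have "\<dots> \<le> 2 * A * (1/4 * (1/4))"
    using pmax_le pmax_ge_2 npos A by (intro mult_left_mono mult_mono) (auto simp: field_simps)
  finally show "\<delta> * pmax \<le> 1/8 * A" by simp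
qed

lemma delta_M: "\<delta> * real M \<le> 1/2"
proof -
  have npos: "0 < real n" using n_ge_8 by linarith
  have "\<delta> * real M \<le> \<delta> * pmax" using delta_nonneg by (intro mult_left_mono) (auto simp: pmax_def)
  also have "\<dots> = 2 * ((pmax * A / real n) * (pmax / real n))" by (simp add: \<delta>_def power2_eq_square)
  also have "\<dots> \<le> 2 * (1/4 * (1/4))"
    using pmax_le pmax_A_le pmax_ge_2 npos A by (intro mult_left_mono mult_mono) (auto simp: field_simps)
  finally show ?thesis by simp
qed

context
  fixes m R p assumes m: "m < M" and R: "R \<in> latin_rectangles m n" and p: "real p \<le> pmax"
begin

lemma approx_pos: "0 < extension_approx m n"
  using m M_less by (intro extension_approx_pos) simp

lemma Y_nonneg: "0 \<le> Y m R"
  using approx_pos by (simp add: Y_def)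

lemma card_ext: "real (card (extensions n R)) = extension_approx m n * Y m R"
  using approx_pos by (simp add: Y_def extension_count_eq)

lemma Y_step:
  assumes "r \<in> extensions n R" shows "Y (Suc m) (R @ [r]) = Y m R * growth_factor n R r"
proof -
  have len: "length R = m" by (rule latin_rectanglesD(2)[OF R])
  have "Suc m < n" using m M_less by simp
  from extension_approx_Suc[OF this] positive[OF m R] approx_pos show ?thesis
    by (simp add: Y_def growth_factor_def len)
qed

lemma step_bounds:
  "real p * (A / real n) \<le> 1" "A / real n \<le> 1"
  "real p * (A / (real n)\<^sup>2) + (real p)\<^sup>2 * (A * (real m + 1) / real n ^ 4) \<le> \<delta>"
  "2 * real p * (A * (real m + 1) / real n ^ 4) \<le> 2 * A / (real n)\<^sup>2"
  "real p * (A / (real n)\<^sup>2) \<le> \<delta>"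
proof -
  have npos: "0 < real n" using n_ge_8 by linarith
  have "real p * A \<le> pmax * A" using p A by (intro mult_right_mono) auto
  also have "\<dots> \<le> real n" using pmax_A_le pmax_ge_2 A by (smt (verit) mult_nonneg_nonneg)
  finally show "real p * (A / real n) \<le> 1" using npos by simp
  have "1 * A \<le> pmax * A" using pmax_ge_2 A by (intro mult_right_mono) auto
  then have "A \<le> real n" using pmax_A_le A by linarith
  then show "A / real n \<le> 1" using npos by simp
  have mp: "real p * (real m + 1) \<le> (real n)\<^sup>2"
  proof -
    have "real p * (real m + 1) \<le> real n * real n"
      using p pmax_le pmax_ge_2 m by (intro mult_mono) (auto simp: pmax_def)
    then show ?thesis by (simp add: power2_eq_square)
  qed
  have b: "real p * (A * (real m + 1) / real n ^ 4) \<le> A / (real n)\<^sup>2"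
  proof -
    have "real p * (A * (real m + 1) / real n ^ 4) = A * (real p * (real m + 1)) / ((real n)\<^sup>2 * (real n)\<^sup>2)"
      by (simp add: power4_eq_xxxx power2_eq_square mult_ac)
    also have "\<dots> \<le> A * (real n)\<^sup>2 / ((real n)\<^sup>2 * (real n)\<^sup>2)"
      using mp A by (intro divide_right_mono mult_left_mono) auto
    also have "\<dots> = A / (real n)\<^sup>2" using npos by (simp only: power2_eq_square) simp
    finally show ?thesis .
  qed
  then show "2 * real p * (A * (real m + 1) / real n ^ 4) \<le> 2 * A / (real n)\<^sup>2" by simp
  have c: "real p * (A / (real n)\<^sup>2) \<le> pmax * (A / (real n)\<^sup>2)" using p A by (intro mult_right_mono) auto
  have "(real p)\<^sup>2 * (A * (real m + 1) / real n ^ 4) = real p * (real p * (A * (real m + 1) / real n ^ 4))"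
    by (simp add: power2_eq_square)
  also have "\<dots> \<le> real p * (A / (real n)\<^sup>2)" using b by (intro mult_left_mono) auto
  finally have d: "(real p)\<^sup>2 * (A * (real m + 1) / real n ^ 4) \<le> real p * (A / (real n)\<^sup>2)" .
  have e: "\<delta> = pmax * (A / (real n)\<^sup>2) + pmax * (A / (real n)\<^sup>2)" by (simp add: \<delta>_def)
  show "real p * (A / (real n)\<^sup>2) + (real p)\<^sup>2 * (A * (real m + 1) / real n ^ 4) \<le> \<delta>"
    unfolding e by (rule add_mono[OF c order_trans[OF d c]])
  have "0 \<le> pmax * (A / (real n)\<^sup>2)" using pmax_ge_2 A by simp
  from add_mono[OF c this] show "real p * (A / (real n)\<^sup>2) \<le> \<delta>" unfolding e by simp
qed

lemma power_step_upper: "(\<Sum>r\<in>extensions n R. growth_factor n R r ^ p) \<le> real (card (extensions n R)) * (1 + \<delta>)"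
proof -
  have "(\<Sum>r\<in>extensions n R. growth_factor n R r ^ p) \<le> real (card (extensions n R)) *
     (1 + real p * (A / (real n)\<^sup>2) + (real p)\<^sup>2 * (A * (real m + 1) / real n ^ 4))"
    by (rule sum_powers_upper[OF near[OF m R] step_bounds(1,2) first[OF m R] second[OF m R]])
  also have "\<dots> \<le> real (card (extensions n R)) * (1 + \<delta>)" using step_bounds(3) by (intro mult_left_mono) auto
  finally show ?thesis .
qed

lemma power_step_lower: "real (card (extensions n R)) * (1 - \<delta>) \<le> (\<Sum>r\<in>extensions n R. growth_factor n R r ^ p)"
proof -
  have "real (card (extensions n R)) * (1 - \<delta>) \<le> real (card (extensions n R)) * (1 - real p * (A / (real n)\<^sup>2))"
    using step_bounds(5) by (intro mult_left_mono) auto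
  also have "\<dots> \<le> (\<Sum>r\<in>extensions n R. growth_factor n R r ^ p)"
    by (rule sum_powers_lower[OF near[OF m R] step_bounds(1,2) first[OF m R] second[OF m R]])
  finally show ?thesis .
qed

text \<open>The cross term of \<open>sum_powers_deviation\<close> is split by the arithmetic-geometric inequality with weight \<open>pmax\<close>:
the coefficient \<open>1 / pmax\<close> of \<open>(Y - 1)\<^sup>2\<close> is small enough to accumulate to a constant factor over
\<open>M\<close> rows, and the remaining term has the order \<open>M / n\<^sup>4\<close> of the variance of one row.\<close>

lemma deviation_step:
  "(\<Sum>r\<in>extensions n R. growth_factor n R r ^ p * (Y m R * growth_factor n R r - 1)\<^sup>2) \<le> real (card (extensions n R)) *
    ((1 + \<delta> + 1 / pmax) * (Y m R - 1)\<^sup>2 + 12 * A\<^sup>2 * pmax / real n ^ 4 * (Y m R)\<^sup>2)"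
proof -
  let ?y = "Y m R" and ?\<alpha> = "A / (real n)\<^sup>2" and ?\<beta> = "A * (real m + 1) / real n ^ 4"
  have npos: "0 < real n" using n_ge_8 by linarith
  have Ppos: "0 < pmax" using pmax_ge_2 by linarith
  have "(\<Sum>r\<in>extensions n R. growth_factor n R r ^ p * (?y * growth_factor n R r - 1)\<^sup>2) \<le> real (card (extensions n R)) *
    ((?y - 1)\<^sup>2 * (1 + real p * ?\<alpha> + (real p)\<^sup>2 * ?\<beta>) + 2 * \<bar>?y - 1\<bar> * ?y * (?\<alpha> + 2 * real p * ?\<beta>) + 3 * ?y\<^sup>2 * ?\<beta>)"
    by (rule sum_powers_deviation[OF near[OF m R] step_bounds(1,2) first[OF m R] second[OF m R] Y_nonneg])
  also have "\<dots> \<le> real (card (extensions n R)) * ((1 + \<delta> + 1 / pmax) * (?y - 1)\<^sup>2 + 12 * A\<^sup>2 * pmax / real n ^ 4 * ?y\<^sup>2)"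
  proof (rule mult_left_mono)
    have 1: "(?y - 1)\<^sup>2 * (1 + real p * ?\<alpha> + (real p)\<^sup>2 * ?\<beta>) \<le> (?y - 1)\<^sup>2 * (1 + \<delta>)"
      using step_bounds(3) by (intro mult_left_mono) auto
    have "?\<alpha> + 2 * real p * ?\<beta> \<le> 3 * ?\<alpha>" using step_bounds(4) by simp
    then have "2 * \<bar>?y - 1\<bar> * ?y * (?\<alpha> + 2 * real p * ?\<beta>) \<le> 2 * \<bar>?y - 1\<bar> * ?y * (3 * ?\<alpha>)"
      using Y_nonneg by (intro mult_left_mono) auto
    also have "\<dots> \<le> (?y - 1)\<^sup>2 / pmax + pmax * (3 * ?\<alpha> * ?y)\<^sup>2"
    proof -
      have "2 * a * b \<le> a\<^sup>2 / pmax + pmax * b\<^sup>2" for a b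
      proof -
        have "a\<^sup>2 / pmax + pmax * b\<^sup>2 - 2 * a * b = (a - pmax * b)\<^sup>2 / pmax"
          using Ppos by (simp add: field_simps power2_eq_square)
        moreover have "0 \<le> (a - pmax * b)\<^sup>2 / pmax" using Ppos by simp
        ultimately show ?thesis by linarith
      qed
      from this[of "\<bar>?y - 1\<bar>" "3 * ?\<alpha> * ?y"] show ?thesis by (simp add: mult_ac)
    qed
    finally have 2: "2 * \<bar>?y - 1\<bar> * ?y * (?\<alpha> + 2 * real p * ?\<beta>) \<le> (?y - 1)\<^sup>2 / pmax + pmax * (3 * ?\<alpha> * ?y)\<^sup>2" .
    have 3: "pmax * (3 * ?\<alpha> * ?y)\<^sup>2 = 9 * A\<^sup>2 * pmax / real n ^ 4 * ?y\<^sup>2"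
      by (simp add: power_divide power_mult_distrib flip: power_mult)
    have 4: "3 * ?y\<^sup>2 * ?\<beta> \<le> 3 * A\<^sup>2 * pmax / real n ^ 4 * ?y\<^sup>2"
    proof -
      have "A * (real m + 1) \<le> A\<^sup>2 * pmax"
        using A m by (intro mult_mono) (auto simp: pmax_def power2_eq_square)
      then have "?\<beta> \<le> A\<^sup>2 * pmax / real n ^ 4" by (intro divide_right_mono) auto
      then have "3 * ?y\<^sup>2 * ?\<beta> \<le> 3 * ?y\<^sup>2 * (A\<^sup>2 * pmax / real n ^ 4)" by (intro mult_left_mono) auto
      then show ?thesis by (simp add: mult_ac)
    qed
    have 5: "12 * A\<^sup>2 * pmax / real n ^ 4 * ?y\<^sup>2 = 9 * A\<^sup>2 * pmax / real n ^ 4 * ?y\<^sup>2 + 3 * A\<^sup>2 * pmax / real n ^ 4 * ?y\<^sup>2"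
      by (simp add: add_divide_distrib[symmetric] distrib_right[symmetric])
    have 6: "(1 + \<delta> + 1 / pmax) * (?y - 1)\<^sup>2 = (?y - 1)\<^sup>2 * (1 + \<delta>) + (?y - 1)\<^sup>2 / pmax" by (simp add: algebra_simps)
    show "(?y - 1)\<^sup>2 * (1 + real p * ?\<alpha> + (real p)\<^sup>2 * ?\<beta>) + 2 * \<bar>?y - 1\<bar> * ?y * (?\<alpha> + 2 * real p * ?\<beta>) + 3 * ?y\<^sup>2 * ?\<beta>
      \<le> (1 + \<delta> + 1 / pmax) * (?y - 1)\<^sup>2 + 12 * A\<^sup>2 * pmax / real n ^ 4 * ?y\<^sup>2"
      unfolding 5 6 using 1 2 3 4 by linarith
  qed simp
  finally show ?thesis .
qed
end

lemma total_pos: "m \<le> M \<Longrightarrow> 0 < total m"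
  unfolding total_def using M_less by (intro prod_pos) (auto intro: extension_approx_pos)

lemma total_Suc: "total (Suc m) = total m * extension_approx m n"
  by (simp add: total_def)

text \<open>The sum over the last row is separated; by \<open>Y_step\<close> it sees the normalised count only through the factor
\<open>Y m R\<close>.\<close>

lemma moment_Suc_sum:
  fixes f :: "real \<Rightarrow> real"
  assumes m: "m < M"
  shows "(\<Sum>R\<in>latin_rectangles (Suc m) n. f (Y (Suc m) R)) =
    (\<Sum>R\<in>latin_rectangles m n. \<Sum>r\<in>extensions n R. f (Y m R * growth_factor n R r))"
proof -
  have "m < n" using m M_less by simp
  from sum_latin_rectangles_Suc[OF this, of "\<lambda>R. f (Y (Suc m) R)"] show ?thesis
    using Y_step[OF m, where p=0] pmax_ge_2 by simp
qed

text \<open>A rectangle \<open>R\<close> has \<open>extension_approx m n * Y m R\<close> extensions, so summing over the last row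
raises the exponent of \<open>Y m R\<close> by one.\<close>

lemma moment_step:
  assumes m: "m < M" and p: "real p \<le> pmax"
  shows "moment (Suc m) p \<le> (1 + \<delta>) * moment m (Suc p)" "(1 - \<delta>) * moment m (Suc p) \<le> moment (Suc m) p"
proof -
  let ?B = "extension_approx m n" and ?L = "latin_rectangles m n"
  have Bpos: "0 < ?B" using m M_less by (intro extension_approx_pos) simp
  have tpos: "0 < total m" using m by (intro total_pos) simp
  have s: "(\<Sum>R\<in>latin_rectangles (Suc m) n. Y (Suc m) R ^ p) = (\<Sum>R\<in>?L. Y m R ^ p * (\<Sum>r\<in>extensions n R. growth_factor n R r ^ p))"
    unfolding moment_Suc_sum[OF m, where f="\<lambda>y. y ^ p"] by (simp add: power_mult_distrib sum_distrib_left)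
  have e: "Y m R ^ p * (real (card (extensions n R)) * c) = c * ?B * Y m R ^ Suc p" if "R \<in> ?L" for R c
    using card_ext[OF m that p] by simp
  have "(\<Sum>R\<in>?L. Y m R ^ p * (\<Sum>r\<in>extensions n R. growth_factor n R r ^ p)) \<le> (\<Sum>R\<in>?L. (1 + \<delta>) * ?B * Y m R ^ Suc p)"
  proof (rule sum_mono)
    fix R assume R: "R \<in> ?L"
    show "Y m R ^ p * (\<Sum>r\<in>extensions n R. growth_factor n R r ^ p) \<le> (1 + \<delta>) * ?B * Y m R ^ Suc p"
      unfolding e[OF R, symmetric] using power_step_upper[OF m R p] Y_nonneg[OF m R p] by (intro mult_left_mono) auto
  qed
  also have "\<dots> = (1 + \<delta>) * ?B * (\<Sum>R\<in>?L. Y m R ^ Suc p)" by (simp add: sum_distrib_left)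
  finally have "moment (Suc m) p \<le> (1 + \<delta>) * ?B * (\<Sum>R\<in>?L. Y m R ^ Suc p) / (total m * ?B)"
    unfolding moment_def s total_Suc using tpos Bpos by (intro divide_right_mono) auto
  then show "moment (Suc m) p \<le> (1 + \<delta>) * moment m (Suc p)" using Bpos by (simp add: moment_def)
  have "(\<Sum>R\<in>?L. (1 - \<delta>) * ?B * Y m R ^ Suc p) \<le> (\<Sum>R\<in>?L. Y m R ^ p * (\<Sum>r\<in>extensions n R. growth_factor n R r ^ p))"
  proof (rule sum_mono)
    fix R assume R: "R \<in> ?L"
    show "(1 - \<delta>) * ?B * Y m R ^ Suc p \<le> Y m R ^ p * (\<Sum>r\<in>extensions n R. growth_factor n R r ^ p)"
      unfolding e[OF R, symmetric] using power_step_lower[OF m R p] Y_nonneg[OF m R p] by (intro mult_left_mono) auto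
  qed
  moreover have "(\<Sum>R\<in>?L. (1 - \<delta>) * ?B * Y m R ^ Suc p) = (1 - \<delta>) * ?B * (\<Sum>R\<in>?L. Y m R ^ Suc p)" by (simp add: sum_distrib_left)
  ultimately have "(1 - \<delta>) * ?B * (\<Sum>R\<in>?L. Y m R ^ Suc p) / (total m * ?B) \<le> moment (Suc m) p"
    unfolding moment_def s total_Suc using tpos Bpos by (intro divide_right_mono) auto
  then show "(1 - \<delta>) * moment m (Suc p) \<le> moment (Suc m) p" using Bpos by (simp add: moment_def)
qed

lemma Y_empty: "R \<in> latin_rectangles 0 n \<Longrightarrow> R = [] \<and> Y 0 R = 1"
proof -
  assume "R \<in> latin_rectangles 0 n"
  then have R: "R = []" by (auto simp: latin_rectangles_def)
  have "0 < n" using M_less by simp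
  then have "Y 0 [] = 1" by (simp add: Y_def extension_count_Nil extension_approx_def)
  then show ?thesis using R by simp
qed

lemma latin_rectangles_0: "latin_rectangles 0 n = {[]}"
  by (auto simp: latin_rectangles_def)

lemma moment_0: "moment 0 p = 1"
  using Y_empty by (simp add: moment_def latin_rectangles_0 total_def)

text \<open>The recursion ends at the empty rectangle, where all moments equal 1.\<close>

lemma moment_bounds:
  assumes "m \<le> M" "real p + real m \<le> pmax"
  shows "moment m p \<le> (1 + \<delta>) ^ m \<and> 1 - \<delta> * real m \<le> moment m p"
  using assms
proof (induction m arbitrary: p)
  case 0 then show ?case by (simp add: moment_0)
next
  case (Suc m p)
  have m: "m < M" and p: "real p \<le> pmax" using Suc.prems by auto
  have IH: "moment m (Suc p) \<le> (1 + \<delta>) ^ m" "1 - \<delta> * real m \<le> moment m (Suc p)"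
    using Suc.IH[of "Suc p"] Suc.prems by auto
  have "moment (Suc m) p \<le> (1 + \<delta>) * (1 + \<delta>) ^ m"
    using moment_step(1)[OF m p] IH(1) delta_nonneg by (meson add_nonneg_nonneg mult_left_mono order_trans zero_le_one)
  moreover have "1 - \<delta> * real (Suc m) \<le> moment (Suc m) p"
  proof -
    have "\<delta> * real M \<le> 1/2" by (rule delta_M)
    moreover have "1 * \<delta> \<le> real M * \<delta>" using m delta_nonneg by (intro mult_right_mono) auto
    ultimately have d1: "\<delta> \<le> 1" by (simp add: mult.commute)
    have "(1 - \<delta>) * (1 - \<delta> * real m) \<le> (1 - \<delta>) * moment m (Suc p)" using d1 IH(2) by (intro mult_left_mono) auto
    moreover have "1 - \<delta> * real (Suc m) \<le> (1 - \<delta>) * (1 - \<delta> * real m)"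
    proof -
      have "0 \<le> \<delta> * (\<delta> * real m)" using delta_nonneg by simp
      then show ?thesis by (simp add: algebra_simps)
    qed
    ultimately show ?thesis using moment_step(2)[OF m p] by linarith
  qed
  ultimately show ?case by simp
qed

lemma moment_upper:
  assumes "m \<le> M" "real p + real m \<le> pmax"
  shows "moment m p \<le> exp A"
proof -
  have "moment m p \<le> (1 + \<delta>) ^ m" using moment_bounds[OF assms] by simp
  also have "\<dots> \<le> exp \<delta> ^ m" using delta_nonneg by (intro power_mono) auto
  also have "\<dots> = exp (real m * \<delta>)" by (simp add: exp_of_nat_mult)
  also have "\<dots> \<le> exp A"
  proof -
    have "real m * \<delta> \<le> pmax * \<delta>" using assms delta_nonneg by (intro mult_right_mono) auto
    also have "\<dots> \<le> 1/8 * A" using delta_pmax by (simp add: mult.commute)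
    also have "\<dots> \<le> A" using A by simp
    finally show ?thesis by simp
  qed
  finally show ?thesis .
qed

text \<open>Summing \<open>deviation_step\<close> over all rectangles raises the exponent of the weight by one, as in
\<open>moment_step\<close>; the additive error carries the moment of order \<open>p + 3\<close>, which is bounded by a constant.\<close>

lemma deviation_recursion:
  assumes m: "m < M" and p: "real p + real m + 3 \<le> pmax"
  shows "deviation (Suc m) p \<le> (1 + \<delta> + 1 / pmax) * deviation m (Suc p) + 12 * A\<^sup>2 * pmax / real n ^ 4 * exp A"
proof -
  let ?B = "extension_approx m n" and ?L = "latin_rectangles m n"
  let ?c = "1 + \<delta> + 1 / pmax" and ?d = "12 * A\<^sup>2 * pmax / real n ^ 4"
  have p': "real p \<le> pmax" using p by linarith
  have Bpos: "0 < ?B" using m M_less by (intro extension_approx_pos) simp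
  have tpos: "0 < total m" using m by (intro total_pos) simp
  have s: "(\<Sum>R\<in>latin_rectangles (Suc m) n. Y (Suc m) R ^ p * (Y (Suc m) R - 1)\<^sup>2) =
     (\<Sum>R\<in>?L. Y m R ^ p * (\<Sum>r\<in>extensions n R. growth_factor n R r ^ p * (Y m R * growth_factor n R r - 1)\<^sup>2))"
    unfolding moment_Suc_sum[OF m, where f="\<lambda>y. y ^ p * (y - 1)\<^sup>2"] by (simp add: power_mult_distrib sum_distrib_left mult.assoc)
  have "\<dots> \<le> (\<Sum>R\<in>?L. ?B * (?c * (Y m R ^ Suc p * (Y m R - 1)\<^sup>2) + ?d * Y m R ^ (p + 3)))"
  proof (rule sum_mono)
    fix R assume R: "R \<in> ?L"
    have "Y m R ^ p * (\<Sum>r\<in>extensions n R. growth_factor n R r ^ p * (Y m R * growth_factor n R r - 1)\<^sup>2)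
      \<le> Y m R ^ p * (?B * Y m R * (?c * (Y m R - 1)\<^sup>2 + ?d * (Y m R)\<^sup>2))"
      using deviation_step[OF m R p'] Y_nonneg[OF m R p'] unfolding card_ext[OF m R p'] by (intro mult_left_mono) auto
    also have "\<dots> = ?B * (?c * (Y m R ^ Suc p * (Y m R - 1)\<^sup>2) + ?d * Y m R ^ (p + 3))"
    proof -
      have "y ^ p * (b * y * (c * u + d * y\<^sup>2)) = b * (c * (y ^ Suc p * u) + d * y ^ (p + 3))" for y b c d u :: real
        by (simp add: power_add power3_eq_cube power2_eq_square distrib_left mult_ac)
      then show ?thesis .
    qed
    finally show "Y m R ^ p * (\<Sum>r\<in>extensions n R. growth_factor n R r ^ p * (Y m R * growth_factor n R r - 1)\<^sup>2)
      \<le> ?B * (?c * (Y m R ^ Suc p * (Y m R - 1)\<^sup>2) + ?d * Y m R ^ (p + 3))" .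
  qed
  also have "\<dots> = ?B * (?c * (\<Sum>R\<in>?L. Y m R ^ Suc p * (Y m R - 1)\<^sup>2) + ?d * (\<Sum>R\<in>?L. Y m R ^ (p + 3)))"
    by (simp only: sum_distrib_left[symmetric] sum.distrib)
  finally have "deviation (Suc m) p \<le> ?B * (?c * (\<Sum>R\<in>?L. Y m R ^ Suc p * (Y m R - 1)\<^sup>2) + ?d * (\<Sum>R\<in>?L. Y m R ^ (p + 3))) / (total m * ?B)"
    unfolding deviation_def s total_Suc using tpos Bpos by (intro divide_right_mono) auto
  also have "\<dots> = ?c * deviation m (Suc p) + ?d * moment m (p + 3)"
    using Bpos by (simp add: deviation_def moment_def add_divide_distrib)
  also have "\<dots> \<le> ?c * deviation m (Suc p) + ?d * exp A"
    using p m A pmax_ge_2 by (intro add_left_mono mult_left_mono moment_upper) auto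
  finally show ?thesis .
qed

lemma deviation_bound:
  assumes "m \<le> M" "real p + real m + 2 \<le> pmax"
  shows "deviation m p \<le> real m * ((1 + \<delta> + 1 / pmax) ^ m * (12 * A\<^sup>2 * pmax / real n ^ 4 * exp A))"
  using assms
proof (induction m arbitrary: p)
  case 0
  then show ?case using Y_empty by (simp add: deviation_def latin_rectangles_0)
next
  case (Suc m p)
  let ?c = "1 + \<delta> + 1 / pmax" and ?d = "12 * A\<^sup>2 * pmax / real n ^ 4 * exp A"
  have c1: "1 \<le> ?c" using delta_nonneg pmax_ge_2 by simp
  have d0: "0 \<le> ?d" using pmax_ge_2 by simp
  have m: "m < M" using Suc.prems by simp
  have "deviation (Suc m) p \<le> ?c * deviation m (Suc p) + ?d"
    using Suc.prems by (intro deviation_recursion[OF m]) auto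
  also have "\<dots> \<le> ?c * (real m * (?c ^ m * ?d)) + ?c ^ Suc m * ?d"
  proof (intro add_mono mult_left_mono)
    show "deviation m (Suc p) \<le> real m * (?c ^ m * ?d)" using Suc.prems by (intro Suc.IH) auto
    have "1 * ?d \<le> ?c ^ Suc m * ?d" using one_le_power[OF c1] d0 by (intro mult_right_mono)
    then show "?d \<le> ?c ^ Suc m * ?d" by simp
  qed (use c1 in simp)
  also have "\<dots> = real (Suc m) * (?c ^ Suc m * ?d)"
  proof -
    have "c * (real m * (c ^ m * d)) + c ^ Suc m * d = real (Suc m) * (c ^ Suc m * d)" for c d :: real
      by (simp add: algebra_simps)
    then show ?thesis .
  qed
  finally show ?case .
qed

text \<open>There are \<open>M\<close> additive errors of order \<open>M / n\<^sup>4\<close>. The multiplicative losses amount to at most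
\<open>exp (A + 1)\<close> because \<open>M (\<delta> + 1 / pmax) \<le> A + 1\<close>.\<close>

lemma deviation_final: "deviation M 0 \<le> 36 * A\<^sup>2 * exp (2 * A + 1) * (real M)\<^sup>2 / real n ^ 4"
proof (cases "M = 0")
  case True
  then show ?thesis using Y_empty by (simp add: deviation_def latin_rectangles_0)
next
  case False
  have Ppos: "0 < pmax" using pmax_ge_2 by linarith
  have "(1 + \<delta> + 1 / pmax) ^ M \<le> exp (\<delta> + 1 / pmax) ^ M"
    using delta_nonneg Ppos by (intro power_mono) (auto simp: add.assoc)
  also have "\<dots> = exp (real M * (\<delta> + 1 / pmax))" by (simp add: exp_of_nat_mult)
  also have "\<dots> \<le> exp (A + 1)"
  proof -
    have "real M * (\<delta> + 1 / pmax) \<le> pmax * (\<delta> + 1 / pmax)"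
      using delta_nonneg Ppos by (intro mult_right_mono) (auto simp: pmax_def)
    also have "\<dots> = \<delta> * pmax + 1" using Ppos by (simp add: distrib_left)
    also have "\<dots> \<le> A + 1" using delta_pmax A by linarith
    finally show ?thesis by simp
  qed
  finally have c: "(1 + \<delta> + 1 / pmax) ^ M \<le> exp (A + 1)" .
  have "deviation M 0 \<le> real M * ((1 + \<delta> + 1 / pmax) ^ M * (12 * A\<^sup>2 * pmax / real n ^ 4 * exp A))"
    by (rule deviation_bound) (auto simp: pmax_def)
  also have "\<dots> \<le> real M * (exp (A + 1) * (12 * A\<^sup>2 * (3 * real M) / real n ^ 4 * exp A))"
  proof (intro mult_left_mono mult_mono divide_right_mono c)
    show "pmax \<le> 3 * real M" using False by (simp add: pmax_def)
  qed (use Ppos in auto)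
  also have "\<dots> = 36 * A\<^sup>2 * (exp (A + 1) * exp A) * (real M)\<^sup>2 / real n ^ 4"
    by (simp add: power2_eq_square)
  also have "exp (A + 1) * exp A = exp (2 * A + 1)" by (simp flip: exp_add)
  finally show ?thesis .
qed

text \<open>The moment of order 0 is the quotient of the actual and the predicted number of rectangles. It converts
averages with respect to \<open>total M\<close> into averages over the rectangles.\<close>

lemma card_lower: "total M / 2 \<le> real (card (latin_rectangles M n))"
proof -
  have "1 - \<delta> * real M \<le> moment M 0" using moment_bounds[of M 0] by (simp add: pmax_def)
  then have "1/2 \<le> moment M 0" using delta_M by linarith
  then show ?thesis using total_pos[of M] by (simp add: moment_def field_simps)
qed

text \<open>By the Cauchy-Schwarz inequality, from the second moment \<open>deviation M 0\<close>.\<close>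

lemma mean_absolute_deviation:
  "(\<Sum>R\<in>latin_rectangles M n. \<bar>Y M R - 1\<bar>) / real (card (latin_rectangles M n))
    \<le> sqrt (72 * A\<^sup>2 * exp (2 * A + 1)) * (real M / (real n)\<^sup>2)"
proof -
  let ?L = "latin_rectangles M n"
  let ?c = "real (card ?L)"
  have tpos: "0 < total M" by (rule total_pos) simp
  have cpos: "0 < ?c" using card_lower tpos by linarith
  have npos: "0 < real n" using n_ge_8 by linarith
  let ?s = "\<Sum>R\<in>?L. \<bar>Y M R - 1\<bar>"
  have "?s\<^sup>2 \<le> (\<Sum>R\<in>?L. \<bar>Y M R - 1\<bar>\<^sup>2) * (\<Sum>R\<in>?L. 1\<^sup>2)"
    using Cauchy_Schwarz_ineq_sum[of "\<lambda>R. \<bar>Y M R - 1\<bar>" "\<lambda>_. 1" ?L] by simp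
  also have "\<dots> = (total M * deviation M 0) * ?c" using tpos by (simp add: deviation_def)
  finally have "?s\<^sup>2 / ?c\<^sup>2 \<le> (total M * deviation M 0) * ?c / ?c\<^sup>2" by (intro divide_right_mono) auto
  also have "\<dots> = deviation M 0 * (total M / ?c)" using cpos by (simp add: power2_eq_square)
  also have "\<dots> \<le> deviation M 0 * 2"
  proof (rule mult_left_mono)
    show "total M / ?c \<le> 2" using card_lower cpos by (simp add: divide_le_eq)
    show "0 \<le> deviation M 0" unfolding deviation_def using tpos by (intro divide_nonneg_nonneg sum_nonneg) auto
  qed
  also have "\<dots> \<le> 36 * A\<^sup>2 * exp (2 * A + 1) * (real M)\<^sup>2 / real n ^ 4 * 2" using deviation_final by simp
  also have "\<dots> = (sqrt (72 * A\<^sup>2 * exp (2 * A + 1)) * (real M / (real n)\<^sup>2))\<^sup>2"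
    by (simp add: power_mult_distrib power_divide flip: power_mult)
  finally have "(?s / ?c)\<^sup>2 \<le> (sqrt (72 * A\<^sup>2 * exp (2 * A + 1)) * (real M / (real n)\<^sup>2))\<^sup>2" by (simp add: power_divide)
  then show ?thesis by (rule power2_le_imp_le) simp
qed

end

section \<open>Uniformity in the number of rows\<close>

text \<open>The truncation length can be of order \<open>ln n\<close>.\<close>

lemma truncation_exists: "\<exists>N0. \<forall>n\<ge>N0. \<exists>k\<ge>1. n ^ 4 \<le> 2 ^ k \<and> (40 * k + 20)\<^sup>2 \<le> n \<and> 2 * (40 * k + 20) \<le> n"
proof -
  have "eventually (\<lambda>n::nat. (40 * (4 * log 2 (real n) + 2) + 20)\<^sup>2 \<le> real n) at_top"
    by real_asymp
  moreover have "eventually (\<lambda>n::nat. 2 * (40 * (4 * log 2 (real n) + 2) + 20) \<le> real n) at_top"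
    by real_asymp
  ultimately have "eventually (\<lambda>n::nat. \<exists>k\<ge>1. n ^ 4 \<le> 2 ^ k \<and> (40 * k + 20)\<^sup>2 \<le> n \<and> 2 * (40 * k + 20) \<le> n) at_top"
    using eventually_ge_at_top[of "1::nat"]
  proof eventually_elim
    case (elim n)
    \<comment> \<open>The added 1 ensures \<open>k \<ge> 1\<close> even for \<open>n = 1\<close>.\<close>
    define k where "k = nat \<lceil>4 * log 2 (real n)\<rceil> + 1"
    have l0: "0 \<le> log 2 (real n)" using elim by simp
    have k1: "4 * log 2 (real n) \<le> real k" "real k \<le> 4 * log 2 (real n) + 2" using l0 by (auto simp: k_def) linarith+
    have "real n ^ 4 = 2 powr (4 * log 2 (real n))"
      using elim by (simp add: powr_powr[symmetric] mult.commute[of 4] powr_numeral)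
    also have "\<dots> \<le> 2 powr (real k)" using k1 by simp
    also have "\<dots> = 2 ^ k" by (simp add: powr_realpow)
    finally have "real (n ^ 4) \<le> real (2 ^ k)" by simp
    then have 1: "n ^ 4 \<le> 2 ^ k" by (simp only: of_nat_le_iff)
    have "(real (40 * k + 20))\<^sup>2 \<le> (40 * (4 * log 2 (real n) + 2) + 20)\<^sup>2" using k1 by (intro power_mono) auto
    then have "real ((40 * k + 20)\<^sup>2) \<le> real n" using elim unfolding of_nat_power by linarith
    then have 2: "(40 * k + 20)\<^sup>2 \<le> n" by (simp only: of_nat_le_iff)
    have "real (2 * (40 * k + 20)) \<le> real n" using k1 elim by simp
    then have 3: "2 * (40 * k + 20) \<le> n" by (simp only: of_nat_le_iff)
    show ?case using 1 2 3 by (intro exI[of _ k]) (auto simp: k_def)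
  qed
  then show ?thesis by (simp add: eventually_at_top_linorder)
qed

text \<open>Both \<open>C\<close> and \<open>\<epsilon>\<close> are absolute; the growth condition on \<open>K\<close> eventually places \<open>m\<close> below \<open>\<epsilon> n\<close>.\<close>

lemma uniform_estimate:
  "\<exists>C \<epsilon>. 0 < \<epsilon> \<and> (\<exists>N0. \<forall>n\<ge>N0. \<forall>m. real m \<le> \<epsilon> * real n \<longrightarrow> Suc m < n \<and> latin_rectangles m n \<noteq> {} \<and>
     (\<Sum>R\<in>latin_rectangles m n. \<bar>real (extension_count n R) / extension_approx m n - 1\<bar>) / real (card (latin_rectangles m n))
       \<le> C * (real m / (real n)\<^sup>2))"
proof -
  define A1 :: real where "A1 = 81 * exp 6 * 2004 + (1 + exp 2) * 11 + 16"
  define A where "A = A1 * exp 3 + (236 * 1920\<^sup>2 + A1\<^sup>2) * exp 6"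
  have A1: "1 \<le> A1" by (simp add: A1_def add_nonneg_nonneg)
  have A: "1 \<le> A"
  proof -
    have "1 * 1 \<le> A1 * exp (3::real)" using A1 by (intro mult_mono) auto
    moreover have "0 \<le> (236 * 1920\<^sup>2 + A1\<^sup>2) * exp (6::real)" by simp
    ultimately show ?thesis unfolding A_def by linarith
  qed
  \<comment> \<open>As \<open>A \<ge> 1\<close>, this gives \<open>160 m \<le> n\<close> for the graph of free cells, and \<open>4 A m \<le> n\<close> with room for the added constants.\<close>
  define \<epsilon> where "\<epsilon> = 1 / (160 * A)"
  have eps: "0 < \<epsilon>" using A by (simp add: \<epsilon>_def)
  obtain N1 where N1: "\<And>n. n \<ge> N1 \<Longrightarrow> \<exists>k\<ge>1. n ^ 4 \<le> 2 ^ k \<and> (40 * k + 20)\<^sup>2 \<le> n \<and> 2 * (40 * k + 20) \<le> n"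
    using truncation_exists by blast
  define N0 where "N0 = max N1 (max 64 (nat \<lceil>16 * A\<rceil>))"
  have main: "Suc m < n \<and> latin_rectangles m n \<noteq> {} \<and>
     (\<Sum>R\<in>latin_rectangles m n. \<bar>real (extension_count n R) / extension_approx m n - 1\<bar>) / real (card (latin_rectangles m n))
       \<le> sqrt (72 * A\<^sup>2 * exp (2 * A + 1)) * (real m / (real n)\<^sup>2)"
    if n: "n \<ge> N0" and m: "real m \<le> \<epsilon> * real n" for n m
  proof -
    have nn: "N1 \<le> n" "64 \<le> n" "16 * A \<le> real n" using n by (auto simp: N0_def)
    obtain k where k: "1 \<le> k" "n ^ 4 \<le> 2 ^ k" "(40 * k + 20)\<^sup>2 \<le> n" "2 * (40 * k + 20) \<le> n" using N1[OF nn(1)] by blast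
    have m160: "160 * (A * real m) \<le> real n"
      using m A by (simp add: \<epsilon>_def field_simps)
    have "160 * real m \<le> 160 * (A * real m)" using A mult_right_mono[of 1 A "real m"] by simp
    then have mm: "160 * m \<le> n" using m160 by linarith
    note est = growth_factor_estimates[OF nn(2) _ _ k, folded A1_def, folded A_def]
    interpret extension_moments n m A
    proof
      show "1 \<le> A" by (rule A)
      have "4 * A * (real m + 2) = 4 * (A * real m) + 8 * A" by (simp add: algebra_simps)
      also have "\<dots> \<le> real n" using m160 nn(3) A by (smt (verit) mult_nonneg_nonneg of_nat_0_le_iff)
      finally show "4 * A * (real m + 2) \<le> real n" .
    next
      fix m' R assume *: "m' < m" "R \<in> latin_rectangles m' n"
      then have m': "160 * m' \<le> n" using mm by linarith
      show "0 < extension_count n R" by (rule est(1)[OF m' *(2)])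
      show "\<bar>\<Sum>r\<in>extensions n R. growth_factor n R r - 1\<bar> \<le> real (card (extensions n R)) * (A / (real n)\<^sup>2)"
        by (rule est(3)[OF m' *(2)])
      show "(\<Sum>r\<in>extensions n R. (growth_factor n R r - 1)\<^sup>2) \<le> real (card (extensions n R)) * (A * (real m' + 1) / real n ^ 4)"
        by (rule est(4)[OF m' *(2)])
      fix r assume r: "r \<in> extensions n R"
      show "\<bar>growth_factor n R r - 1\<bar> \<le> A / real n" by (rule est(2)[OF m' *(2) r])
    qed
    have "0 < real (card (latin_rectangles m n))" using card_lower total_pos[of m] by simp
    then have "latin_rectangles m n \<noteq> {}" by (metis card.empty less_irrefl of_nat_0)
    then show ?thesis using mean_absolute_deviation M_less unfolding Y_def by blast
  qed
  show ?thesis using eps main by blast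
qed

theorem theorem6p3:
  shows "\<exists>C::real. \<forall>K::nat \<Rightarrow> nat. (\<lambda>n. real (K n)) \<in> o(\<lambda>n. real n) \<longrightarrow>
    (\<exists>n0::nat. \<forall>n\<ge>n0. \<forall>m\<le>K n.
       measure_pmf.expectation (pmf_of_set (latin_rectangles m n))
         (\<lambda>R. \<bar>real (extension_count n R) / extension_approx m n - 1\<bar>)
         \<le> C * (real m / (real n)\<^sup>2) \<and>
       \<bar>real (latin_count (m + 1) n) / (real (latin_count m n) * extension_approx m n) - 1\<bar>
         \<le> C * (real m / (real n)\<^sup>2))"
proof -
  obtain C \<epsilon> N0 where eps: "0 < \<epsilon>" and est: "\<And>n m. n \<ge> N0 \<Longrightarrow> real m \<le> \<epsilon> * real n \<Longrightarrow> Suc m < n \<and> latin_rectangles m n \<noteq> {} \<and>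
     (\<Sum>R\<in>latin_rectangles m n. \<bar>real (extension_count n R) / extension_approx m n - 1\<bar>) / real (card (latin_rectangles m n))
       \<le> C * (real m / (real n)\<^sup>2)"
    using uniform_estimate by metis
  show ?thesis
  proof (intro exI[of _ C] allI impI)
    fix K :: "nat \<Rightarrow> nat" assume K: "(\<lambda>n. real (K n)) \<in> o(\<lambda>n. real n)"
    from landau_o.smallD[OF K eps] obtain N1 where N1: "\<And>n. n \<ge> N1 \<Longrightarrow> real (K n) \<le> \<epsilon> * real n"
      unfolding eventually_at_top_linorder by auto
    show "\<exists>n0. \<forall>n\<ge>n0. \<forall>m\<le>K n.
       measure_pmf.expectation (pmf_of_set (latin_rectangles m n))
         (\<lambda>R. \<bar>real (extension_count n R) / extension_approx m n - 1\<bar>)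
         \<le> C * (real m / (real n)\<^sup>2) \<and>
       \<bar>real (latin_count (m + 1) n) / (real (latin_count m n) * extension_approx m n) - 1\<bar>
         \<le> C * (real m / (real n)\<^sup>2)"
    proof (intro exI[of _ "max N0 N1"] allI impI)
      fix n m assume n: "max N0 N1 \<le> n" and m: "m \<le> K n"
      let ?L = "latin_rectangles m n" and ?B = "extension_approx m n"
      have "real m \<le> \<epsilon> * real n" using N1[of n] n m by (meson le_trans max.bounded_iff of_nat_mono order_trans)
      then have e: "Suc m < n" "?L \<noteq> {}"
        "(\<Sum>R\<in>?L. \<bar>real (extension_count n R) / ?B - 1\<bar>) / real (card ?L) \<le> C * (real m / (real n)\<^sup>2)"
        using est[of n m] n by auto
      have fin: "finite ?L" by (rule finite_latin_rectangles)
      have cpos: "0 < real (card ?L)" using e(2) fin by (simp add: card_gt_0_iff)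
      have Bpos: "0 < ?B" using e(1) by (intro extension_approx_pos) simp
      have ex: "measure_pmf.expectation (pmf_of_set ?L) (\<lambda>R. \<bar>real (extension_count n R) / ?B - 1\<bar>)
        = (\<Sum>R\<in>?L. \<bar>real (extension_count n R) / ?B - 1\<bar>) / real (card ?L)"
        by (rule integral_pmf_of_set[OF e(2) fin])
      have "real (latin_count (m + 1) n) = (\<Sum>R\<in>?L. real (extension_count n R))"
        using sum_latin_rectangles_Suc[of m n "\<lambda>_. 1"] e(1) by (simp add: latin_count_def extension_count_eq)
      then have "real (latin_count (m + 1) n) / (real (latin_count m n) * ?B) - 1 = (\<Sum>R\<in>?L. real (extension_count n R) / ?B - 1) / real (card ?L)"
        using cpos Bpos by (simp add: latin_count_def sum_subtractf sum_divide_distrib[symmetric] field_simps)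
      also have "\<bar>\<dots>\<bar> \<le> (\<Sum>R\<in>?L. \<bar>real (extension_count n R) / ?B - 1\<bar>) / real (card ?L)"
        using cpos by (simp add: divide_right_mono sum_abs)
      finally show "measure_pmf.expectation (pmf_of_set ?L)
         (\<lambda>R. \<bar>real (extension_count n R) / ?B - 1\<bar>)
         \<le> C * (real m / (real n)\<^sup>2) \<and>
       \<bar>real (latin_count (m + 1) n) / (real (latin_count m n) * ?B) - 1\<bar>
         \<le> C * (real m / (real n)\<^sup>2)"
        using e(3) unfolding ex by linarith
    qed
  qed
qed

end
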